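(* Let $A(\cdot)$ be piecewise constant, with values invertible diagonalizable $n\times n$ complex matrices, and let $L$ be the operator $(Lf)(x)=A(x)f'(x)$ in $L^2((\alpha,\beta),\mathbb{C}^n)$ with boundary conditions $f(\alpha)\in\mathbb{C}u$ and $\langle f(\beta),v\rangle=0$, where $u,v\in\mathbb{C}^n$ are both non-zero. Let $b(x)$ be the length of the boundary of $K(x)$, where $K(x)$ is the convex hull of the eigenvalues of $A(x)^{-1}$. Let $N(E)$ be the number of eigenvalues $z$ of $L$ with $|z|\le E$. Then, under the genericity assumption stated in the context, $$N(E)=\frac{E}{2\pi}\int_\alpha^\beta b(x)\,dx+O(1)$$ as $E\to\infty$.
   Context: Let $\alpha=\alpha_0<\alpha_1<\dots<\alpha_m=\beta$ be real and $A(x)=A_s$ for $\alpha_{s-1}<x\le\alpha_s$. The domain of $L$ is the set of $f\in W^{1,2}((\alpha,\beta),\mathbb{C}^n)$ satisfying the boundary conditions. Write $A_s=V_s\,\mathrm{diag}(a_{s,1},\dots,a_{s,n})V_s^{-1}$ and $D_s=\mathrm{diag}(a_{s,1}^{-1},\dots,a_{s,n}^{-1})(\alpha_s-\alpha_{s-1})$. The eigenvalues of $L$ are the zeros of the entire function $$F(z)=\langle V_m e^{zD_m}V_m^{-1}\cdots V_1e^{zD_1}V_1^{-1}u,v\rangle.$$ For each function $t:\{1,\dots,m\}\to\{1,\dots,n\}$ define $\gamma_t\in\mathbb{C}$ by $\overline{\gamma_t}=\sum_{s=1}^m a_{s,t(s)}^{-1}(\alpha_s-\alpha_{s-1})$,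 let $\Gamma$ be the finite set of distinct values of the $\gamma_t$, and let $K$ be the convex hull of $\Gamma$. Expanding gives $F(z)=\sum_{\gamma\in\Gamma}\delta_\gamma e^{z\overline{\gamma}}$ for unique coefficients $\delta_\gamma\in\mathbb{C}$. Genericity assumption: $\delta_\gamma\ne0$ for every vertex $\gamma$ of $K$, and no $\gamma\in\Gamma$ lies on an edge of $K$ unless it is a vertex of $K$. Convention: the length of the boundary of a segment is twice its length, and that of a point is $0$. *)

theory Defs
  imports "HOL-Analysis.Analysis" "HOL-Library.Landau_Symbols"
begin

(* The Hermitian inner product, linear in the first argument; the library's
   inner product on complex ^ 'n is its real part. *)
definition cinner :: "complex ^ 'n \<Rightarrow> complex ^ 'n \<Rightarrow> complex" where
  "cinner x y = (\<Sum>i\<in>UNIV. x $ i * cnj (y $ i))"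

definition diag :: "('n \<Rightarrow> complex) \<Rightarrow> complex ^ 'n ^ 'n" where
  "diag d = (\<chi> i j. if i = j then d i else 0)"

definition matrix_eigenvalues :: "complex ^ 'n ^ 'n \<Rightarrow> complex set" where
  "matrix_eigenvalues B = {\<mu>. \<exists>w. w \<noteq> 0 \<and> B *v w = \<mu> *s w}"

definition L2_on :: "real \<Rightarrow> real \<Rightarrow> (real \<Rightarrow> complex ^ 'n) \<Rightarrow> bool" where
  "L2_on \<alpha> \<beta> f \<longleftrightarrow>
     set_borel_measurable lborel {\<alpha><..<\<beta>} f \<and>
     set_integrable lborel {\<alpha><..<\<beta>} (\<lambda>x. (norm (f x))\<^sup>2)"

(* Test functions are C^1 functions with compact support in the open interval,
   a standard choice in one dimension; it gives the same weak derivatives as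
   smooth test functions. *)
definition test_function :: "real \<Rightarrow> real \<Rightarrow> (real \<Rightarrow> real) \<Rightarrow> bool" where
  "test_function \<alpha> \<beta> \<phi> \<longleftrightarrow>
     \<phi> C1_differentiable_on UNIV \<and> closure {x. \<phi> x \<noteq> 0} \<subseteq> {\<alpha><..<\<beta>}"

definition weak_deriv ::
    "real \<Rightarrow> real \<Rightarrow> (real \<Rightarrow> complex ^ 'n) \<Rightarrow> (real \<Rightarrow> complex ^ 'n) \<Rightarrow> bool" where
  "weak_deriv \<alpha> \<beta> f g \<longleftrightarrow>
     (\<forall>\<phi>. test_function \<alpha> \<beta> \<phi> \<longrightarrow>
        (LINT x:{\<alpha><..<\<beta>}|lborel. deriv \<phi> x *\<^sub>R f x) =
        - (LINT x:{\<alpha><..<\<beta>}|lborel. \<phi> x *\<^sub>R g x))"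

(* An element of W^{1,2} is represented by its continuous representative on the
   closed interval, so that the boundary values f \<alpha> and f \<beta> make sense. *)
definition W12 :: "real \<Rightarrow> real \<Rightarrow> (real \<Rightarrow> complex ^ 'n) set" where
  "W12 \<alpha> \<beta> = {f. continuous_on {\<alpha>..\<beta>} f \<and> L2_on \<alpha> \<beta> f \<and>
                  (\<exists>g. L2_on \<alpha> \<beta> g \<and> weak_deriv \<alpha> \<beta> f g)}"

definition L_domain ::
    "real \<Rightarrow> real \<Rightarrow> complex ^ 'n \<Rightarrow> complex ^ 'n \<Rightarrow> (real \<Rightarrow> complex ^ 'n) set" where
  "L_domain \<alpha> \<beta> u v =
     {f \<in> W12 \<alpha> \<beta>. (\<exists>c. f \<alpha> = c *s u) \<and> cinner (f \<beta>) v = 0}"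

(* The graph of L. Weak derivatives, and hence L f, are determined only almost
   everywhere. *)
definition L_graph ::
    "real \<Rightarrow> real \<Rightarrow> (real \<Rightarrow> complex ^ 'n ^ 'n) \<Rightarrow> complex ^ 'n \<Rightarrow> complex ^ 'n \<Rightarrow>
     ((real \<Rightarrow> complex ^ 'n) \<times> (real \<Rightarrow> complex ^ 'n)) set" where
  "L_graph \<alpha> \<beta> A u v =
     {(f, h). f \<in> L_domain \<alpha> \<beta> u v \<and> L2_on \<alpha> \<beta> h \<and>
        (\<exists>g. L2_on \<alpha> \<beta> g \<and> weak_deriv \<alpha> \<beta> f g \<and>
             (AE x in lborel. \<alpha> < x \<and> x < \<beta> \<longrightarrow> h x = A x *v g x))}"

definition L_eigenvalues ::
    "real \<Rightarrow> real \<Rightarrow> (real \<Rightarrow> complex ^ 'n ^ 'n) \<Rightarrow> complex ^ 'n \<Rightarrow> complex ^ 'n \<Rightarrow>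
     complex set" where
  "L_eigenvalues \<alpha> \<beta> A u v =
     {z. \<exists>f. \<not> (AE x in lborel. \<alpha> < x \<and> x < \<beta> \<longrightarrow> f x = 0) \<and>
             (f, \<lambda>x. z *s f x) \<in> L_graph \<alpha> \<beta> A u v}"

(* For convex polygons: the sum of the edge lengths. A segment is its own single
   edge (aff_dim 1) and counts twice; a point has no edges. *)
definition boundary_length :: "complex set \<Rightarrow> real" where
  "boundary_length K =
     (if aff_dim K = 1 then 2 else 1) * (\<Sum>e | e edge_of K. diameter e)"

(* p s is the breakpoint \<alpha>_s, and the s-th factor of the product is
   V_s exp(z D_s) V_s^{-1}, the exponential of a diagonal matrix being taken
   entrywise on the diagonal. *)
fun propagator ::
    "(nat \<Rightarrow> real) \<Rightarrow> (nat \<Rightarrow> complex ^ 'n ^ 'n) \<Rightarrow> (nat \<Rightarrow> 'n \<Rightarrow> complex) \<Rightarrow>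
     complex \<Rightarrow> nat \<Rightarrow> complex ^ 'n ^ 'n" where
  "propagator p V a z 0 = mat 1"
| "propagator p V a z (Suc s) =
     V (Suc s) **
     diag (\<lambda>i. exp (z * (inverse (a (Suc s) i) * of_real (p (Suc s) - p s)))) **
     matrix_inv (V (Suc s)) ** propagator p V a z s"

definition char_fun ::
    "nat \<Rightarrow> (nat \<Rightarrow> real) \<Rightarrow> (nat \<Rightarrow> complex ^ 'n ^ 'n) \<Rightarrow> (nat \<Rightarrow> 'n \<Rightarrow> complex) \<Rightarrow>
     complex ^ 'n \<Rightarrow> complex ^ 'n \<Rightarrow> complex \<Rightarrow> complex" where
  "char_fun m p V a u v z = cinner (propagator p V a z m *v u) v"

definition gamma ::
    "nat \<Rightarrow> (nat \<Rightarrow> real) \<Rightarrow> (nat \<Rightarrow> 'n \<Rightarrow> complex) \<Rightarrow> (nat \<Rightarrow> 'n) \<Rightarrow> complex" where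
  "gamma m p a t =
     cnj (\<Sum>s = 1..m. inverse (a s (t s)) * of_real (p s - p (s - 1)))"

definition Gamma_set ::
    "nat \<Rightarrow> (nat \<Rightarrow> real) \<Rightarrow> (nat \<Rightarrow> 'n::finite \<Rightarrow> complex) \<Rightarrow> complex set" where
  "Gamma_set m p a = gamma m p a ` ({1..m} \<rightarrow>\<^sub>E UNIV)"

(* The coefficients \<delta>_\<gamma>, extended by 0 outside \<Gamma>; they exist by expanding the
   product and are unique by linear independence of exponentials (lemma
   exp_coeffs_ex1 below). *)
definition exp_coeffs ::
    "nat \<Rightarrow> (nat \<Rightarrow> real) \<Rightarrow> (nat \<Rightarrow> complex ^ 'n ^ 'n) \<Rightarrow> (nat \<Rightarrow> 'n::finite \<Rightarrow> complex) \<Rightarrow>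
     complex ^ 'n \<Rightarrow> complex ^ 'n \<Rightarrow> complex \<Rightarrow> complex" where
  "exp_coeffs m p V a u v =
     (THE \<delta>. (\<forall>\<gamma>. \<gamma> \<notin> Gamma_set m p a \<longrightarrow> \<delta> \<gamma> = 0) \<and>
        (\<forall>z. char_fun m p V a u v z =
               (\<Sum>\<gamma>\<in>Gamma_set m p a. \<delta> \<gamma> * exp (z * cnj \<gamma>))))"

lemma exp_sum_zero:
  fixes d :: "complex \<Rightarrow> complex"
  assumes "finite S" and "\<And>z. (\<Sum>\<gamma>\<in>S. d \<gamma> * exp (z * cnj \<gamma>)) = 0"
  shows "\<forall>\<gamma>\<in>S. d \<gamma> = 0"
  using assms
proof (induction S arbitrary: d rule: finite_induct)
  case empty
  then show ?case by simp
next
  case (insert g S)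
  have shifted: "d g + (\<Sum>\<gamma>\<in>S. d \<gamma> * exp (z * (cnj \<gamma> - cnj g))) = 0" for z
  proof -
    have "(d g * exp (z * cnj g) + (\<Sum>\<gamma>\<in>S. d \<gamma> * exp (z * cnj \<gamma>))) * exp (- z * cnj g) = 0"
      using insert.prems[of z] insert.hyps by simp
    then show ?thesis
      by (simp add: distrib_right sum_distrib_right mult.assoc right_diff_distrib
          flip: exp_add)
  qed
  have "(\<Sum>\<gamma>\<in>S. d \<gamma> * (cnj \<gamma> - cnj g) * exp (z * cnj \<gamma>)) = 0" for z
  proof -
    have "((\<lambda>z. d g + (\<Sum>\<gamma>\<in>S. d \<gamma> * exp (z * (cnj \<gamma> - cnj g)))) has_field_derivative
        (\<Sum>\<gamma>\<in>S. d \<gamma> * (exp (z * (cnj \<gamma> - cnj g)) * (cnj \<gamma> - cnj g)))) (at z)"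
      by (auto intro!: derivative_eq_intros sum.cong)
    moreover have "((\<lambda>z. d g + (\<Sum>\<gamma>\<in>S. d \<gamma> * exp (z * (cnj \<gamma> - cnj g)))) has_field_derivative 0) (at z)"
      by (simp add: shifted)
    ultimately have "(\<Sum>\<gamma>\<in>S. d \<gamma> * (exp (z * (cnj \<gamma> - cnj g)) * (cnj \<gamma> - cnj g))) = 0"
      by (rule DERIV_unique)
    then have "(\<Sum>\<gamma>\<in>S. d \<gamma> * (exp (z * (cnj \<gamma> - cnj g)) * (cnj \<gamma> - cnj g))) * exp (z * cnj g) = 0"
      by simp
    moreover have "(\<Sum>\<gamma>\<in>S. d \<gamma> * (exp (z * (cnj \<gamma> - cnj g)) * (cnj \<gamma> - cnj g))) * exp (z * cnj g)
        = (\<Sum>\<gamma>\<in>S. d \<gamma> * (cnj \<gamma> - cnj g) * exp (z * cnj \<gamma>))"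
      unfolding sum_distrib_right
      by (intro sum.cong refl) (simp add: right_diff_distrib[of z] exp_diff)
    ultimately show ?thesis by simp
  qed
  then have "\<forall>\<gamma>\<in>S. d \<gamma> * (cnj \<gamma> - cnj g) = 0"
    using insert.IH[of "\<lambda>\<gamma>. d \<gamma> * (cnj \<gamma> - cnj g)"] by blast
  then have S: "\<forall>\<gamma>\<in>S. d \<gamma> = 0"
    using insert.hyps by auto
  then have "d g = 0"
    using shifted[of 0] by simp
  with S show ?case by simp
qed

definition exp_poly_on :: "complex set \<Rightarrow> (complex \<Rightarrow> complex) \<Rightarrow> bool" where
  "exp_poly_on S f \<longleftrightarrow> (\<exists>d. \<forall>z. f z = (\<Sum>\<gamma>\<in>S. d \<gamma> * exp (z * cnj \<gamma>)))"

lemma exp_poly_on_sum: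
  assumes "\<And>i. i \<in> I \<Longrightarrow> exp_poly_on S (f i)"
  shows "exp_poly_on S (\<lambda>z. \<Sum>i\<in>I. f i z)"
proof -
  obtain d where d: "\<And>i z. i \<in> I \<Longrightarrow> f i z = (\<Sum>\<gamma>\<in>S. d i \<gamma> * exp (z * cnj \<gamma>))"
    using assms unfolding exp_poly_on_def by metis
  have "(\<Sum>i\<in>I. f i z) = (\<Sum>\<gamma>\<in>S. (\<Sum>i\<in>I. d i \<gamma>) * exp (z * cnj \<gamma>))" for z
    by (simp add: d sum_distrib_right) (rule sum.swap)
  then show ?thesis unfolding exp_poly_on_def by fast
qed

lemma exp_poly_on_cmult:
  assumes "exp_poly_on S f"
  shows "exp_poly_on S (\<lambda>z. c * f z)"
proof -
  obtain d where d: "\<And>z. f z = (\<Sum>\<gamma>\<in>S. d \<gamma> * exp (z * cnj \<gamma>))"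
    using assms unfolding exp_poly_on_def by blast
  have "c * f z = (\<Sum>\<gamma>\<in>S. (c * d \<gamma>) * exp (z * cnj \<gamma>))" for z
    by (simp add: d sum_distrib_left mult.assoc)
  then show ?thesis unfolding exp_poly_on_def by fast
qed

lemma exp_poly_on_shift:
  assumes "exp_poly_on S f" and "finite T" and "\<And>\<gamma>. \<gamma> \<in> S \<Longrightarrow> \<gamma> + cnj w \<in> T"
  shows "exp_poly_on T (\<lambda>z. exp (z * w) * f z)"
proof -
  obtain d where d: "\<And>z. f z = (\<Sum>\<gamma>\<in>S. d \<gamma> * exp (z * cnj \<gamma>))"
    using assms unfolding exp_poly_on_def by blast
  have "exp (z * w) * f z =
      (\<Sum>\<gamma>\<in>T. (if \<gamma> - cnj w \<in> S then d (\<gamma> - cnj w) else 0) * exp (z * cnj \<gamma>))" for z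
  proof -
    have "exp (z * w) * f z = (\<Sum>\<gamma>\<in>S. d \<gamma> * exp (z * cnj (\<gamma> + cnj w)))"
      by (simp add: d sum_distrib_left distrib_left exp_add mult_ac)
    also have "\<dots> = (\<Sum>\<gamma>\<in>(\<lambda>\<gamma>. \<gamma> + cnj w) ` S. d (\<gamma> - cnj w) * exp (z * cnj \<gamma>))"
      by (subst sum.reindex) (auto simp: inj_on_def)
    also have "\<dots> = (\<Sum>\<gamma>\<in>T. (if \<gamma> - cnj w \<in> S then d (\<gamma> - cnj w) else 0) * exp (z * cnj \<gamma>))"
    proof (rule sum.mono_neutral_cong_left)
      show "\<forall>i\<in>T - (\<lambda>\<gamma>. \<gamma> + cnj w) ` S.
          (if i - cnj w \<in> S then d (i - cnj w) else 0) * exp (z * cnj i) = 0"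
        by (auto simp: image_iff) (metis diff_add_cancel)
    qed (use assms in auto)
    finally show ?thesis .
  qed
  then show ?thesis unfolding exp_poly_on_def by (intro exI allI)
qed

lemma finite_Gamma_set: "finite (Gamma_set m p a)"
  by (auto simp: Gamma_set_def intro!: finite_PiE)

lemma Gamma_set_Suc:
  assumes "\<gamma> \<in> Gamma_set k p a"
  shows "\<gamma> + cnj (inverse (a (Suc k) j) * of_real (p (Suc k) - p k)) \<in> Gamma_set (Suc k) p a"
proof -
  obtain t where t: "t \<in> {1..k} \<rightarrow>\<^sub>E UNIV" and g: "\<gamma> = gamma k p a t"
    using assms unfolding Gamma_set_def by blast
  let ?t = "t(Suc k := j)"
  have "(\<Sum>s = 1..k. inverse (a s (?t s)) * complex_of_real (p s - p (s - 1)))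
      = (\<Sum>s = 1..k. inverse (a s (t s)) * complex_of_real (p s - p (s - 1)))"
    by (intro sum.cong) auto
  then have "gamma (Suc k) p a ?t =
      \<gamma> + cnj (inverse (a (Suc k) j) * of_real (p (Suc k) - p k))"
    unfolding gamma_def g by simp
  moreover have "?t \<in> {1..Suc k} \<rightarrow>\<^sub>E UNIV"
    using t by (auto simp: PiE_def extensional_def)
  ultimately show ?thesis unfolding Gamma_set_def by (metis imageI)
qed

lemma exp_poly_on_propagator:
  fixes a :: "nat \<Rightarrow> 'n::finite \<Rightarrow> complex"
  shows "exp_poly_on (Gamma_set k p a) (\<lambda>z. (propagator p V a z k *v u) $ i)"
proof (induction k arbitrary: i)
  case 0
  have "Gamma_set 0 p a = {0}"
    by (auto simp: Gamma_set_def gamma_def)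
  then show ?case
    by (auto simp: exp_poly_on_def intro!: exI[of _ "\<lambda>_. u $ i"])
next
  case (Suc k)
  let ?w = "\<lambda>j. inverse (a (Suc k) j) * complex_of_real (p (Suc k) - p k)"
  have eq: "(propagator p V a z (Suc k) *v u) $ i =
      (\<Sum>j\<in>UNIV. V (Suc k) $ i $ j * (exp (z * ?w j) *
        (\<Sum>l\<in>UNIV. matrix_inv (V (Suc k)) $ j $ l * (propagator p V a z k *v u) $ l)))" for z
    by (simp add: matrix_vector_mul_assoc[symmetric])
       (simp add: matrix_vector_mult_def diag_def if_distrib if_distribR sum.delta cong: if_cong)
  show ?case
    unfolding eq
  proof (intro exp_poly_on_sum exp_poly_on_cmult)
    fix j :: 'n
    have "exp_poly_on (Gamma_set k p a) (\<lambda>z. \<Sum>l\<in>UNIV.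
        matrix_inv (V (Suc k)) $ j $ l * (propagator p V a z k *v u) $ l)"
      by (intro exp_poly_on_sum exp_poly_on_cmult) (rule Suc.IH)
    then show "exp_poly_on (Gamma_set (Suc k) p a) (\<lambda>z. exp (z * ?w j) *
        (\<Sum>l\<in>UNIV. matrix_inv (V (Suc k)) $ j $ l * (propagator p V a z k *v u) $ l))"
      by (rule exp_poly_on_shift[OF _ finite_Gamma_set]) (rule Gamma_set_Suc)
  qed
qed

lemma exp_coeffs_ex1:
  "\<exists>!\<delta>. (\<forall>\<gamma>. \<gamma> \<notin> Gamma_set m p a \<longrightarrow> \<delta> \<gamma> = 0) \<and>
     (\<forall>z. char_fun m p V a u v z =
            (\<Sum>\<gamma>\<in>Gamma_set m p a. \<delta> \<gamma> * exp (z * cnj \<gamma>)))"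
proof (rule ex_ex1I)
  have "exp_poly_on (Gamma_set m p a)
      (\<lambda>z. \<Sum>i\<in>UNIV. cnj (v $ i) * (propagator p V a z m *v u) $ i)"
    by (intro exp_poly_on_sum exp_poly_on_cmult exp_poly_on_propagator)
  then obtain d where d: "\<And>z. char_fun m p V a u v z =
      (\<Sum>\<gamma>\<in>Gamma_set m p a. d \<gamma> * exp (z * cnj \<gamma>))"
    unfolding exp_poly_on_def char_fun_def cinner_def by (auto simp: mult.commute)
  show "\<exists>\<delta>. (\<forall>\<gamma>. \<gamma> \<notin> Gamma_set m p a \<longrightarrow> \<delta> \<gamma> = 0) \<and>
     (\<forall>z. char_fun m p V a u v z =
            (\<Sum>\<gamma>\<in>Gamma_set m p a. \<delta> \<gamma> * exp (z * cnj \<gamma>)))"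
    by (rule exI[of _ "\<lambda>\<gamma>. if \<gamma> \<in> Gamma_set m p a then d \<gamma> else 0"]) (simp add: d)
next
  fix \<delta> \<delta>'
  assume 1: "(\<forall>\<gamma>. \<gamma> \<notin> Gamma_set m p a \<longrightarrow> \<delta> \<gamma> = 0) \<and>
     (\<forall>z. char_fun m p V a u v z = (\<Sum>\<gamma>\<in>Gamma_set m p a. \<delta> \<gamma> * exp (z * cnj \<gamma>)))"
    and 2: "(\<forall>\<gamma>. \<gamma> \<notin> Gamma_set m p a \<longrightarrow> \<delta>' \<gamma> = 0) \<and>
     (\<forall>z. char_fun m p V a u v z = (\<Sum>\<gamma>\<in>Gamma_set m p a. \<delta>' \<gamma> * exp (z * cnj \<gamma>)))"
  have "(\<Sum>\<gamma>\<in>Gamma_set m p a. (\<delta> \<gamma> - \<delta>' \<gamma>) * exp (z * cnj \<gamma>)) = 0" for z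
    using conjunct2[OF 1, rule_format, of z] conjunct2[OF 2, rule_format, of z]
    by (simp add: left_diff_distrib sum_subtractf)
  then have "\<forall>\<gamma>\<in>Gamma_set m p a. \<delta> \<gamma> - \<delta>' \<gamma> = 0"
    by (rule exp_sum_zero[OF finite_Gamma_set])
  then show "\<delta> = \<delta>'"
    using 1 2 by (metis eq_iff_diff_eq_0 ext)
qed

definition generic ::
    "nat \<Rightarrow> (nat \<Rightarrow> real) \<Rightarrow> (nat \<Rightarrow> complex ^ 'n ^ 'n) \<Rightarrow> (nat \<Rightarrow> 'n::finite \<Rightarrow> complex) \<Rightarrow>
     complex ^ 'n \<Rightarrow> complex ^ 'n \<Rightarrow> bool" where
  "generic m p V a u v \<longleftrightarrow>
     (let \<Gamma> = Gamma_set m p a; K = convex hull \<Gamma> in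
       (\<forall>\<gamma>. \<gamma> extreme_point_of K \<longrightarrow> exp_coeffs m p V a u v \<gamma> \<noteq> 0) \<and>
       (\<forall>\<gamma>\<in>\<Gamma>. \<forall>e. e edge_of K \<and> \<gamma> \<in> e \<longrightarrow> \<gamma> extreme_point_of K))"

end

theory Submission
  imports Defs "HOL-Complex_Analysis.Conformal_Mappings"
begin

text \<open>
  A function \<open>f\<close> with \<open>L f = z f\<close> solves \<open>f' = z A\<^sup>-\<^sup>1 f\<close> in the weak sense. On each piece the coefficient
  is constant and diagonalisable, so \<open>f\<close> follows the matrix exponential there, and the two boundary
  conditions have a common non-zero solution exactly if the characteristic function \<open>F\<close> vanishes at
  \<open>z\<close> (\<open>eigenvalue_imp_char_fun_zero\<close>, \<open>char_fun_zero_imp_eigenvalue\<close>). The eigenvalues are therefore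
  the zeros of an exponential sum \<open>F(z) = \<Sum> \<delta>\<^sub>\<gamma> exp (z * cnj \<gamma>)\<close>.

  The modulus of the term of \<open>\<gamma>\<close> is governed by the inner product \<open>z \<bullet> \<gamma>\<close>. At a zero no single term may
  dominate, so two exponents nearly maximise this inner product, and this happens only at a bounded
  distance from the rays spanned by the outer normals of the edges of the polygon \<open>K\<close>
  (\<open>exp_sum_zeros_near_rays\<close>). Around such a ray, genericity leaves exactly two terms that compete,
  those of the two ends of the edge; all others are exponentially small. Two competing terms alone vanish on
  an arithmetic progression with step \<open>2 * pi\<close> divided by the length of the edge. Taking logarithms, the
  small terms amount to a contracting perturbation of this progression, which moves each of its
  points to exactly one zero (\<open>strip_zero_count\<close>). Distinct indices give distinct zeros, so the zeros
  are counted without multiplicity, as the eigenvalues are. Every edge thus contributes its length times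
  \<open>E / (2 * pi)\<close>, up to a bounded error, and together they contribute the perimeter of \<open>K\<close> (\<open>exp_sum_zero_count\<close>). If \<open>K\<close> is a segment, its two normals give two
  rays, in accordance with the convention for the boundary length.

  It remains to identify the perimeter of \<open>K\<close> with the integral of \<open>b\<close>. The set of exponents is a
  Minkowski sum over the pieces of the scaled and conjugated eigenvalue sets of the inverse
  coefficients. Perimeters of planar polygons are additive under Minkowski sums, because the face of
  a sum in a given direction is the sum of the parallel faces (\<open>perimeter_minkowski_sum\<close>).
\<close>

section \<open>Edges and perimeters of planar polygons\<close>

definition support_face :: "complex set \<Rightarrow> complex \<Rightarrow> complex set" where
  "support_face S \<omega> = {x \<in> S. \<forall>y\<in>S. \<omega> \<bullet> y \<le> \<omega> \<bullet> x}"

text \<open>Outer unit normals of the edges of the convex hull. When the hull is a segment, both unit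
vectors perpendicular to it qualify, so the segment is met twice: this is the convention that the
boundary of a segment has twice its length.\<close>

definition edge_normals :: "complex set \<Rightarrow> complex set" where
  "edge_normals S = {\<omega>. norm \<omega> = 1 \<and> (\<exists>x\<in>support_face S \<omega>. \<exists>y\<in>support_face S \<omega>. x \<noteq> y)}"

definition perimeter :: "complex set \<Rightarrow> real" where
  "perimeter S = (\<Sum>\<omega>\<in>edge_normals S. diameter (support_face S \<omega>))"

lemma support_face_subset: "support_face S \<omega> \<subseteq> S"
  by (auto simp: support_face_def)

lemma support_face_inner_eq:
  "x \<in> support_face S \<omega> \<Longrightarrow> y \<in> support_face S \<omega> \<Longrightarrow> \<omega> \<bullet> x = \<omega> \<bullet> y"
  by (auto simp: support_face_def intro: antisym)

lemma support_face_eq_hyperplane: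
  assumes "x \<in> S" "\<And>y. y \<in> S \<Longrightarrow> \<omega> \<bullet> y \<le> \<omega> \<bullet> x"
  shows "support_face S \<omega> = S \<inter> {y. \<omega> \<bullet> y = \<omega> \<bullet> x}"
proof -
  have "x \<in> support_face S \<omega>"
    using assms by (simp add: support_face_def)
  then have "support_face S \<omega> \<subseteq> S \<inter> {y. \<omega> \<bullet> y = \<omega> \<bullet> x}"
    using support_face_inner_eq support_face_subset by blast
  moreover have "S \<inter> {y. \<omega> \<bullet> y = \<omega> \<bullet> x} \<subseteq> support_face S \<omega>"
    using assms(2) by (auto simp: support_face_def)
  ultimately show ?thesis by blast
qed

lemma support_face_nonempty:
  assumes "finite S" "S \<noteq> {}"
  shows "support_face S \<omega> \<noteq> {}"
proof -
  have "Max ((\<bullet>) \<omega> ` S) \<in> (\<bullet>) \<omega> ` S"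
    using assms by (intro Max_in) auto
  then obtain x where "x \<in> S" "\<omega> \<bullet> x = Max ((\<bullet>) \<omega> ` S)"
    by auto
  then have "x \<in> support_face S \<omega>"
    using assms by (auto simp: support_face_def)
  then show ?thesis by blast
qed

text \<open>Coordinates on a face: the points of a face in direction \<open>\<omega>\<close> differ by real multiples of
\<open>\<i> * \<omega>\<close>, and the inner product with \<open>\<i> * \<omega>\<close> reads off the multiple.\<close>

lemma inner_unit_perp:
  fixes \<omega> d :: complex
  assumes "norm \<omega> = 1" "\<omega> \<bullet> d = 0"
  shows "\<exists>t::real. d = of_real t * (\<i> * \<omega>) \<and> \<bar>t\<bar> = norm d \<and> (\<i> * \<omega>) \<bullet> d = t"
proof -
  have sq: "(Re \<omega>)\<^sup>2 + (Im \<omega>)\<^sup>2 = 1"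
    using assms(1) by (simp add: cmod_def)
  have perp: "Re \<omega> * Re d + Im \<omega> * Im d = 0"
    using assms(2) by (simp add: inner_complex_def)
  define t where "t = (\<i> * \<omega>) \<bullet> d"
  have t: "t = Re \<omega> * Im d - Im \<omega> * Re d"
    by (simp add: t_def inner_complex_def)
  have "- t * Im \<omega> = Re d * ((Re \<omega>)\<^sup>2 + (Im \<omega>)\<^sup>2) - Re \<omega> * (Re \<omega> * Re d + Im \<omega> * Im d)"
    by (simp add: t algebra_simps power2_eq_square)
  moreover have "t * Re \<omega> = Im d * ((Re \<omega>)\<^sup>2 + (Im \<omega>)\<^sup>2) - Im \<omega> * (Re \<omega> * Re d + Im \<omega> * Im d)"
    by (simp add: t algebra_simps power2_eq_square)
  ultimately have d: "d = of_real t * (\<i> * \<omega>)"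
    by (simp add: complex_eq_iff sq perp)
  have "norm d = norm (of_real t * (\<i> * \<omega>))"
    by (rule arg_cong[OF d])
  then have "\<bar>t\<bar> = norm d"
    using assms(1) by (simp add: norm_mult)
  with d show ?thesis
    by (intro exI[of _ t]) (simp only: t_def)
qed

lemma unit_perp_cases:
  fixes \<omega> d :: complex
  assumes "norm \<omega> = 1" "d \<noteq> 0" "\<omega> \<bullet> d = 0"
  shows "\<omega> = \<i> * sgn d \<or> \<omega> = - \<i> * sgn d"
proof -
  obtain t where t: "d = of_real t * (\<i> * \<omega>)" "\<bar>t\<bar> = norm d"
    using inner_unit_perp assms by blast
  have "sgn d = sgn (of_real t * (\<i> * \<omega>))"
    by (rule arg_cong[OF t(1)])
  then have "sgn d = of_real (sgn t) * (\<i> * sgn \<omega>)"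
    by (simp only: sgn_mult sgn_of_real) (simp add: sgn_eq[of \<i>])
  then have "sgn d = of_real (sgn t) * (\<i> * \<omega>)"
    using assms(1) by (simp add: sgn_eq)
  then have "\<i> * sgn d = - (of_real (sgn t) * \<omega>)"
    by (simp only:) (simp add: complex_eq_iff)
  moreover have "t \<noteq> 0" using t assms by auto
  ultimately show ?thesis
    by (cases "t > 0") auto
qed

lemma finite_edge_normals:
  assumes "finite S"
  shows "finite (edge_normals S)"
proof (rule finite_subset)
  show "edge_normals S \<subseteq> (\<Union>x\<in>S. \<Union>y\<in>S. {\<i> * sgn (x - y), - \<i> * sgn (x - y)})"
  proof
    fix \<omega> assume "\<omega> \<in> edge_normals S"
    then obtain x y where xy: "norm \<omega> = 1" "x \<in> support_face S \<omega>" "y \<in> support_face S \<omega>" "x \<noteq> y"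
      by (auto simp: edge_normals_def)
    then have "\<omega> \<bullet> (x - y) = 0"
      using support_face_inner_eq[OF xy(2,3)] by (simp add: inner_diff_right)
    then have "\<omega> = \<i> * sgn (x - y) \<or> \<omega> = - \<i> * sgn (x - y)"
      using unit_perp_cases[of \<omega> "x - y"] xy(1,4) by simp
    moreover have "x \<in> S" "y \<in> S"
      using xy(2,3) by (simp_all add: support_face_def)
    ultimately show "\<omega> \<in> (\<Union>x\<in>S. \<Union>y\<in>S. {\<i> * sgn (x - y), - \<i> * sgn (x - y)})"
      by (intro UN_I[of x] UN_I[of y]) simp_all
  qed
  show "finite (\<Union>x\<in>S. \<Union>y\<in>S. {\<i> * sgn (x - y), - \<i> * sgn (x - y)})"
    by (intro finite_UN_I assms finite.intros)
qed

lemma diameter_convex_hull: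
  fixes A :: "'a::real_normed_vector set"
  assumes "bounded A"
  shows "diameter (convex hull A) = diameter A"
proof (rule antisym)
  show "diameter (convex hull A) \<le> diameter A"
  proof (cases "A = {}")
    case False
    have "norm (x - y) \<le> diameter A" if "x \<in> convex hull A" "y \<in> convex hull A" for x y
    proof -
      have "convex hull A \<subseteq> cball a (diameter A)" if "a \<in> A" for a
        using that diameter_bounded_bound[OF assms] by (intro hull_minimal) auto
      then have "A \<subseteq> cball x (diameter A)"
        using \<open>x \<in> convex hull A\<close> by (metis dist_commute mem_cball subset_iff)
      then have "convex hull A \<subseteq> cball x (diameter A)"
        by (intro hull_minimal) auto
      then show ?thesis using that by (auto simp: dist_norm)
    qed
    then show ?thesis using False by (intro diameter_le) (auto simp: hull_inc)
  qed simp
  show "diameter A \<le> diameter (convex hull A)"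
    by (intro diameter_subset hull_subset bounded_convex_hull assms)
qed

text \<open>The face of the hull in a given direction is the intersection with a supporting hyperplane, and
a face of the hull of a finite set is the hull of the points of the set that it contains. This
reduces all questions about edges to the finite set.\<close>

lemma support_face_convex_hull:
  assumes "finite S" "S \<noteq> {}"
  shows "support_face (convex hull S) \<omega> = convex hull (support_face S \<omega>)"
    and "support_face (convex hull S) \<omega> face_of convex hull S"
proof -
  obtain x0 where x0: "x0 \<in> support_face S \<omega>"
    using support_face_nonempty[OF assms] by blast
  define h where "h = \<omega> \<bullet> x0"
  have "S \<subseteq> {x. \<omega> \<bullet> x \<le> h}"
    using x0 by (auto simp: support_face_def h_def)
  then have le: "convex hull S \<subseteq> {x. \<omega> \<bullet> x \<le> h}"
    by (intro hull_minimal convex_halfspace_le) auto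
  have "x0 \<in> S" using x0 support_face_subset by blast
  then have "x0 \<in> convex hull S" by (rule hull_inc)
  then have K: "support_face (convex hull S) \<omega> = convex hull S \<inter> {x. \<omega> \<bullet> x = h}"
    unfolding h_def using le by (intro support_face_eq_hyperplane) (auto simp: h_def)
  have S: "support_face S \<omega> = S \<inter> {x. \<omega> \<bullet> x = h}"
    unfolding h_def using x0 by (intro support_face_eq_hyperplane) (auto simp: support_face_def)
  show face: "support_face (convex hull S) \<omega> face_of convex hull S"
    unfolding K using le by (intro face_of_Int_supporting_hyperplane_le) auto
  obtain S' where S': "S' \<subseteq> S" "support_face (convex hull S) \<omega> = convex hull S'"
    using face_of_convex_hull_subset[OF _ face] assms finite_imp_compact by metis
  have "S' \<subseteq> support_face S \<omega>"
    using S' K S hull_subset[of S' convex] by blast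
  then have "convex hull S' \<subseteq> convex hull (support_face S \<omega>)"
    by (rule hull_mono)
  moreover have "convex hull (support_face S \<omega>) \<subseteq> support_face (convex hull S) \<omega>"
    unfolding K S
    by (intro hull_minimal) (auto intro: hull_inc convex_Int convex_convex_hull convex_hyperplane)
  ultimately show "support_face (convex hull S) \<omega> = convex hull (support_face S \<omega>)"
    using S' by blast
qed

lemma edge_normal_imp_edge:
  assumes "finite S" "\<omega> \<in> edge_normals S"
  shows "support_face (convex hull S) \<omega> edge_of convex hull S"
proof -
  obtain x y where xy: "norm \<omega> = 1" "x \<in> support_face S \<omega>" "y \<in> support_face S \<omega>" "x \<noteq> y"
    using assms by (auto simp: edge_normals_def)
  let ?F = "support_face (convex hull S) \<omega>"
  have ne: "S \<noteq> {}" using xy by (auto simp: support_face_def)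
  have in_F: "x \<in> ?F" "y \<in> ?F"
    using xy by (auto simp: support_face_convex_hull(1)[OF assms(1) ne] hull_inc)
  then have "?F \<subseteq> {z. \<omega> \<bullet> z = \<omega> \<bullet> x}"
    by (auto intro: support_face_inner_eq)
  then have "aff_dim ?F \<le> aff_dim {z. \<omega> \<bullet> z = \<omega> \<bullet> x}"
    by (rule aff_dim_subset)
  also have "\<dots> = 1"
    using xy(1) by (subst aff_dim_hyperplane) auto
  finally have "aff_dim ?F \<le> 1" .
  moreover have "aff_dim {x, y} = 1"
    using xy(4) by (simp add: aff_dim_2)
  then have "1 \<le> aff_dim ?F"
    using aff_dim_subset[of "{x, y}" ?F] in_F by auto
  ultimately show ?thesis
    using support_face_convex_hull(2)[OF assms(1) ne] by (auto simp: edge_of_def)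
qed

text \<open>Faces of polytopes are exposed, so a proper edge comes with a supporting hyperplane whose
normalised normal is the required direction; a polygon that is its own edge is a segment, and a
perpendicular to it does the same.\<close>

lemma edge_obtain_normal:
  assumes "finite S" "e edge_of convex hull S"
  obtains \<omega> where "\<omega> \<in> edge_normals S" "support_face (convex hull S) \<omega> = e"
proof -
  let ?K = "convex hull S"
  have face: "e face_of ?K" and dim: "aff_dim e = 1"
    using assms by (auto simp: edge_of_def)
  have "e \<noteq> {}" using dim by auto
  then have ne: "S \<noteq> {}" using face_of_imp_subset[OF face] by auto
  have "\<exists>a b. a \<noteq> 0 \<and> ?K \<subseteq> {x. a \<bullet> x \<le> b} \<and> e = ?K \<inter> {x. a \<bullet> x = b}"
  proof (cases "e = ?K")
    case True
    then have "collinear ?K" using dim by (simp add: collinear_aff_dim)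
    then obtain d where d: "\<And>x y. x \<in> ?K \<Longrightarrow> y \<in> ?K \<Longrightarrow> \<exists>c. x - y = c *\<^sub>R d"
      unfolding collinear_def by blast
    obtain x0 where x0: "x0 \<in> ?K" using ne by (auto intro: hull_inc)
    \<comment> \<open>The spanning vector of a collinear set may be given as zero; then the set is a point and
      any direction is perpendicular to it.\<close>
    define a where "a = (if d = 0 then 1 else \<i> * d)"
    have "a \<bullet> x = a \<bullet> x0" if x: "x \<in> ?K" for x
    proof -
      obtain c where "x - x0 = c *\<^sub>R d" using d[OF x x0] by blast
      then have "a \<bullet> (x - x0) = 0" by (auto simp: a_def inner_complex_def)
      then show ?thesis by (simp add: inner_diff_right)
    qed
    moreover have "a \<noteq> 0" by (auto simp: a_def)
    ultimately show ?thesis using True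
      by (intro exI[of _ a] exI[of _ "a \<bullet> x0"]) auto
  next
    case False
    have "polyhedron ?K" using assms by (simp add: polyhedron_convex_hull)
    then have "e exposed_face_of ?K"
      using face exposed_face_of_polyhedron by blast
    then show ?thesis
      using False \<open>e \<noteq> {}\<close> by (auto simp: exposed_face_of)
  qed
  then obtain a b where ab: "a \<noteq> 0" "?K \<subseteq> {x. a \<bullet> x \<le> b}" "e = ?K \<inter> {x. a \<bullet> x = b}"
    by blast
  have inner_sgn: "sgn a \<bullet> x = a \<bullet> x / norm a" for x
    by (simp add: sgn_div_norm divide_inverse mult.commute)
  have eq: "support_face ?K (sgn a) = e"
  proof -
    obtain x0 where "x0 \<in> e" using \<open>e \<noteq> {}\<close> by blast
    then have "x0 \<in> ?K" "a \<bullet> x0 = b" using ab by auto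
    then have "support_face ?K (sgn a) = ?K \<inter> {x. sgn a \<bullet> x = sgn a \<bullet> x0}"
      using ab(1,2) by (intro support_face_eq_hyperplane) (auto simp: inner_sgn divide_right_mono)
    also have "{x. sgn a \<bullet> x = sgn a \<bullet> x0} = {x. a \<bullet> x = b}"
      using ab(1) \<open>a \<bullet> x0 = b\<close> by (simp add: inner_sgn)
    finally show ?thesis using ab(3) by simp
  qed
  moreover have "sgn a \<in> edge_normals S"
  proof (rule ccontr)
    assume "sgn a \<notin> edge_normals S"
    then have "\<And>x y. x \<in> support_face S (sgn a) \<Longrightarrow> y \<in> support_face S (sgn a) \<Longrightarrow> x = y"
      using ab(1) by (auto simp: edge_normals_def norm_sgn)
    then have "\<exists>x. support_face S (sgn a) \<subseteq> {x}"
      by blast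
    then obtain x where "support_face S (sgn a) \<subseteq> {x}" by blast
    then have "e \<subseteq> {x}"
      using hull_mono[of "support_face S (sgn a)" "{x}" convex] eq
      by (simp add: support_face_convex_hull(1)[OF assms(1) ne])
    then have "aff_dim e \<le> aff_dim {x}" by (rule aff_dim_subset)
    with dim show False by simp
  qed
  ultimately show ?thesis using that by blast
qed

text \<open>Two distinct unit normals of one edge are opposite. Both of them occur only if the whole polygon
lies in the line of the edge, that is, if it is a segment. The multiplicities are exactly the
factors in the definition of the boundary length.\<close>

lemma card_normals_of_edge:
  assumes "finite S" "e edge_of convex hull S"
  shows "card {\<omega> \<in> edge_normals S. support_face (convex hull S) \<omega> = e} =
           (if aff_dim (convex hull S) = 1 then 2 else 1)"
proof -
  let ?K = "convex hull S"
  obtain \<omega> where \<omega>: "\<omega> \<in> edge_normals S" "support_face ?K \<omega> = e"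
    using edge_obtain_normal[OF assms] .
  have unit: "norm \<omega> = 1" using \<omega> by (auto simp: edge_normals_def)
  have ne: "S \<noteq> {}" using \<omega> by (auto simp: edge_normals_def support_face_def)
  have unique: "\<omega>' = \<omega> \<or> \<omega>' = - \<omega>" if "\<omega>' \<in> edge_normals S" "support_face ?K \<omega>' = e" for \<omega>'
  proof -
    obtain x y where xy: "x \<in> support_face S \<omega>" "y \<in> support_face S \<omega>" "x \<noteq> y"
      using \<omega> by (auto simp: edge_normals_def)
    then have "x \<in> e" "y \<in> e"
      using \<omega>(2) by (auto simp: support_face_convex_hull(1)[OF assms(1) ne] hull_inc)
    then have "\<omega> \<bullet> x = \<omega> \<bullet> y" "\<omega>' \<bullet> x = \<omega>' \<bullet> y"
      using support_face_inner_eq \<omega>(2) that(2) by blast+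
    then have "\<omega> \<bullet> (x - y) = 0" "\<omega>' \<bullet> (x - y) = 0"
      by (simp_all add: inner_diff_right)
    moreover have "norm \<omega>' = 1" using that(1) by (simp add: edge_normals_def)
    ultimately show ?thesis
      using unit_perp_cases[of \<omega> "x - y"] unit_perp_cases[of \<omega>' "x - y"] unit xy(3)
      by (metis eq_iff_diff_eq_0 minus_minus mult_minus_left)
  qed
  show ?thesis
  proof (cases "aff_dim ?K = 1")
    case True
    have "e face_of ?K" "aff_dim e = 1" using assms by (auto simp: edge_of_def)
    then have "e = ?K"
      using face_of_aff_dim_lt[of ?K e] True by fastforce
    then have "support_face ?K (- \<omega>) = e"
      using support_face_inner_eq \<omega>(2) by (auto simp: support_face_def)
    moreover have "- \<omega> \<in> edge_normals S"
    proof -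
      have "S \<subseteq> support_face ?K \<omega>" using \<omega>(2) \<open>e = ?K\<close> by (auto intro: hull_inc)
      then have "\<omega> \<bullet> x = \<omega> \<bullet> y" if "x \<in> S" "y \<in> S" for x y
        using that support_face_inner_eq by blast
      then have "\<And>x y. x \<in> S \<Longrightarrow> y \<in> S \<Longrightarrow> - \<omega> \<bullet> y \<le> - \<omega> \<bullet> x"
        by (metis inner_minus_left order_refl)
      then have "S \<subseteq> support_face S (- \<omega>)"
        unfolding support_face_def by blast
      then have "support_face S \<omega> \<subseteq> support_face S (- \<omega>)"
        using support_face_subset by blast
      then show ?thesis using \<omega>(1) unfolding edge_normals_def by auto
    qed
    ultimately have "{\<omega> \<in> edge_normals S. support_face ?K \<omega> = e} = {\<omega>, - \<omega>}"
      using unique \<omega> by blast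
    moreover have "\<omega> \<noteq> - \<omega>" using unit by auto
    ultimately show ?thesis using True by simp
  next
    case False
    have "support_face ?K (- \<omega>) \<noteq> e"
    proof
      assume *: "support_face ?K (- \<omega>) = e"
      have "?K = e"
      proof -
        obtain x0 where x0: "x0 \<in> e" using \<omega> ne support_face_nonempty[OF assms(1) ne]
          by (metis convex_hull_eq_empty ex_in_conv support_face_convex_hull(1)[OF assms(1) ne])
        then have "x0 \<in> support_face ?K \<omega>" "x0 \<in> support_face ?K (- \<omega>)"
          using * \<omega>(2) by auto
        then have "\<omega> \<bullet> y = \<omega> \<bullet> x0" if "y \<in> ?K" for y
          using that by (force simp: support_face_def)
        then have "?K \<subseteq> support_face ?K \<omega>" by (auto simp: support_face_def)
        then show ?thesis using \<omega>(2) support_face_subset by blast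
      qed
      then show False using False assms by (auto simp: edge_of_def)
    qed
    then have "{\<omega> \<in> edge_normals S. support_face ?K \<omega> = e} = {\<omega>}"
      using unique \<omega> by blast
    then show ?thesis using False by simp
  qed
qed

text \<open>The sum over edges is the sum over edge normals, grouped by the edge that they expose. The sum
over normals no longer distinguishes polygons from segments and behaves well under Minkowski sums.\<close>

lemma boundary_length_convex_hull:
  assumes "finite S" "S \<noteq> {}"
  shows "boundary_length (convex hull S) = perimeter S"
proof -
  let ?K = "convex hull S"
  let ?c = "if aff_dim ?K = 1 then 2 else 1 :: real"
  have fin: "finite {e. e edge_of ?K}"
    by (rule finite_subset[OF _ finite_polytope_faces[OF polytope_convex_hull[OF assms(1)]]])
       (auto simp: edge_of_def)
  have "perimeter S = (\<Sum>\<omega>\<in>edge_normals S. diameter (support_face ?K \<omega>))"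
    unfolding perimeter_def support_face_convex_hull(1)[OF assms]
    using assms finite_subset[OF support_face_subset]
    by (intro sum.cong refl) (simp add: diameter_convex_hull finite_imp_bounded)
  also have "\<dots> = (\<Sum>e | e edge_of ?K. \<Sum>\<omega> | \<omega> \<in> edge_normals S \<and> support_face ?K \<omega> = e.
      diameter (support_face ?K \<omega>))"
    by (rule sum.group[symmetric])
       (use fin finite_edge_normals edge_normal_imp_edge assms in auto)
  also have "\<dots> = (\<Sum>e | e edge_of ?K. ?c * diameter e)"
  proof (rule sum.cong[OF refl])
    fix e assume "e \<in> {e. e edge_of ?K}"
    then show "(\<Sum>\<omega> | \<omega> \<in> edge_normals S \<and> support_face ?K \<omega> = e.
      diameter (support_face ?K \<omega>)) = ?c * diameter e"
      using card_normals_of_edge[OF assms(1), of e] by simp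
  qed
  also have "\<dots> = boundary_length ?K"
    by (simp add: boundary_length_def sum_distrib_left)
  finally show ?thesis by simp
qed

text \<open>A set inside a line perpendicular to \<open>\<omega>\<close> has as diameter the sum of its support function in the
two directions along the line. Support functions, unlike diameters, are additive for all Minkowski
sums.\<close>

lemma diameter_flat:
  assumes "finite A" "A \<noteq> {}" "norm \<omega> = 1" "\<And>x y. x \<in> A \<Longrightarrow> y \<in> A \<Longrightarrow> \<omega> \<bullet> x = \<omega> \<bullet> y"
  shows "diameter A = Max ((\<bullet>) (\<i> * \<omega>) ` A) + Max ((\<bullet>) (- (\<i> * \<omega>)) ` A)"
proof (rule antisym)
  let ?M = "\<lambda>\<nu>. Max ((\<bullet>) \<nu> ` A)"
  have dist: "norm (x - y) = \<bar>(\<i> * \<omega>) \<bullet> x - (\<i> * \<omega>) \<bullet> y\<bar>" if "x \<in> A" "y \<in> A" for x y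
    using inner_unit_perp[OF assms(3), of "x - y"] assms(4)[OF that]
    by (auto simp: inner_diff_right)
  have le: "\<nu> \<bullet> x \<le> ?M \<nu>" if "x \<in> A" for x \<nu>
    using that assms(1) by auto
  show "diameter A \<le> ?M (\<i> * \<omega>) + ?M (- (\<i> * \<omega>))"
  proof (rule diameter_le)
    fix x y assume xy: "x \<in> A" "y \<in> A"
    show "norm (x - y) \<le> ?M (\<i> * \<omega>) + ?M (- (\<i> * \<omega>))"
      using dist[OF xy] le[OF xy(1), of "\<i> * \<omega>"] le[OF xy(2), of "\<i> * \<omega>"]
        le[OF xy(1), of "- (\<i> * \<omega>)"] le[OF xy(2), of "- (\<i> * \<omega>)"]
      unfolding inner_minus_left by linarith
  qed (use assms(2) in simp)
  have "?M (\<i> * \<omega>) \<in> (\<bullet>) (\<i> * \<omega>) ` A" "?M (- (\<i> * \<omega>)) \<in> (\<bullet>) (- (\<i> * \<omega>)) ` A"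
    using assms(1,2) by (intro Max_in; simp)+
  then obtain x y where x: "x \<in> A" "(\<i> * \<omega>) \<bullet> x = ?M (\<i> * \<omega>)"
    and y: "y \<in> A" "- (\<i> * \<omega>) \<bullet> y = ?M (- (\<i> * \<omega>))"
    by (metis imageE)
  have "?M (\<i> * \<omega>) + ?M (- (\<i> * \<omega>)) \<le> norm (x - y)"
    using x(2) y(2) dist[OF x(1) y(1)] unfolding inner_minus_left by linarith
  also have "\<dots> \<le> diameter A"
    using diameter_bounded_bound[of A x y] x(1) y(1) assms(1) by (simp add: finite_imp_bounded dist_norm)
  finally show "?M (\<i> * \<omega>) + ?M (- (\<i> * \<omega>)) \<le> diameter A" .
qed

abbreviation minkowski_sum :: "complex set \<Rightarrow> complex set \<Rightarrow> complex set" where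
  "minkowski_sum S T \<equiv> (\<lambda>(x, y). x + y) ` (S \<times> T)"

lemma Max_inner_minkowski_sum:
  assumes "finite S" "finite T" "S \<noteq> {}" "T \<noteq> {}"
  shows "Max ((\<bullet>) \<nu> ` minkowski_sum S T) = Max ((\<bullet>) \<nu> ` S) + Max ((\<bullet>) \<nu> ` T)"
proof (rule Max_eqI)
  show "Max ((\<bullet>) \<nu> ` S) + Max ((\<bullet>) \<nu> ` T) \<in> (\<bullet>) \<nu> ` minkowski_sum S T"
  proof -
    have "Max ((\<bullet>) \<nu> ` S) \<in> (\<bullet>) \<nu> ` S" "Max ((\<bullet>) \<nu> ` T) \<in> (\<bullet>) \<nu> ` T"
      using assms by (intro Max_in; simp)+
    then obtain x y where x: "x \<in> S" "\<nu> \<bullet> x = Max ((\<bullet>) \<nu> ` S)"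
      and y: "y \<in> T" "\<nu> \<bullet> y = Max ((\<bullet>) \<nu> ` T)"
      by (metis imageE)
    have "\<nu> \<bullet> (x + y) \<in> (\<bullet>) \<nu> ` minkowski_sum S T" using x y by auto
    then show ?thesis by (simp add: inner_add_right x y)
  qed
qed (use assms in \<open>auto simp: inner_add_right intro!: add_mono\<close>)

lemma support_face_minkowski_sum:
  assumes "finite S" "finite T" "S \<noteq> {}" "T \<noteq> {}"
  shows "support_face (minkowski_sum S T) \<omega> =
           minkowski_sum (support_face S \<omega>) (support_face T \<omega>)"
proof
  show "minkowski_sum (support_face S \<omega>) (support_face T \<omega>) \<subseteq> support_face (minkowski_sum S T) \<omega>"
    by (auto simp: support_face_def inner_add_right intro!: add_mono)
  show "support_face (minkowski_sum S T) \<omega> \<subseteq> minkowski_sum (support_face S \<omega>) (support_face T \<omega>)"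
  proof
    fix z assume z: "z \<in> support_face (minkowski_sum S T) \<omega>"
    then obtain x y where xy: "x \<in> S" "y \<in> T" "z = x + y"
      by (auto simp: support_face_def)
    have opt: "\<omega> \<bullet> x' + \<omega> \<bullet> y' \<le> \<omega> \<bullet> x + \<omega> \<bullet> y" if "x' \<in> S" "y' \<in> T" for x' y'
    proof -
      have "x' + y' \<in> minkowski_sum S T" using that by auto
      then have "\<omega> \<bullet> (x' + y') \<le> \<omega> \<bullet> (x + y)"
        using z unfolding support_face_def xy by blast
      then show ?thesis by (simp add: inner_add_right)
    qed
    have "x \<in> support_face S \<omega>"
      using xy opt[OF _ xy(2)] by (auto simp: support_face_def)
    moreover have "y \<in> support_face T \<omega>"
      using xy opt[OF xy(1)] by (auto simp: support_face_def)
    ultimately show "z \<in> minkowski_sum (support_face S \<omega>) (support_face T \<omega>)"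
      using xy by auto
  qed
qed

lemma diameter_support_face_minkowski_sum:
  assumes "finite S" "finite T" "S \<noteq> {}" "T \<noteq> {}" "norm \<omega> = 1"
  shows "diameter (support_face (minkowski_sum S T) \<omega>) =
           diameter (support_face S \<omega>) + diameter (support_face T \<omega>)"
proof -
  have flat: "diameter (support_face R \<omega>) =
      Max ((\<bullet>) (\<i> * \<omega>) ` support_face R \<omega>) + Max ((\<bullet>) (- (\<i> * \<omega>)) ` support_face R \<omega>)"
    if "finite R" "R \<noteq> {}" for R
    by (rule diameter_flat[OF finite_subset[OF support_face_subset that(1)]
          support_face_nonempty[OF that] assms(5) support_face_inner_eq])
  have fin: "finite (support_face S \<omega>)" "finite (support_face T \<omega>)"
    using assms(1,2) by (simp_all add: finite_subset[OF support_face_subset])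
  have "finite (minkowski_sum S T)" "minkowski_sum S T \<noteq> {}" using assms by auto
  then show ?thesis
    using flat[of "minkowski_sum S T"] flat[OF assms(1,3)] flat[OF assms(2,4)]
    by (simp only: support_face_minkowski_sum[OF assms(1-4)] not_False_eq_True
        Max_inner_minkowski_sum[OF fin support_face_nonempty[OF assms(1,3)] support_face_nonempty[OF assms(2,4)]])
qed

lemma perimeter_eq_sum:
  assumes "finite S" "S \<noteq> {}" "finite W" "edge_normals S \<subseteq> W" "\<And>\<omega>. \<omega> \<in> W \<Longrightarrow> norm \<omega> = 1"
  shows "perimeter S = (\<Sum>\<omega>\<in>W. diameter (support_face S \<omega>))"
  unfolding perimeter_def
proof (rule sum.mono_neutral_left)
  show "\<forall>\<omega>\<in>W - edge_normals S. diameter (support_face S \<omega>) = 0"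
  proof
    fix \<omega> assume "\<omega> \<in> W - edge_normals S"
    moreover obtain x where "x \<in> support_face S \<omega>"
      using support_face_nonempty assms by blast
    ultimately have "support_face S \<omega> = {x}"
      using assms by (auto simp: edge_normals_def)
    then show "diameter (support_face S \<omega>) = 0" by simp
  qed
qed (use assms in auto)

text \<open>In each direction the face of a Minkowski sum is the sum of the two parallel faces, so its length
is the sum of their lengths. Directions that are edge normals of only one of the sets contribute
a face of length zero for the other.\<close>

lemma perimeter_minkowski_sum:
  assumes "finite S" "finite T" "S \<noteq> {}" "T \<noteq> {}"
  shows "perimeter (minkowski_sum S T) = perimeter S + perimeter T"
proof -
  define W where "W = edge_normals S \<union> edge_normals T \<union> edge_normals (minkowski_sum S T)"
  have W: "finite W" "\<And>\<omega>. \<omega> \<in> W \<Longrightarrow> norm \<omega> = 1"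
  proof -
    show "finite W" using assms unfolding W_def by (intro finite_UnI finite_edge_normals) auto
  qed (auto simp: W_def edge_normals_def)
  have "perimeter (minkowski_sum S T) = (\<Sum>\<omega>\<in>W. diameter (support_face (minkowski_sum S T) \<omega>))"
    using assms W by (intro perimeter_eq_sum) (auto simp: W_def)
  also have "\<dots> = (\<Sum>\<omega>\<in>W. diameter (support_face S \<omega>) + diameter (support_face T \<omega>))"
    using assms W by (intro sum.cong refl diameter_support_face_minkowski_sum)
  also have "\<dots> = perimeter S + perimeter T"
    unfolding sum.distrib
    using assms W by (intro arg_cong2[of _ _ _ _ "(+)"] perimeter_eq_sum[symmetric]) (auto simp: W_def)
  finally show ?thesis .
qed

lemma perimeter_scaled_cnj:
  assumes "finite S" "l > 0"
  shows "perimeter ((\<lambda>x. cnj (x * of_real l)) ` S) = l * perimeter S"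
proof -
  let ?f = "\<lambda>x. cnj (x * of_real l)"
  have inner: "cnj \<omega> \<bullet> ?f x = l * (\<omega> \<bullet> x)" for \<omega> x
    by (simp add: inner_complex_def algebra_simps)
  have face: "support_face (?f ` S) (cnj \<omega>) = ?f ` support_face S \<omega>" for \<omega>
    using assms by (auto simp: support_face_def inner simp del: complex_cnj_mult)
  have inj: "inj_on ?f A" for A using assms by (auto simp: inj_on_def)
  have mem: "cnj \<omega> \<in> edge_normals (?f ` S) \<longleftrightarrow> \<omega> \<in> edge_normals S" for \<omega>
    using assms(2) inj[of "support_face S \<omega>"]
    unfolding edge_normals_def mem_Collect_eq face by (auto simp: inj_on_eq_iff simp del: complex_cnj_mult)
  have normals: "edge_normals (?f ` S) = cnj ` edge_normals S"
  proof (rule set_eqI)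
    fix w
    have "w \<in> cnj ` edge_normals S \<longleftrightarrow> cnj w \<in> edge_normals S"
      by (auto intro: image_eqI[of w cnj "cnj w"])
    then show "w \<in> edge_normals (?f ` S) \<longleftrightarrow> w \<in> cnj ` edge_normals S"
      using mem[of "cnj w"] unfolding complex_cnj_cnj by blast
  qed
  have dist: "dist (?f x) (?f y) = l * dist x y" for x y
  proof -
    have "?f x - ?f y = cnj ((x - y) * of_real l)" by (simp add: algebra_simps)
    then show ?thesis using assms(2) by (simp only: dist_norm complex_mod_cnj norm_mult) simp
  qed
  have diam: "diameter (?f ` A) = l * diameter A" if A: "finite A" "A \<noteq> {}" for A
  proof (rule antisym)
    show "diameter (?f ` A) \<le> l * diameter A"
      using A assms(2) diameter_bounded_bound[of A]
      by (intro diameter_le)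
         (auto simp: dist finite_imp_bounded simp flip: dist_norm simp del: complex_cnj_mult
           intro!: mult_left_mono)
    obtain x y where xy: "x \<in> A" "y \<in> A" "dist x y = diameter A"
      using diameter_compact_attained[of A] A finite_imp_compact by blast
    have "l * diameter A = dist (?f x) (?f y)" using xy dist by simp
    also have "\<dots> \<le> diameter (?f ` A)"
      using xy A by (intro diameter_bounded_bound finite_imp_bounded) auto
    finally show "l * diameter A \<le> diameter (?f ` A)" .
  qed
  have "perimeter (?f ` S) = (\<Sum>\<omega>\<in>edge_normals S. diameter (?f ` support_face S \<omega>))"
    unfolding perimeter_def normals
    by (subst sum.reindex) (auto simp: inj_on_def face simp del: complex_cnj_mult)
  also have "\<dots> = (\<Sum>\<omega>\<in>edge_normals S. l * diameter (support_face S \<omega>))"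
    using assms finite_subset[OF support_face_subset[of S]]
    by (intro sum.cong refl diam) (auto simp: edge_normals_def)
  also have "\<dots> = l * perimeter S"
    by (simp add: perimeter_def sum_distrib_left)
  finally show ?thesis .
qed

lemma Gamma_set_0: "Gamma_set 0 p a = {0}"
  by (auto simp: Gamma_set_def gamma_def)

lemma Gamma_set_nonempty: "Gamma_set m p a \<noteq> {}"
  by (auto simp: Gamma_set_def PiE_eq_empty_iff)

lemma Gamma_set_Suc_eq:
  "Gamma_set (Suc k) p a = minkowski_sum (Gamma_set k p a)
     ((\<lambda>x. cnj (x * of_real (p (Suc k) - p k))) ` range (\<lambda>i. inverse (a (Suc k) i)))"
proof
  show "minkowski_sum (Gamma_set k p a)
      ((\<lambda>x. cnj (x * of_real (p (Suc k) - p k))) ` range (\<lambda>i. inverse (a (Suc k) i)))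
      \<subseteq> Gamma_set (Suc k) p a"
    using Gamma_set_Suc by (auto simp del: complex_cnj_mult of_real_diff)
  show "Gamma_set (Suc k) p a \<subseteq> minkowski_sum (Gamma_set k p a)
     ((\<lambda>x. cnj (x * of_real (p (Suc k) - p k))) ` range (\<lambda>i. inverse (a (Suc k) i)))"
  proof
    fix g assume "g \<in> Gamma_set (Suc k) p a"
    then obtain t where g: "g = gamma (Suc k) p a t" by (auto simp: Gamma_set_def)
    define t' where "t' = restrict t {1..k}"
    have "t' \<in> {1..k} \<rightarrow>\<^sub>E UNIV" by (auto simp: t'_def)
    then have "gamma k p a t' \<in> Gamma_set k p a" by (auto simp: Gamma_set_def)
    moreover have "gamma k p a t' = gamma k p a t"
      by (simp add: gamma_def t'_def)
    moreover have "g = gamma k p a t +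
        cnj (inverse (a (Suc k) (t (Suc k))) * of_real (p (Suc k) - p k))"
      by (simp add: g gamma_def)
    ultimately have "(gamma k p a t, cnj (inverse (a (Suc k) (t (Suc k))) * of_real (p (Suc k) - p k)))
        \<in> Gamma_set k p a \<times>
          ((\<lambda>x. cnj (x * of_real (p (Suc k) - p k))) ` range (\<lambda>i. inverse (a (Suc k) i)))"
      and g': "g = gamma k p a t + cnj (inverse (a (Suc k) (t (Suc k))) * of_real (p (Suc k) - p k))"
      by (auto simp del: complex_cnj_mult of_real_diff)
    from imageI[OF this(1), of "\<lambda>(x, y). x + y"]
    show "g \<in> minkowski_sum (Gamma_set k p a)
        ((\<lambda>x. cnj (x * of_real (p (Suc k) - p k))) ` range (\<lambda>i. inverse (a (Suc k) i)))"
      unfolding g' by (simp only: prod.case)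
  qed
qed

lemma perimeter_singleton: "perimeter {x} = 0"
  by (simp add: perimeter_def edge_normals_def support_face_def)

text \<open>The set of exponents is the Minkowski sum of the conjugated eigenvalue sets of the inverse
coefficients, scaled by the lengths of the pieces. Hence the perimeter of its hull is the weighted
sum of the perimeters on the pieces, which is the integral in the counting law.\<close>

lemma perimeter_Gamma_set:
  assumes "\<And>s. s \<in> {1..m} \<Longrightarrow> p (s - 1) < p s"
  shows "perimeter (Gamma_set m p a) =
    (\<Sum>s = 1..m. (p s - p (s - 1)) * perimeter (range (\<lambda>i. inverse (a s i))))"
  using assms
proof (induction m)
  case 0
  then show ?case by (simp add: Gamma_set_0 perimeter_singleton)
next
  case (Suc k)
  have "p k < p (Suc k)" using Suc.prems[of "Suc k"] by simp
  then have "perimeter (Gamma_set (Suc k) p a) = perimeter (Gamma_set k p a) +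
      (p (Suc k) - p k) * perimeter (range (\<lambda>i. inverse (a (Suc k) i)))"
    unfolding Gamma_set_Suc_eq
    by (subst perimeter_minkowski_sum)
       (use perimeter_scaled_cnj[of "range (\<lambda>i. inverse (a (Suc k) i))" "p (Suc k) - p k"]
         in \<open>auto simp: finite_Gamma_set Gamma_set_nonempty simp del: complex_cnj_mult of_real_diff\<close>)
  with Suc show ?case by simp
qed

section \<open>Zeros of exponential sums\<close>

text \<open>With bounded imaginary part of \<open>\<zeta>\<close>, the modulus of \<open>exp (\<zeta> * w)\<close> is at most a constant times the
exponential of \<open>Re w * Re \<zeta>\<close>.\<close>

lemma exp_sum_decay:
  fixes c w :: "'a \<Rightarrow> complex"
  assumes "finite J" "\<And>j. j \<in> J \<Longrightarrow> Re (w j) < 0" "e > 0"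
  shows "\<forall>\<^sub>F X in at_top. \<forall>\<zeta>. X \<le> Re \<zeta> \<and> \<bar>Im \<zeta>\<bar> \<le> C \<longrightarrow>
           norm (\<Sum>j\<in>J. c j * exp (\<zeta> * w j)) \<le> e"
proof -
  define B where "B = (\<lambda>x. \<Sum>j\<in>J. norm (c j) * exp (C * \<bar>Im (w j)\<bar>) * exp (Re (w j) * x))"
  have "((\<lambda>x. exp (r * x)) \<longlongrightarrow> 0) at_top" if "r < 0" for r :: real
    by (rule filterlim_compose[OF exp_at_bot])
       (rule filterlim_tendsto_neg_mult_at_bot[OF tendsto_const that filterlim_ident])
  then have "(B \<longlongrightarrow> 0) at_top"
    unfolding B_def using assms(2) by (intro tendsto_null_sum tendsto_mult_right_zero) blast
  then have "\<forall>\<^sub>F x in at_top. B x < e"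
    by (rule order_tendstoD) (use assms in auto)
  then obtain X0 where X0: "\<And>x. x \<ge> X0 \<Longrightarrow> B x < e"
    by (auto simp: eventually_at_top_linorder)
  have "norm (\<Sum>j\<in>J. c j * exp (\<zeta> * w j)) \<le> e" if "X0 \<le> Re \<zeta>" "\<bar>Im \<zeta>\<bar> \<le> C" for \<zeta>
  proof -
    have "norm (\<Sum>j\<in>J. c j * exp (\<zeta> * w j)) \<le> (\<Sum>j\<in>J. norm (c j * exp (\<zeta> * w j)))"
      by (rule norm_sum)
    also have "\<dots> \<le> B (Re \<zeta>)"
      unfolding B_def
    proof (rule sum_mono)
      fix j
      have "- (Im \<zeta> * Im (w j)) \<le> \<bar>Im \<zeta>\<bar> * \<bar>Im (w j)\<bar>"
        by (metis abs_ge_minus_self abs_mult)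
      also have "\<dots> \<le> C * \<bar>Im (w j)\<bar>"
        using that by (intro mult_right_mono) auto
      finally have "exp (Re (\<zeta> * w j)) \<le> exp (C * \<bar>Im (w j)\<bar>) * exp (Re (w j) * Re \<zeta>)"
        by (simp flip: exp_add add: mult.commute)
      then show "norm (c j * exp (\<zeta> * w j)) \<le>
          norm (c j) * exp (C * \<bar>Im (w j)\<bar>) * exp (Re (w j) * Re \<zeta>)"
        by (simp add: norm_mult mult.assoc mult_left_mono del: times_complex.sel)
    qed
    also have "\<dots> \<le> e" using X0[OF that(1)] by simp
    finally show ?thesis .
  qed
  then have "\<forall>\<zeta>. X \<le> Re \<zeta> \<and> \<bar>Im \<zeta>\<bar> \<le> C \<longrightarrow> norm (\<Sum>j\<in>J. c j * exp (\<zeta> * w j)) \<le> e" if "X \<ge> X0" for X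
    using that by auto
  then show ?thesis
    unfolding eventually_at_top_linorder by blast
qed

text \<open>Let \<open>q\<close> be small and contracting on a half-strip. For each index \<open>k\<close> whose unperturbed point
\<open>c + d k\<close> is at distance at least 1 from the left side of the half-strip, Banach's theorem gives a
solution of \<open>\<zeta> = c + d k + q \<zeta>\<close>, and contraction makes the solution for a given \<open>k\<close> unique.
Solutions thus correspond to integers, up to boundedly many near both ends, and their real parts
are spaced by \<open>d\<close> up to bounded errors.\<close>

lemma perturbed_progression_count:
  fixes q :: "complex \<Rightarrow> complex" and c :: complex and d C X :: real
  defines "S \<equiv> {\<zeta>. X \<le> Re \<zeta> \<and> \<bar>Im \<zeta>\<bar> \<le> C}"
  assumes "0 \<le> X" "0 < d" "\<bar>Im c\<bar> + 1 \<le> C"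
    and bound: "\<And>\<zeta>. \<zeta> \<in> S \<Longrightarrow> norm (q \<zeta>) \<le> 1"
    and contr: "\<And>\<zeta> \<xi>. \<zeta> \<in> S \<Longrightarrow> \<xi> \<in> S \<Longrightarrow> norm (q \<zeta> - q \<xi>) \<le> norm (\<zeta> - \<xi>) / 2"
  shows "\<exists>B. \<forall>E\<ge>0.
    finite {\<zeta> \<in> S. (\<exists>k::int. \<zeta> = c + of_real (d * k) + q \<zeta>) \<and> norm \<zeta> \<le> E} \<and>
    \<bar>real (card {\<zeta> \<in> S. (\<exists>k::int. \<zeta> = c + of_real (d * k) + q \<zeta>) \<and> norm \<zeta> \<le> E}) - E / d\<bar> \<le> B"
proof -
  define Z where "Z = (\<lambda>E. {\<zeta> \<in> S. (\<exists>k::int. \<zeta> = c + of_real (d * k) + q \<zeta>) \<and> norm \<zeta> \<le> E})"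
  define \<kappa> where "\<kappa> = (\<lambda>\<zeta>. SOME k::int. \<zeta> = c + of_real (d * k) + q \<zeta>)"
  have \<kappa>: "\<zeta> = c + of_real (d * \<kappa> \<zeta>) + q \<zeta>" if "\<zeta> \<in> Z E" for \<zeta> E
    using that unfolding Z_def \<kappa>_def by (auto intro: someI_ex)
  have unique: "\<zeta> = \<xi>" if "\<zeta> \<in> S" "\<xi> \<in> S"
      "\<zeta> = c + of_real x + q \<zeta>" "\<xi> = c + of_real x + q \<xi>" for \<zeta> \<xi> x
  proof -
    have "\<zeta> - \<xi> = q \<zeta> - q \<xi>"
      by (subst that(3), subst that(4)) simp
    then have "norm (\<zeta> - \<xi>) \<le> norm (\<zeta> - \<xi>) / 2"
      using contr[OF that(1,2)] by simp
    then show ?thesis by simp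
  qed
  have Re_close: "\<bar>Re \<zeta> - (Re c + x)\<bar> \<le> 1" if "\<zeta> \<in> S" "\<zeta> = c + of_real x + q \<zeta>" for \<zeta> x
  proof -
    have "Re \<zeta> - (Re c + x) = Re (q \<zeta>)"
      by (subst that(2)) simp
    then show ?thesis
      using abs_Re_le_cmod[of "q \<zeta>"] bound[OF that(1)] by linarith
  qed
  have exists_fixpoint: "\<exists>\<zeta>\<in>S. \<zeta> = c + of_real x + q \<zeta>" if "X + 1 \<le> Re c + x" for x
  proof -
    have "complete S"
    proof -
      have "closed {\<zeta>. X \<le> Re \<zeta>}" "closed {\<zeta>. \<bar>Im \<zeta>\<bar> \<le> C}"
        by (intro closed_Collect_le continuous_intros)+
      then show ?thesis
        unfolding S_def Collect_conj_eq by (intro complete_eq_closed[THEN iffD2] closed_Int)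
    qed
    have "of_real X \<in> S" using assms(2,4) by (auto simp: S_def)
    then have "S \<noteq> {}" by blast
    have self_map: "(\<lambda>\<zeta>. c + of_real x + q \<zeta>) ` S \<subseteq> S"
    proof
      fix \<xi> assume "\<xi> \<in> (\<lambda>\<zeta>. c + of_real x + q \<zeta>) ` S"
      then obtain \<zeta> where "\<zeta> \<in> S" "\<xi> = c + of_real x + q \<zeta>" by blast
      then show "\<xi> \<in> S"
        using bound[of \<zeta>] abs_Re_le_cmod[of "q \<zeta>"] abs_Im_le_cmod[of "q \<zeta>"] that assms(4)
        by (auto simp: S_def)
    qed
    have "\<exists>!\<zeta>\<in>S. c + of_real x + q \<zeta> = \<zeta>"
      by (rule Banach_fix[OF \<open>complete S\<close> \<open>S \<noteq> {}\<close> _ _ self_map, of "1 / 2"])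
         (use contr in \<open>auto simp: dist_norm\<close>)
    then show ?thesis by metis
  qed
  define B where "B = (C + X + 2) / d + 2"
  have main: "finite (Z E) \<and> \<bar>real (card (Z E)) - E / d\<bar> \<le> B" if "E \<ge> 0" for E
  proof -
    \<comment> \<open>A solution of modulus at most \<open>E\<close> has its index in \<open>up\<close>, and every index in \<open>lo\<close> has such
      a solution. Both intervals contain \<open>E / d + O(1)\<close> integers.\<close>
    define up where "up = {\<lceil>(X - Re c - 1) / d\<rceil>..\<lfloor>(E - Re c + 1) / d\<rfloor>}"
    define lo where "lo = {\<lceil>(X - Re c + 1) / d\<rceil>..\<lfloor>(E - C - Re c - 1) / d\<rfloor>}"
    have inj: "inj_on \<kappa> (Z E)"
      by (rule inj_onI) (metis (no_types, lifting) Z_def \<kappa> mem_Collect_eq unique)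
    have sub: "\<kappa> ` Z E \<subseteq> up"
    proof
      fix k assume "k \<in> \<kappa> ` Z E"
      then obtain \<zeta> where \<zeta>: "\<zeta> \<in> Z E" "k = \<kappa> \<zeta>" by blast
      then have "\<zeta> \<in> S" "norm \<zeta> \<le> E" by (auto simp: Z_def)
      then have "X \<le> Re \<zeta>" "Re \<zeta> \<le> E"
        using complex_Re_le_cmod[of \<zeta>] by (auto simp: S_def)
      then have "X - Re c - 1 \<le> d * k" "d * k \<le> E - Re c + 1"
        using Re_close[OF \<open>\<zeta> \<in> S\<close> \<kappa>[OF \<zeta>(1)]] \<zeta>(2) by auto
      then show "k \<in> up"
        using \<open>0 < d\<close> by (auto simp: up_def ceiling_le_iff le_floor_iff field_simps)
    qed
    have fin: "finite (Z E)"
      using inj_on_finite[OF inj sub] by (simp add: up_def)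
    have "real (card (Z E)) \<le> real (card up)"
      using card_inj_on_le[OF inj sub] by (simp add: up_def)
    also have "\<dots> \<le> max 0 ((E - Re c + 1) / d - (X - Re c - 1) / d + 1)"
      unfolding up_def card_atLeastAtMost_int by linarith
    also have "\<dots> \<le> E / d + B"
    proof -
      have "(E - Re c + 1) / d - (X - Re c - 1) / d = E / d + (2 - X) / d"
        by (simp add: diff_divide_distrib add_divide_distrib)
      moreover have "(2 - X) / d \<le> (C + X + 2) / d" "0 \<le> E / d" "0 \<le> (C + X + 2) / d"
        using assms that by (auto simp: divide_right_mono)
      ultimately show ?thesis by (simp add: B_def)
    qed
    finally have upper: "real (card (Z E)) \<le> E / d + B" .
    define g where "g = (\<lambda>k::int. SOME \<zeta>. \<zeta> \<in> S \<and> \<zeta> = c + of_real (d * k) + q \<zeta>)"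
    have g: "g k \<in> S" "g k = c + of_real (d * k) + q (g k)" if "k \<in> lo" for k
    proof -
      have "X + 1 \<le> Re c + d * k"
        using that \<open>0 < d\<close> by (auto simp: lo_def ceiling_le_iff field_simps)
      then have "\<exists>\<zeta>. \<zeta> \<in> S \<and> \<zeta> = c + of_real (d * k) + q \<zeta>"
        using exists_fixpoint by blast
      then have "g k \<in> S \<and> g k = c + of_real (d * k) + q (g k)"
        unfolding g_def by (rule someI_ex)
      then show "g k \<in> S" "g k = c + of_real (d * k) + q (g k)" by blast+
    qed
    have "inj_on g lo"
    proof (rule inj_onI)
      fix j k assume jk: "j \<in> lo" "k \<in> lo" "g j = g k"
      have "complex_of_real (d * j) = of_real (d * k)"
        using g(2)[OF jk(1)] g(2)[OF jk(2)] unfolding jk(3) by (metis add_diff_cancel add_diff_cancel_left')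
      then show "j = k" using \<open>0 < d\<close> unfolding of_real_eq_iff by simp
    qed
    moreover have "g ` lo \<subseteq> Z E"
    proof
      fix \<zeta> assume "\<zeta> \<in> g ` lo"
      then obtain k where k: "k \<in> lo" "\<zeta> = g k" by blast
      have "d * k \<le> E - C - Re c - 1"
        using k(1) \<open>0 < d\<close> by (auto simp: lo_def le_floor_iff field_simps)
      then have "Re \<zeta> \<le> E - C"
        using Re_close[OF g(1)[OF k(1)] g(2)[OF k(1)]] unfolding k(2) by linarith
      moreover have "X \<le> Re \<zeta>" "\<bar>Im \<zeta>\<bar> \<le> C"
        using g(1)[OF k(1)] k(2) by (auto simp: S_def)
      ultimately have "norm \<zeta> \<le> E"
        using cmod_le[of \<zeta>] \<open>0 \<le> X\<close> by linarith
      then show "\<zeta> \<in> Z E"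
        using g[OF k(1)] k(2) unfolding Z_def by blast
    qed
    ultimately have "card lo \<le> card (Z E)"
      using fin by (rule card_inj_on_le)
    have "E / d - B \<le> (E - C - Re c - 1) / d - (X - Re c + 1) / d - 1"
      by (simp add: B_def diff_divide_distrib add_divide_distrib)
    also have "\<dots> \<le> real (card lo)"
      unfolding lo_def card_atLeastAtMost_int by linarith
    also have "\<dots> \<le> real (card (Z E))"
      using \<open>card lo \<le> card (Z E)\<close> by simp
    finally show ?thesis using upper fin by auto
  qed
  then show ?thesis
    unfolding Z_def by blast
qed

text \<open>Dividing by \<open>\<delta>1\<close> and taking logarithms turns the equation \<open>G \<zeta> = 0\<close> into the perturbed
arithmetic progression above with step \<open>2 * pi / l\<close>: the exponentials in the remaining sum decay along
the half-strip, so the logarithm of their correction factor is a small contraction far out.\<close>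

lemma strip_zero_count:
  fixes \<delta>1 \<delta>2 :: complex and l :: real and J :: "'a set" and c w :: "'a \<Rightarrow> complex"
  defines "G \<equiv> \<lambda>\<zeta>. \<delta>1 + \<delta>2 * exp (\<i> * of_real l * \<zeta>) + (\<Sum>j\<in>J. c j * exp (\<zeta> * w j))"
  assumes "\<delta>1 \<noteq> 0" "\<delta>2 \<noteq> 0" "0 < l" "finite J" "\<And>j. j \<in> J \<Longrightarrow> Re (w j) < 0"
  shows "\<forall>\<^sub>F C in at_top. \<forall>\<^sub>F X in at_top. \<exists>B. \<forall>E\<ge>0.
    finite {\<zeta>. G \<zeta> = 0 \<and> X \<le> Re \<zeta> \<and> \<bar>Im \<zeta>\<bar> \<le> C \<and> norm \<zeta> \<le> E} \<and>
    \<bar>real (card {\<zeta>. G \<zeta> = 0 \<and> X \<le> Re \<zeta> \<and> \<bar>Im \<zeta>\<bar> \<le> C \<and> norm \<zeta> \<le> E}) - E / (2 * pi) * l\<bar> \<le> B"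
proof -
  define c0 where "c0 = Ln (- \<delta>1 / \<delta>2) / (\<i> * of_real l)"
  define \<epsilon> where "\<epsilon> = (\<lambda>\<zeta>. \<Sum>j\<in>J. (c j / \<delta>1) * exp (\<zeta> * w j))"
  define \<epsilon>' where "\<epsilon>' = (\<lambda>\<zeta>. \<Sum>j\<in>J. (c j / \<delta>1 * w j) * exp (\<zeta> * w j))"
  define q where "q = (\<lambda>\<zeta>. Ln (1 + \<epsilon> \<zeta>) / (\<i> * of_real l))"
  have deriv_\<epsilon>: "(\<epsilon> has_field_derivative \<epsilon>' \<zeta>) (at \<zeta>)" for \<zeta>
    unfolding \<epsilon>_def \<epsilon>'_def using assms(2)
    by (auto intro!: derivative_eq_intros sum.cong simp: mult_ac)
  \<comment> \<open>The bound 1/4 keeps the logarithm in its disc of estimates, the bound \<open>l / 2\<close> gives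
    \<open>norm (q \<zeta>) \<le> 1\<close>, and the bound \<open>l / 4\<close> on the derivative gives the contraction factor 1/2.\<close>
  have "\<exists>B. \<forall>E\<ge>0.
    finite {\<zeta>. G \<zeta> = 0 \<and> X \<le> Re \<zeta> \<and> \<bar>Im \<zeta>\<bar> \<le> C \<and> norm \<zeta> \<le> E} \<and>
    \<bar>real (card {\<zeta>. G \<zeta> = 0 \<and> X \<le> Re \<zeta> \<and> \<bar>Im \<zeta>\<bar> \<le> C \<and> norm \<zeta> \<le> E}) - E / (2 * pi) * l\<bar> \<le> B"
    if C: "\<bar>Im c0\<bar> + 1 \<le> C" and X: "0 \<le> X"
      and \<epsilon>_small: "\<forall>\<zeta>. X \<le> Re \<zeta> \<and> \<bar>Im \<zeta>\<bar> \<le> C \<longrightarrow> norm (\<epsilon> \<zeta>) \<le> min (1 / 4) (l / 2)"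
      and \<epsilon>'_small: "\<forall>\<zeta>. X \<le> Re \<zeta> \<and> \<bar>Im \<zeta>\<bar> \<le> C \<longrightarrow> norm (\<epsilon>' \<zeta>) \<le> l / 4" for C X
  proof -
    define S where "S = {\<zeta>. X \<le> Re \<zeta> \<and> \<bar>Im \<zeta>\<bar> \<le> C}"
    have small: "norm (\<epsilon> \<zeta>) < 1 / 2" "norm (\<epsilon> \<zeta>) \<le> l / 2" "norm (\<epsilon>' \<zeta>) \<le> l / 4" if "\<zeta> \<in> S" for \<zeta>
      using that \<epsilon>_small \<epsilon>'_small by (force simp: S_def)+
    have Re_pos: "0 < Re (1 + \<epsilon> \<zeta>)" if "\<zeta> \<in> S" for \<zeta>
      using small(1)[OF that] abs_Re_le_cmod[of "\<epsilon> \<zeta>"] by simp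
    have "convex S"
    proof -
      have "S = {\<zeta>. 1 \<bullet> \<zeta> \<ge> X} \<inter> {\<zeta>. \<i> \<bullet> \<zeta> \<le> C} \<inter> {\<zeta>. \<i> \<bullet> \<zeta> \<ge> - C}"
        by (auto simp: S_def inner_complex_def)
      then show ?thesis
        by (simp only: convex_Int convex_halfspace_le convex_halfspace_ge)
    qed
    have q_bound: "norm (q \<zeta>) \<le> 1" if "\<zeta> \<in> S" for \<zeta>
    proof -
      have "norm (Ln (1 + \<epsilon> \<zeta>)) \<le> 2 * norm (\<epsilon> \<zeta>)"
        using small(1)[OF that] by (intro norm_Ln_le) auto
      also have "\<dots> \<le> l" using small(2)[OF that] by simp
      finally show ?thesis using \<open>0 < l\<close> by (simp add: q_def norm_divide norm_mult)
    qed
    have q_deriv: "(q has_field_derivative \<epsilon>' \<zeta> / (1 + \<epsilon> \<zeta>) / (\<i> * of_real l)) (at \<zeta> within S)"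
      if "\<zeta> \<in> S" for \<zeta>
    proof -
      have "1 + \<epsilon> \<zeta> \<notin> \<real>\<^sub>\<le>\<^sub>0"
        using Re_pos[OF that] by (auto simp: complex_nonpos_Reals_iff)
      then show ?thesis
        unfolding q_def using \<open>0 < l\<close>
        by (auto intro!: derivative_eq_intros DERIV_subset[OF deriv_\<epsilon>] simp: divide_inverse mult_ac)
    qed
    have q_contr: "norm (q \<zeta> - q \<xi>) \<le> norm (\<zeta> - \<xi>) / 2" if "\<zeta> \<in> S" "\<xi> \<in> S" for \<zeta> \<xi>
    proof -
      have "norm (\<epsilon>' x / (1 + \<epsilon> x) / (\<i> * of_real l)) \<le> 1 / 2" if "x \<in> S" for x
      proof -
        have "1 / 2 \<le> norm (1 + \<epsilon> x)"
          using small(1)[OF that] norm_triangle_ineq2[of 1 "- \<epsilon> x"] by simp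
        then have "norm (\<epsilon>' x) / norm (1 + \<epsilon> x) \<le> (l / 4) / (1 / 2)"
          using small(3)[OF that] \<open>0 < l\<close> by (intro frac_le) auto
        then have "norm (\<epsilon>' x) / norm (1 + \<epsilon> x) / l \<le> (l / 4) / (1 / 2) / l"
          using \<open>0 < l\<close> by (intro divide_right_mono) auto
        moreover have "norm (\<epsilon>' x / (1 + \<epsilon> x) / (\<i> * of_real l)) = norm (\<epsilon>' x) / norm (1 + \<epsilon> x) / l"
          using \<open>0 < l\<close> unfolding norm_divide norm_mult by simp
        ultimately show ?thesis
          using \<open>0 < l\<close> by (simp only:) simp
      qed
      from field_differentiable_bound[OF \<open>convex S\<close> q_deriv this that]
      show ?thesis by simp
    qed
    have zero_iff: "G \<zeta> = 0 \<longleftrightarrow> (\<exists>k::int. \<zeta> = c0 + of_real (2 * pi / l * k) + q \<zeta>)" if "\<zeta> \<in> S" for \<zeta>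
    proof -
      have "1 + \<epsilon> \<zeta> \<noteq> 0" using Re_pos[OF that] by (metis less_irrefl zero_complex.sel(1))
      have "(\<Sum>j\<in>J. c j * exp (\<zeta> * w j)) = \<delta>1 * \<epsilon> \<zeta>"
        unfolding \<epsilon>_def sum_distrib_left using \<open>\<delta>1 \<noteq> 0\<close> by (intro sum.cong) auto
      then have "G \<zeta> = 0 \<longleftrightarrow> exp (\<i> * of_real l * \<zeta>) = - \<delta>1 / \<delta>2 * (1 + \<epsilon> \<zeta>)"
        using \<open>\<delta>2 \<noteq> 0\<close> unfolding G_def by (auto simp: field_simps add_eq_0_iff)
      also have "\<dots> \<longleftrightarrow> exp (\<i> * of_real l * \<zeta>) = exp (Ln (- \<delta>1 / \<delta>2) + Ln (1 + \<epsilon> \<zeta>))"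
        using \<open>\<delta>1 \<noteq> 0\<close> \<open>\<delta>2 \<noteq> 0\<close> \<open>1 + \<epsilon> \<zeta> \<noteq> 0\<close> by (simp add: exp_add)
      also have "\<dots> \<longleftrightarrow> (\<exists>k::int. \<i> * of_real l * \<zeta> =
          Ln (- \<delta>1 / \<delta>2) + Ln (1 + \<epsilon> \<zeta>) + of_int (2 * k) * pi * \<i>)"
        by (rule exp_eq)
      also have "\<dots> \<longleftrightarrow> (\<exists>k::int. \<zeta> = c0 + of_real (2 * pi / l * k) + q \<zeta>)"
      proof (rule ex_cong1)
        fix k :: int
        let ?W = "Ln (- \<delta>1 / \<delta>2) + Ln (1 + \<epsilon> \<zeta>) + of_int (2 * k) * pi * \<i>"
        have "\<i> * of_real l * \<zeta> = ?W \<longleftrightarrow> \<zeta> = ?W / (\<i> * of_real l)"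
          using \<open>0 < l\<close> by (subst nonzero_eq_divide_eq) (simp_all only: mult.commute, simp)
        also have "?W / (\<i> * of_real l) = c0 + of_real (2 * pi / l * k) + q \<zeta>"
          unfolding c0_def q_def add_divide_distrib using \<open>0 < l\<close> by simp
        finally show "\<i> * of_real l * \<zeta> = ?W \<longleftrightarrow> \<zeta> = c0 + of_real (2 * pi / l * k) + q \<zeta>" .
      qed
      finally show ?thesis .
    qed
    have eq: "{\<zeta>. G \<zeta> = 0 \<and> X \<le> Re \<zeta> \<and> \<bar>Im \<zeta>\<bar> \<le> C \<and> norm \<zeta> \<le> E} =
        {\<zeta> \<in> S. (\<exists>k::int. \<zeta> = c0 + of_real (2 * pi / l * k) + q \<zeta>) \<and> norm \<zeta> \<le> E}" for E
      using zero_iff by (auto simp: S_def)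
    have "E / (2 * pi) * l = E / (2 * pi / l)" for E by simp
    then show ?thesis
      unfolding eq S_def
      using perturbed_progression_count[of X "2 * pi / l" c0 C q] X C \<open>0 < l\<close> q_bound q_contr
      by (simp add: S_def)
  qed
  note main = this
  show ?thesis
    using eventually_ge_at_top[of "\<bar>Im c0\<bar> + 1"]
  proof eventually_elim
    case (elim C)
    have "\<forall>\<^sub>F X in at_top. \<forall>\<zeta>. X \<le> Re \<zeta> \<and> \<bar>Im \<zeta>\<bar> \<le> C \<longrightarrow> norm (\<epsilon> \<zeta>) \<le> min (1 / 4) (l / 2)"
      unfolding \<epsilon>_def using assms by (intro exp_sum_decay) auto
    moreover have "\<forall>\<^sub>F X in at_top. \<forall>\<zeta>. X \<le> Re \<zeta> \<and> \<bar>Im \<zeta>\<bar> \<le> C \<longrightarrow> norm (\<epsilon>' \<zeta>) \<le> l / 4"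
      unfolding \<epsilon>'_def using assms by (intro exp_sum_decay) auto
    ultimately show ?case
      using eventually_ge_at_top[of "0::real"] by eventually_elim (rule main[OF elim])
  qed
qed

text \<open>Moving from \<open>z\<close> in the direction \<open>\<gamma> - \<gamma>0\<close> closes the gap between the linear functionals of \<open>\<gamma>0\<close> and
\<open>\<gamma>\<close> at a definite rate. At the first moment at which \<open>\<gamma>0\<close> ties with a point that catches up with
it, which need not be \<open>\<gamma>\<close>, it is still a maximiser, so the tie is between two maximisers.\<close>

lemma near_tie_imp_near_exact_tie:
  assumes "finite \<Gamma>" "\<gamma>0 \<in> support_face \<Gamma> z" "\<gamma> \<in> \<Gamma>" "\<gamma> \<noteq> \<gamma>0"
  shows "\<exists>w. norm (z - w) \<le> z \<bullet> (\<gamma>0 - \<gamma>) / norm (\<gamma>0 - \<gamma>) \<and>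
    (\<exists>x\<in>support_face \<Gamma> w. \<exists>y\<in>support_face \<Gamma> w. x \<noteq> y)"
proof -
  define e where "e = \<gamma>0 - \<gamma>"
  \<comment> \<open>The points of \<open>P\<close> are those whose gap to \<open>\<gamma>0\<close> shrinks along the path, and \<open>r y\<close> is the time
    at which the gap of \<open>y\<close> vanishes.\<close>
  define P where "P = {y \<in> \<Gamma>. e \<bullet> (\<gamma>0 - y) > 0}"
  define r where "r = (\<lambda>y. z \<bullet> (\<gamma>0 - y) / (e \<bullet> (\<gamma>0 - y)))"
  have gap: "z \<bullet> (\<gamma>0 - y) \<ge> 0" if "y \<in> \<Gamma>" for y
    using assms(2) that by (auto simp: support_face_def inner_diff_right)
  have "e \<noteq> 0" using assms(4) by (simp add: e_def)
  then have "\<gamma> \<in> P" using assms(3) by (simp add: P_def e_def)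
  have "finite P" using assms(1) by (simp add: P_def)
  define t where "t = Min (r ` P)"
  have "t \<in> r ` P" unfolding t_def using \<open>finite P\<close> \<open>\<gamma> \<in> P\<close> by (intro Min_in) auto
  then obtain y where y: "y \<in> P" "t = r y" by blast
  have t_le: "t \<le> r x" if "x \<in> P" for x
    unfolding t_def using \<open>finite P\<close> that by simp
  have "t \<ge> 0" using y gap by (auto simp: r_def P_def)
  define w where "w = z - t *\<^sub>R e"
  have w_gap: "w \<bullet> (\<gamma>0 - x) \<ge> 0" if "x \<in> \<Gamma>" for x
  proof (cases "x \<in> P")
    case True
    then show ?thesis
      using t_le[OF True] by (simp add: w_def r_def P_def inner_diff_left pos_le_divide_eq)
  next
    case False
    then have "t * (e \<bullet> (\<gamma>0 - x)) \<le> 0"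
      using \<open>t \<ge> 0\<close> that by (simp add: P_def mult_nonneg_nonpos)
    then show ?thesis
      using gap[OF that] by (simp add: w_def inner_diff_left)
  qed
  have "\<gamma>0 \<in> \<Gamma>" using assms(2) by (simp add: support_face_def)
  then have "\<gamma>0 \<in> support_face \<Gamma> w"
    using w_gap by (simp add: support_face_def inner_diff_right)
  moreover have "w \<bullet> (\<gamma>0 - y) = 0"
    using y by (simp add: w_def r_def P_def inner_diff_left)
  then have "w \<bullet> \<gamma>0 = w \<bullet> y" by (simp add: inner_diff_right)
  then have "y \<in> support_face \<Gamma> w"
    using w_gap y by (auto simp: support_face_def inner_diff_right P_def)
  moreover have "y \<noteq> \<gamma>0" using y by (auto simp: P_def)
  moreover have "norm (z - w) \<le> z \<bullet> (\<gamma>0 - \<gamma>) / norm (\<gamma>0 - \<gamma>)"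
  proof -
    have "norm (z - w) = t * norm e" using \<open>t \<ge> 0\<close> by (simp add: w_def)
    also have "\<dots> \<le> r \<gamma> * norm e" using t_le[OF \<open>\<gamma> \<in> P\<close>] by (intro mult_right_mono) auto
    also have "\<dots> = z \<bullet> e / norm e"
      using \<open>e \<noteq> 0\<close> by (simp add: r_def flip: e_def) (simp add: dot_square_norm power2_eq_square)
    finally show ?thesis by (simp add: e_def)
  qed
  ultimately show ?thesis by blast
qed

lemma support_face_sgn:
  assumes "w \<noteq> 0"
  shows "support_face S (sgn w) = support_face S w"
proof -
  have "sgn w \<bullet> x = w \<bullet> x / norm w" for x
    by (simp add: sgn_div_norm divide_inverse mult.commute)
  then show ?thesis
    using assms by (simp add: support_face_def divide_le_cancel)
qed

definition exp_sum :: "complex set \<Rightarrow> (complex \<Rightarrow> complex) \<Rightarrow> complex \<Rightarrow> complex" where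
  "exp_sum \<Gamma> d z = (\<Sum>\<gamma>\<in>\<Gamma>. d \<gamma> * exp (z * cnj \<gamma>))"

lemma norm_exp_cnj: "norm (exp (z * cnj \<gamma>)) = exp (z \<bullet> \<gamma>)"
  by (simp add: inner_complex_def)

text \<open>At a zero the dominant term must be balanced by the others, so some other exponent has a real
part within a bounded distance of the largest one.\<close>

lemma exp_sum_zero_near_tie:
  assumes "finite \<Gamma>"
  shows "\<exists>C\<ge>0. \<forall>z. \<forall>\<gamma>0\<in>support_face \<Gamma> z. d \<gamma>0 \<noteq> 0 \<longrightarrow> exp_sum \<Gamma> d z = 0 \<longrightarrow>
    (\<exists>\<gamma>\<in>\<Gamma>. \<gamma> \<noteq> \<gamma>0 \<and> z \<bullet> (\<gamma>0 - \<gamma>) \<le> C)"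
proof -
  define D where "D = (\<Sum>\<gamma>\<in>\<Gamma>. norm (d \<gamma>))"
  \<comment> \<open>If all other exponents lag by more than \<open>f \<gamma>0\<close>, their terms together are smaller than the term
    of \<open>\<gamma>0\<close>.\<close>
  define f where "f = (\<lambda>\<gamma>. ln (D / norm (d \<gamma>)))"
  define C where "C = Max (insert 0 (f ` \<Gamma>))"
  have "C \<ge> 0" unfolding C_def using assms by simp
  moreover have "\<exists>\<gamma>\<in>\<Gamma>. \<gamma> \<noteq> \<gamma>0 \<and> z \<bullet> (\<gamma>0 - \<gamma>) \<le> C"
    if \<gamma>0: "\<gamma>0 \<in> support_face \<Gamma> z" "d \<gamma>0 \<noteq> 0" and zero: "exp_sum \<Gamma> d z = 0" for z \<gamma>0
  proof (rule ccontr)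
    assume "\<not> ?thesis"
    then have far: "z \<bullet> \<gamma> \<le> z \<bullet> \<gamma>0 - C" if "\<gamma> \<in> \<Gamma> - {\<gamma>0}" for \<gamma>
      using that by (force simp: inner_diff_right)
    have "\<gamma>0 \<in> \<Gamma>" using \<gamma>0 by (simp add: support_face_def)
    have split: "D = norm (d \<gamma>0) + (\<Sum>\<gamma>\<in>\<Gamma> - {\<gamma>0}. norm (d \<gamma>))"
      unfolding D_def by (rule sum.remove) (use assms \<open>\<gamma>0 \<in> \<Gamma>\<close> in auto)
    then have D: "norm (d \<gamma>0) \<le> D" "0 < D" "(\<Sum>\<gamma>\<in>\<Gamma> - {\<gamma>0}. norm (d \<gamma>)) < D"
      using \<gamma>0(2) sum_nonneg[of "\<Gamma> - {\<gamma>0}" "\<lambda>\<gamma>. norm (d \<gamma>)"] zero_less_norm_iff[of "d \<gamma>0"]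
      by (simp_all add: add_pos_nonneg)
    have "f \<gamma>0 \<le> C" unfolding C_def using assms \<open>\<gamma>0 \<in> \<Gamma>\<close> by simp
    then have "exp (- C) \<le> exp (- f \<gamma>0)" by simp
    also have "\<dots> = norm (d \<gamma>0) / D"
      using D \<gamma>0(2) by (simp add: f_def exp_minus exp_ln)
    finally have exp_C: "exp (- C) \<le> norm (d \<gamma>0) / D" .
    have "d \<gamma>0 * exp (z * cnj \<gamma>0) = - (\<Sum>\<gamma>\<in>\<Gamma> - {\<gamma>0}. d \<gamma> * exp (z * cnj \<gamma>))"
      using zero unfolding exp_sum_def
      by (subst (asm) sum.remove[OF assms \<open>\<gamma>0 \<in> \<Gamma>\<close>]) (simp add: add_eq_0_iff)
    then have "norm (d \<gamma>0 * exp (z * cnj \<gamma>0)) = norm (\<Sum>\<gamma>\<in>\<Gamma> - {\<gamma>0}. d \<gamma> * exp (z * cnj \<gamma>))"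
      by (simp only: norm_minus_cancel)
    also have "\<dots> \<le> (\<Sum>\<gamma>\<in>\<Gamma> - {\<gamma>0}. norm (d \<gamma>) * exp (z \<bullet> \<gamma>0 - C))"
      by (rule sum_norm_le) (simp add: norm_mult norm_exp_cnj mult_left_mono far del: norm_exp_eq_Re)
    also have "\<dots> = (\<Sum>\<gamma>\<in>\<Gamma> - {\<gamma>0}. norm (d \<gamma>)) * exp (- C) * exp (z \<bullet> \<gamma>0)"
      by (simp add: sum_distrib_right mult.assoc flip: exp_add)
    also have "\<dots> < D * (norm (d \<gamma>0) / D) * exp (z \<bullet> \<gamma>0)"
    proof -
      have "(\<Sum>\<gamma>\<in>\<Gamma> - {\<gamma>0}. norm (d \<gamma>)) * exp (- C) < D * exp (- C)"
        using D(3) by simp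
      also have "\<dots> \<le> D * (norm (d \<gamma>0) / D)"
        using exp_C D(2) by (intro mult_left_mono) auto
      finally show ?thesis by simp
    qed
    also have "\<dots> = norm (d \<gamma>0 * exp (z * cnj \<gamma>0))"
      using D(2) by (simp add: norm_mult norm_exp_cnj del: norm_exp_eq_Re)
    finally show False by simp
  qed
  ultimately show ?thesis by blast
qed

text \<open>Near ties lie close to exact ties, and away from the origin exact ties occur precisely along the
rays spanned by the edge normals.\<close>

lemma exp_sum_zeros_near_rays:
  assumes "finite \<Gamma>" "\<Gamma> \<noteq> {}"
    and nz: "\<And>\<omega> \<gamma>. norm \<omega> = 1 \<Longrightarrow> \<gamma> \<in> support_face \<Gamma> \<omega> \<Longrightarrow> d \<gamma> \<noteq> 0"
  shows "\<exists>C\<ge>0. \<forall>z. exp_sum \<Gamma> d z = 0 \<longrightarrow>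
    norm z \<le> C \<or> (\<exists>\<omega>\<in>edge_normals \<Gamma>. \<exists>t\<ge>0. norm (z - of_real t * \<omega>) \<le> C)"
proof -
  obtain C0 where "C0 \<ge> 0" and C0: "\<And>z \<gamma>0. \<gamma>0 \<in> support_face \<Gamma> z \<Longrightarrow> d \<gamma>0 \<noteq> 0 \<Longrightarrow>
      exp_sum \<Gamma> d z = 0 \<Longrightarrow> \<exists>\<gamma>\<in>\<Gamma>. \<gamma> \<noteq> \<gamma>0 \<and> z \<bullet> (\<gamma>0 - \<gamma>) \<le> C0"
    using exp_sum_zero_near_tie[OF assms(1), of d] by blast
  define C where "C = Max (insert 0 ((\<lambda>(x, y). C0 / norm (x - y)) ` (\<Gamma> \<times> \<Gamma>)))"
  have "C \<ge> 0" unfolding C_def using assms by simp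
  have C_ge: "C0 / norm (x - y) \<le> C" if "x \<in> \<Gamma>" "y \<in> \<Gamma>" for x y
  proof -
    have "(\<lambda>(x, y). C0 / norm (x - y)) (x, y) \<in> insert 0 ((\<lambda>(x, y). C0 / norm (x - y)) ` (\<Gamma> \<times> \<Gamma>))"
      using that by blast
    then show ?thesis unfolding C_def using assms(1) by (intro Max_ge) auto
  qed
  have "norm z \<le> C \<or> (\<exists>\<omega>\<in>edge_normals \<Gamma>. \<exists>t\<ge>0. norm (z - of_real t * \<omega>) \<le> C)"
    if zero: "exp_sum \<Gamma> d z = 0" for z
  proof (cases "z = 0")
    case True
    then show ?thesis using \<open>C \<ge> 0\<close> by simp
  next
    case False
    obtain \<gamma>0 where \<gamma>0: "\<gamma>0 \<in> support_face \<Gamma> z"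
      using support_face_nonempty[OF assms(1,2)] by blast
    then have "d \<gamma>0 \<noteq> 0"
      using nz[of "sgn z" \<gamma>0] False support_face_sgn[OF False] by (simp add: norm_sgn)
    then obtain \<gamma> where \<gamma>: "\<gamma> \<in> \<Gamma>" "\<gamma> \<noteq> \<gamma>0" "z \<bullet> (\<gamma>0 - \<gamma>) \<le> C0"
      using C0[OF \<gamma>0 _ zero] by blast
    obtain w where w: "norm (z - w) \<le> z \<bullet> (\<gamma>0 - \<gamma>) / norm (\<gamma>0 - \<gamma>)"
      "\<exists>x\<in>support_face \<Gamma> w. \<exists>y\<in>support_face \<Gamma> w. x \<noteq> y"
      using near_tie_imp_near_exact_tie[OF assms(1) \<gamma>0 \<gamma>(1,2)] by blast
    have "\<gamma>0 \<in> \<Gamma>" using \<gamma>0 by (simp add: support_face_def)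
    have "norm (z - w) \<le> C0 / norm (\<gamma>0 - \<gamma>)"
      using w(1) \<gamma>(3) by (meson divide_right_mono norm_ge_zero order_trans)
    then have zw: "norm (z - w) \<le> C"
      using C_ge[OF \<open>\<gamma>0 \<in> \<Gamma>\<close> \<gamma>(1)] by linarith
    show ?thesis
    proof (cases "w = 0")
      case True
      then show ?thesis using zw by simp
    next
      case False
      then have "sgn w \<in> edge_normals \<Gamma>"
        using w(2) by (simp add: edge_normals_def support_face_sgn norm_sgn)
      moreover have "of_real (norm w) * sgn w = w"
        using False by (simp add: sgn_eq)
      ultimately show ?thesis
        using zw by (metis norm_ge_zero)
    qed
  qed
  then show ?thesis using \<open>C \<ge> 0\<close> by blast
qed

abbreviation half_strip :: "complex \<Rightarrow> real \<Rightarrow> real \<Rightarrow> complex set" where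
  "half_strip \<omega> C X \<equiv> {z. X \<le> Re (z * cnj \<omega>) \<and> \<bar>Im (z * cnj \<omega>)\<bar> \<le> C}"

text \<open>After rotating \<open>\<omega>\<close> to 1 and dividing by the exponential of one end of the edge, only the two ends
of the edge contribute terms that do not decay; the other end becomes a pure oscillation whose
frequency is the length of the edge.\<close>

lemma exp_sum_half_strip_count:
  assumes "finite \<Gamma>" "\<omega> \<in> edge_normals \<Gamma>" "card (support_face \<Gamma> \<omega>) \<le> 2"
    and nz: "\<And>\<gamma>. \<gamma> \<in> support_face \<Gamma> \<omega> \<Longrightarrow> d \<gamma> \<noteq> 0"
  shows "\<forall>\<^sub>F C in at_top. \<forall>\<^sub>F X in at_top. \<exists>B. \<forall>E\<ge>0.
    finite {z \<in> half_strip \<omega> C X. exp_sum \<Gamma> d z = 0 \<and> norm z \<le> E} \<and>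
    \<bar>real (card {z \<in> half_strip \<omega> C X. exp_sum \<Gamma> d z = 0 \<and> norm z \<le> E}) -
      E / (2 * pi) * diameter (support_face \<Gamma> \<omega>)\<bar> \<le> B"
proof -
  have unit: "norm \<omega> = 1" using assms(2) by (simp add: edge_normals_def)
  then have \<omega>_cnj: "\<omega> * cnj \<omega> = 1" by (simp add: complex_norm_square[symmetric])
  have fin: "finite (support_face \<Gamma> \<omega>)"
    using assms(1) by (rule finite_subset[OF support_face_subset])
  obtain x y where xy: "x \<in> support_face \<Gamma> \<omega>" "y \<in> support_face \<Gamma> \<omega>" "x \<noteq> y"
    using assms(2) by (auto simp: edge_normals_def)
  then have face_xy: "support_face \<Gamma> \<omega> = {x, y}"
    using card_seteq[OF fin, of "{x, y}"] assms(3) by auto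
  have "\<omega> \<bullet> (x - y) = 0"
    using support_face_inner_eq[OF xy(1,2)] by (simp add: inner_diff_right)
  then obtain t where t: "x - y = of_real t * (\<i> * \<omega>)" "\<bar>t\<bar> = norm (x - y)"
    using inner_unit_perp[OF unit] by blast
  \<comment> \<open>The ends are labelled such that the edge runs counterclockwise from \<open>\<gamma>2\<close> to \<open>\<gamma>1\<close>; this fixes
    the sign of the frequency.\<close>
  obtain \<gamma>1 \<gamma>2 l where face: "support_face \<Gamma> \<omega> = {\<gamma>1, \<gamma>2}" "\<gamma>1 \<noteq> \<gamma>2"
    and l: "\<gamma>1 - \<gamma>2 = of_real l * (\<i> * \<omega>)" "l = norm (\<gamma>1 - \<gamma>2)"
  proof (cases "t \<ge> 0")
    case True
    then have "t = norm (x - y)" using t(2) by linarith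
    then show ?thesis by (rule that[OF face_xy xy(3) t(1)])
  next
    case False
    then have "y - x = of_real (- t) * (\<i> * \<omega>)"
      using t(1) by (metis minus_diff_eq mult_minus_left of_real_minus)
    moreover have "- t = norm (y - x)" using t(2) False norm_minus_commute[of x y] by linarith
    ultimately show ?thesis
      by (rule that[rotated 2]) (use face_xy xy(3) in auto)
  qed
  have "l > 0" using l(2) face(2) by simp
  have diam: "diameter (support_face \<Gamma> \<omega>) = l"
  proof (rule antisym)
    show "diameter (support_face \<Gamma> \<omega>) \<le> l"
      unfolding face(1) using \<open>l > 0\<close> l(2) by (intro diameter_le) (auto simp: norm_minus_commute)
    show "l \<le> diameter (support_face \<Gamma> \<omega>)"
      using diameter_bounded_bound[of "support_face \<Gamma> \<omega>" \<gamma>1 \<gamma>2] fin l(2)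
      by (simp add: face(1) dist_norm)
  qed
  define J where "J = \<Gamma> - {\<gamma>1, \<gamma>2}"
  have "\<gamma>1 \<in> \<Gamma>" "\<gamma>2 \<in> \<Gamma>" using face(1) support_face_subset by blast+
  have neg: "Re (\<omega> * cnj (\<gamma> - \<gamma>1)) < 0" if "\<gamma> \<in> J" for \<gamma>
  proof -
    have "\<gamma>1 \<in> support_face \<Gamma> \<omega>" "\<gamma> \<notin> support_face \<Gamma> \<omega>" "\<gamma> \<in> \<Gamma>"
      using that face(1) by (auto simp: J_def)
    then have "\<omega> \<bullet> \<gamma> < \<omega> \<bullet> \<gamma>1"
      unfolding support_face_def by force
    then show ?thesis by (simp add: inner_complex_def algebra_simps)
  qed
  define G where "G = (\<lambda>\<zeta>. d \<gamma>1 + d \<gamma>2 * exp (\<i> * of_real l * \<zeta>) +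
      (\<Sum>\<gamma>\<in>J. d \<gamma> * exp (\<zeta> * (\<omega> * cnj (\<gamma> - \<gamma>1)))))"
  have zero_iff: "exp_sum \<Gamma> d (\<omega> * \<zeta>) = 0 \<longleftrightarrow> G \<zeta> = 0" for \<zeta>
  proof -
    have factor: "exp (\<omega> * \<zeta> * cnj \<gamma>) = exp (\<omega> * \<zeta> * cnj \<gamma>1) * exp (\<zeta> * (\<omega> * cnj (\<gamma> - \<gamma>1)))" for \<gamma>
      by (simp add: algebra_simps flip: exp_add)
    have "\<omega> * cnj (\<gamma>2 - \<gamma>1) = \<i> * of_real l"
    proof -
      have "\<gamma>2 - \<gamma>1 = - (of_real l * (\<i> * \<omega>))" using l(1) by (metis minus_diff_eq)
      then have "\<omega> * cnj (\<gamma>2 - \<gamma>1) = of_real l * \<i> * (\<omega> * cnj \<omega>)" by simp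
      then show ?thesis using \<omega>_cnj by simp
    qed
    then have two: "exp (\<omega> * \<zeta> * cnj \<gamma>2) = exp (\<omega> * \<zeta> * cnj \<gamma>1) * exp (\<i> * of_real l * \<zeta>)"
      using factor[of \<gamma>2] by (simp add: mult.commute)
    have "exp_sum \<Gamma> d (\<omega> * \<zeta>) = d \<gamma>1 * exp (\<omega> * \<zeta> * cnj \<gamma>1) + d \<gamma>2 * exp (\<omega> * \<zeta> * cnj \<gamma>2) +
        (\<Sum>\<gamma>\<in>J. d \<gamma> * exp (\<omega> * \<zeta> * cnj \<gamma>))"
    proof -
      have "\<Gamma> = insert \<gamma>1 (insert \<gamma>2 J)" "\<gamma>1 \<notin> insert \<gamma>2 J" "\<gamma>2 \<notin> J" "finite J"
        using \<open>\<gamma>1 \<in> \<Gamma>\<close> \<open>\<gamma>2 \<in> \<Gamma>\<close> face(2) assms(1) by (auto simp: J_def)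
      then show ?thesis unfolding exp_sum_def by (simp add: add.assoc)
    qed
    also have "\<dots> = exp (\<omega> * \<zeta> * cnj \<gamma>1) * G \<zeta>"
      unfolding G_def two
      by (subst factor) (simp add: distrib_left sum_distrib_left mult_ac)
    finally show ?thesis by simp
  qed
  have eq: "{z \<in> half_strip \<omega> C X. exp_sum \<Gamma> d z = 0 \<and> norm z \<le> E} =
      (\<lambda>\<zeta>. \<omega> * \<zeta>) ` {\<zeta>. G \<zeta> = 0 \<and> X \<le> Re \<zeta> \<and> \<bar>Im \<zeta>\<bar> \<le> C \<and> norm \<zeta> \<le> E}" for C X E
  proof -
    have unrot: "z = \<omega> * (z * cnj \<omega>)" for z
      using \<omega>_cnj by (simp add: mult.left_commute[of \<omega>])
    have cancel: "\<omega> * \<zeta> * cnj \<omega> = \<zeta>" for \<zeta>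
      using \<omega>_cnj by (simp add: mult.commute mult.left_commute)
    have norm: "norm (\<omega> * \<zeta>) = norm \<zeta>" for \<zeta>
      using unit by (simp add: norm_mult)
    show ?thesis (is "?L = ?R")
    proof
      show "?L \<subseteq> ?R"
      proof
        fix z assume z: "z \<in> ?L"
        then have "G (z * cnj \<omega>) = 0" "norm (z * cnj \<omega>) \<le> E"
          using zero_iff[of "z * cnj \<omega>"] norm[of "z * cnj \<omega>"] by (simp_all flip: unrot)
        then show "z \<in> ?R" using z unrot[of z] by blast
      qed
      show "?R \<subseteq> ?L"
      proof
        fix z assume "z \<in> ?R"
        then obtain \<zeta> where \<zeta>: "G \<zeta> = 0 \<and> X \<le> Re \<zeta> \<and> \<bar>Im \<zeta>\<bar> \<le> C \<and> norm \<zeta> \<le> E" "z = \<omega> * \<zeta>"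
          by blast
        show "z \<in> ?L"
          unfolding \<zeta>(2) mem_Collect_eq cancel norm zero_iff using \<zeta>(1) by blast
      qed
    qed
  qed
  have inj: "inj_on (\<lambda>\<zeta>. \<omega> * \<zeta>) A" for A
    using unit by (auto simp: inj_on_def)
  show ?thesis
    unfolding eq diam card_image[OF inj] finite_image_iff[OF inj] G_def
    using \<open>l > 0\<close> nz face(1) neg assms(1) by (intro strip_zero_count) (auto simp: J_def)
qed

text \<open>A common point is within distance \<open>C\<close> of both rays, whose distance from each other grows
linearly.\<close>

lemma half_strips_disjoint:
  assumes "norm \<omega> = 1" "norm \<omega>' = 1" "\<omega> \<noteq> \<omega>'"
  shows "\<forall>\<^sub>F X in at_top. half_strip \<omega> C X \<inter> half_strip \<omega>' C X = {}"
  using eventually_gt_at_top[of "4 * C / norm (\<omega> - \<omega>')"] eventually_ge_at_top[of 0]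
proof eventually_elim
  case (elim X)
  have near: "norm (z - of_real (Re (z * cnj \<nu>)) * \<nu>) \<le> C" if "z \<in> half_strip \<nu> C X" "norm \<nu> = 1" for z \<nu>
  proof -
    define \<zeta> where "\<zeta> = z * cnj \<nu>"
    have "\<nu> * cnj \<nu> = 1" using that(2) by (simp add: complex_norm_square[symmetric])
    then have "z = \<zeta> * \<nu>"
      by (simp add: \<zeta>_def mult.assoc mult.commute[of "cnj \<nu>"])
    then have "z - of_real (Re \<zeta>) * \<nu> = (\<zeta> - of_real (Re \<zeta>)) * \<nu>"
      by (simp add: left_diff_distrib)
    also have "\<zeta> - of_real (Re \<zeta>) = \<i> * of_real (Im \<zeta>)"
      by (simp add: complex_eq_iff)
    finally have "norm (z - of_real (Re \<zeta>) * \<nu>) = \<bar>Im \<zeta>\<bar>"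
      using that(2) by (simp add: norm_mult)
    then show ?thesis using that(1) unfolding \<zeta>_def by simp
  qed
  show ?case
  proof (rule ccontr)
    assume "half_strip \<omega> C X \<inter> half_strip \<omega>' C X \<noteq> {}"
    then obtain z where z: "z \<in> half_strip \<omega> C X" "z \<in> half_strip \<omega>' C X" by blast
    define s t where "s = Re (z * cnj \<omega>)" and "t = Re (z * cnj \<omega>')"
    have st: "norm (z - of_real s * \<omega>) \<le> C" "norm (z - of_real t * \<omega>') \<le> C" "s \<ge> X"
      using near[OF z(1) assms(1)] near[OF z(2) assms(2)] z(1) by (simp_all add: s_def t_def)
    have close: "norm (of_real s * \<omega> - of_real t * \<omega>') \<le> 2 * C"
      using st norm_triangle_ineq4[of "z - of_real t * \<omega>'" "z - of_real s * \<omega>"] by simp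
    have "t \<ge> X" using z(2) by (simp add: t_def)
    have "\<bar>s - t\<bar> \<le> 2 * C"
      using norm_triangle_ineq3[of "of_real s * \<omega>" "of_real t * \<omega>'"] close assms elim st(3) \<open>t \<ge> X\<close>
      by (simp add: norm_mult)
    have "of_real s * (\<omega> - \<omega>') = (of_real s * \<omega> - of_real t * \<omega>') - of_real (s - t) * \<omega>'"
      by (simp add: algebra_simps)
    then have "norm (of_real s * (\<omega> - \<omega>')) \<le> 2 * C + \<bar>s - t\<bar>"
      using norm_triangle_ineq4[of "of_real s * \<omega> - of_real t * \<omega>'" "of_real (s - t) * \<omega>'"] close assms(2)
      by (simp add: norm_mult del: of_real_diff)
    then have "s * norm (\<omega> - \<omega>') \<le> 4 * C"
      using \<open>\<bar>s - t\<bar> \<le> 2 * C\<close> st(3) elim by (simp add: norm_mult)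
    then have "s \<le> 4 * C / norm (\<omega> - \<omega>')"
      using assms(3) by (simp add: pos_le_divide_eq)
    then show False using st(3) elim by linarith
  qed
qed

text \<open>All but finitely many zeros lie in disjoint half-strips, one around each ray spanned by an edge
normal, and each half-strip contributes the length of its edge.\<close>

theorem exp_sum_zero_count:
  assumes "finite \<Gamma>" "\<Gamma> \<noteq> {}"
    and nz: "\<And>\<omega> \<gamma>. norm \<omega> = 1 \<Longrightarrow> \<gamma> \<in> support_face \<Gamma> \<omega> \<Longrightarrow> d \<gamma> \<noteq> 0"
    and two: "\<And>\<omega>. norm \<omega> = 1 \<Longrightarrow> card (support_face \<Gamma> \<omega>) \<le> 2"
  shows "\<And>E. finite {z. exp_sum \<Gamma> d z = 0 \<and> norm z \<le> E}"
    and "\<exists>B. \<forall>E\<ge>0. \<bar>real (card {z. exp_sum \<Gamma> d z = 0 \<and> norm z \<le> E}) - E / (2 * pi) * perimeter \<Gamma>\<bar> \<le> B"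
proof -
  define Z where "Z = (\<lambda>E. {z. exp_sum \<Gamma> d z = 0 \<and> norm z \<le> E})"
  show fin: "finite {z. exp_sum \<Gamma> d z = 0 \<and> norm z \<le> E}" for E
  proof -
    obtain \<gamma>0 where "\<gamma>0 \<in> support_face \<Gamma> 1"
      using support_face_nonempty[OF assms(1,2)] by blast
    then have "\<gamma>0 \<in> \<Gamma>" "d \<gamma>0 \<noteq> 0"
      using nz[of 1] support_face_subset by auto
    then obtain z0 where z0: "exp_sum \<Gamma> d z0 \<noteq> 0"
      using exp_sum_zero[OF assms(1), of d] unfolding exp_sum_def by blast
    have "exp_sum \<Gamma> d holomorphic_on UNIV"
      unfolding exp_sum_def by (intro holomorphic_intros)
    then have "finite {z \<in> cball 0 E. exp_sum \<Gamma> d z = 0}"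
    proof (cases "exp_sum \<Gamma> d constant_on UNIV")
      case True
      then have "exp_sum \<Gamma> d z \<noteq> 0" for z
        using z0 by (metis UNIV_I constant_on_def)
      then show ?thesis by simp
    next
      case False
      then show ?thesis
        using \<open>exp_sum \<Gamma> d holomorphic_on UNIV\<close>
        by (intro holomorphic_compact_finite_zeros[of _ UNIV]) auto
    qed
    then show ?thesis by (rule rev_finite_subset) auto
  qed
  then have finZ: "finite (Z E)" for E by (simp add: Z_def)
  define \<Omega> where "\<Omega> = edge_normals \<Gamma>"
  have "finite \<Omega>" unfolding \<Omega>_def by (rule finite_edge_normals[OF assms(1)])
  have unit: "norm \<omega> = 1" if "\<omega> \<in> \<Omega>" for \<omega>
    using that by (simp add: \<Omega>_def edge_normals_def)
  have "\<exists>C\<ge>0. \<forall>z. exp_sum \<Gamma> d z = 0 \<longrightarrow>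
      norm z \<le> C \<or> (\<exists>\<omega>\<in>\<Omega>. \<exists>t\<ge>0. norm (z - of_real t * \<omega>) \<le> C)"
    unfolding \<Omega>_def by (rule exp_sum_zeros_near_rays[OF assms(1,2)]) (rule nz)
  then obtain C1 where "C1 \<ge> 0" and C1: "\<And>z. exp_sum \<Gamma> d z = 0 \<Longrightarrow>
      norm z \<le> C1 \<or> (\<exists>\<omega>\<in>\<Omega>. \<exists>t\<ge>0. norm (z - of_real t * \<omega>) \<le> C1)"
    by metis
  define count where "count = (\<lambda>\<omega> C X B. \<forall>E\<ge>0.
    \<bar>real (card (half_strip \<omega> C X \<inter> Z E)) - E / (2 * pi) * diameter (support_face \<Gamma> \<omega>)\<bar> \<le> B)"
  have "\<forall>\<^sub>F C in at_top. \<forall>\<omega>\<in>\<Omega>. \<forall>\<^sub>F X in at_top. \<exists>B. count \<omega> C X B"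
  proof (rule eventually_ball_finite[OF \<open>finite \<Omega>\<close>], rule ballI)
    fix \<omega> assume "\<omega> \<in> \<Omega>"
    have eq: "{z \<in> half_strip \<omega> C X. exp_sum \<Gamma> d z = 0 \<and> norm z \<le> E} = half_strip \<omega> C X \<inter> Z E" for C X E
      by (auto simp: Z_def)
    have "\<forall>\<^sub>F C in at_top. \<forall>\<^sub>F X in at_top. \<exists>B. \<forall>E\<ge>0. finite (half_strip \<omega> C X \<inter> Z E) \<and>
        \<bar>real (card (half_strip \<omega> C X \<inter> Z E)) - E / (2 * pi) * diameter (support_face \<Gamma> \<omega>)\<bar> \<le> B"
      using exp_sum_half_strip_count[OF assms(1), of \<omega> d] \<open>\<omega> \<in> \<Omega>\<close> nz[OF unit] two[OF unit]
      unfolding eq \<Omega>_def by blast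
    then show "\<forall>\<^sub>F C in at_top. \<forall>\<^sub>F X in at_top. \<exists>B. count \<omega> C X B"
      unfolding count_def by eventually_elim (erule eventually_mono, blast)
  qed
  moreover have "\<forall>\<^sub>F C in at_top. C \<ge> C1" by (rule eventually_ge_at_top)
  ultimately have "\<forall>\<^sub>F C in at_top. (\<forall>\<omega>\<in>\<Omega>. \<forall>\<^sub>F X in at_top. \<exists>B. count \<omega> C X B) \<and> C \<ge> C1"
    by eventually_elim blast
  then obtain C where "C \<ge> C1" and C: "\<forall>\<omega>\<in>\<Omega>. \<forall>\<^sub>F X in at_top. \<exists>B. count \<omega> C X B"
    unfolding eventually_at_top_linorder by blast
  have "\<forall>\<^sub>F X in at_top. \<forall>\<omega>\<in>\<Omega>. \<exists>B. count \<omega> C X B"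
    using C by (rule eventually_ball_finite[OF \<open>finite \<Omega>\<close>])
  moreover have "\<forall>\<^sub>F X in at_top. \<forall>\<omega>\<in>\<Omega>. \<forall>\<omega>'\<in>\<Omega>. \<omega> \<noteq> \<omega>' \<longrightarrow> half_strip \<omega> C X \<inter> half_strip \<omega>' C X = {}"
  proof (intro eventually_ball_finite[OF \<open>finite \<Omega>\<close>] ballI)
    fix \<omega> \<omega>' assume "\<omega> \<in> \<Omega>" "\<omega>' \<in> \<Omega>"
    then show "\<forall>\<^sub>F X in at_top. \<omega> \<noteq> \<omega>' \<longrightarrow> half_strip \<omega> C X \<inter> half_strip \<omega>' C X = {}"
      using half_strips_disjoint[of \<omega> \<omega>' C] unit by (cases "\<omega> = \<omega>'") auto
  qed
  moreover have "\<forall>\<^sub>F X in at_top. X \<ge> (0::real)" by (rule eventually_ge_at_top)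
  ultimately have "\<forall>\<^sub>F X in at_top. (\<forall>\<omega>\<in>\<Omega>. \<exists>B. count \<omega> C X B) \<and> X \<ge> 0 \<and>
      (\<forall>\<omega>\<in>\<Omega>. \<forall>\<omega>'\<in>\<Omega>. \<omega> \<noteq> \<omega>' \<longrightarrow> half_strip \<omega> C X \<inter> half_strip \<omega>' C X = {})"
    by eventually_elim blast
  then obtain X where "X \<ge> 0" and ex_B: "\<forall>\<omega>\<in>\<Omega>. \<exists>B. count \<omega> C X B"
    and disj: "\<forall>\<omega>\<in>\<Omega>. \<forall>\<omega>'\<in>\<Omega>. \<omega> \<noteq> \<omega>' \<longrightarrow> half_strip \<omega> C X \<inter> half_strip \<omega>' C X = {}"
    unfolding eventually_at_top_linorder by blast
  obtain B where B: "\<And>\<omega>. \<omega> \<in> \<Omega> \<Longrightarrow> count \<omega> C X (B \<omega>)"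
    using ex_B by metis
  \<comment> \<open>A zero within \<open>C1\<close> of a ray can miss the half-strip only at its near end, hence only if its
    modulus is below \<open>R\<close>.\<close>
  define R where "R = X + 2 * C1"
  have cover: "norm z \<le> R \<or> (\<exists>\<omega>\<in>\<Omega>. z \<in> half_strip \<omega> C X)" if zero: "exp_sum \<Gamma> d z = 0" for z
  proof (cases "norm z \<le> C1")
    case True
    then show ?thesis using \<open>X \<ge> 0\<close> \<open>C1 \<ge> 0\<close> by (simp add: R_def)
  next
    case False
    then obtain \<omega> t where \<omega>: "\<omega> \<in> \<Omega>" "t \<ge> 0" "norm (z - of_real t * \<omega>) \<le> C1"
      using C1[OF zero] by blast
    have "\<omega> * cnj \<omega> = 1" using unit[OF \<omega>(1)] by (simp add: complex_norm_square[symmetric])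
    then obtain e where eq: "z * cnj \<omega> = of_real t + e" and e: "e = (z - of_real t * \<omega>) * cnj \<omega>"
      by (simp add: left_diff_distrib mult.assoc)
    have "norm e \<le> C1"
      using \<omega>(3) unit[OF \<omega>(1)] by (simp add: e norm_mult)
    then have "\<bar>Re e\<bar> \<le> C1" "\<bar>Im e\<bar> \<le> C1"
      using abs_Re_le_cmod[of e] abs_Im_le_cmod[of e] by linarith+
    then have "\<bar>Im (z * cnj \<omega>)\<bar> \<le> C" "Re (z * cnj \<omega>) \<ge> t - C1"
      using \<open>C \<ge> C1\<close> unfolding eq by simp_all
    moreover have "norm z \<le> t + C1"
      using norm_triangle_ineq[of "z - of_real t * \<omega>" "of_real t * \<omega>"] \<omega> unit[OF \<omega>(1)]
      by (simp add: norm_mult)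
    ultimately show ?thesis
      using \<omega>(1) unfolding R_def by force
  qed
  have "\<bar>real (card (Z E)) - E / (2 * pi) * perimeter \<Gamma>\<bar> \<le> real (card (Z R)) + (\<Sum>\<omega>\<in>\<Omega>. B \<omega>)"
    if "E \<ge> 0" for E
  proof -
    let ?H = "\<lambda>\<omega>. half_strip \<omega> C X \<inter> Z E"
    have "Z E = (Z E - (\<Union>\<omega>\<in>\<Omega>. ?H \<omega>)) \<union> (\<Union>\<omega>\<in>\<Omega>. ?H \<omega>)" by blast
    then have "card (Z E) = card (Z E - (\<Union>\<omega>\<in>\<Omega>. ?H \<omega>)) + card (\<Union>\<omega>\<in>\<Omega>. ?H \<omega>)"
      using finZ \<open>finite \<Omega>\<close> by (subst card_Un_disjoint[symmetric]) auto
    also have "card (\<Union>\<omega>\<in>\<Omega>. ?H \<omega>) = (\<Sum>\<omega>\<in>\<Omega>. card (?H \<omega>))"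
      using finZ \<open>finite \<Omega>\<close> disj by (intro card_UN_disjoint) blast+
    finally have card_eq: "real (card (Z E)) =
        real (card (Z E - (\<Union>\<omega>\<in>\<Omega>. ?H \<omega>))) + (\<Sum>\<omega>\<in>\<Omega>. real (card (?H \<omega>)))"
      by simp
    have "Z E - (\<Union>\<omega>\<in>\<Omega>. ?H \<omega>) \<subseteq> Z R"
      using cover unfolding Z_def by blast
    then have rest: "card (Z E - (\<Union>\<omega>\<in>\<Omega>. ?H \<omega>)) \<le> card (Z R)"
      by (rule card_mono[OF finZ])
    have "\<bar>(\<Sum>\<omega>\<in>\<Omega>. real (card (?H \<omega>))) - E / (2 * pi) * perimeter \<Gamma>\<bar> =
        \<bar>\<Sum>\<omega>\<in>\<Omega>. real (card (?H \<omega>)) - E / (2 * pi) * diameter (support_face \<Gamma> \<omega>)\<bar>"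
      unfolding perimeter_def \<Omega>_def[symmetric] sum_subtractf sum_distrib_left ..
    also have "\<dots> \<le> (\<Sum>\<omega>\<in>\<Omega>. B \<omega>)"
      using B that unfolding count_def by (intro order_trans[OF sum_abs] sum_mono) blast
    finally show ?thesis using card_eq rest by linarith
  qed
  then show "\<exists>B. \<forall>E\<ge>0. \<bar>real (card {z. exp_sum \<Gamma> d z = 0 \<and> norm z \<le> E}) - E / (2 * pi) * perimeter \<Gamma>\<bar> \<le> B"
    unfolding Z_def by blast
qed

section \<open>Diagonalisable matrices\<close>

lemma matrix_inv_mult:
  fixes A :: "'a::semiring_1 ^ 'n ^ 'n"
  assumes "invertible A"
  shows "A ** matrix_inv A = mat 1" "matrix_inv A ** A = mat 1"
proof -
  have "A ** matrix_inv A = mat 1 \<and> matrix_inv A ** A = mat 1"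
    using assms unfolding matrix_inv_def invertible_def by (rule someI_ex)
  then show "A ** matrix_inv A = mat 1" "matrix_inv A ** A = mat 1" by blast+
qed

lemma matrix_inv_unique:
  fixes A B :: "'a::semiring_1 ^ 'n ^ 'n"
  assumes "A ** B = mat 1" "B ** A = mat 1"
  shows "matrix_inv A = B"
proof -
  have "invertible A" using assms by (auto simp: invertible_def)
  then have "matrix_inv A = (matrix_inv A ** A) ** B"
    using assms by (metis matrix_mul_assoc matrix_mul_rid)
  also have "\<dots> = B" using matrix_inv_mult(2)[OF \<open>invertible A\<close>] by simp
  finally show ?thesis .
qed

lemma matrix_inv_vec_cancel:
  fixes V :: "complex ^ 'n ^ 'n"
  assumes "invertible V"
  shows "V *v (matrix_inv V *v x) = x" "matrix_inv V *v (V *v x) = x"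
  by (simp_all add: matrix_vector_mul_assoc matrix_inv_mult[OF assms])

lemma diag_mult_vec_nth: "(diag d *v x) $ i = d i * x $ i"
  by (simp add: matrix_vector_mult_def diag_def if_distrib if_distribR sum.delta cong: if_cong)

lemma matrix_mult_vec_smult:
  fixes M :: "complex ^ 'n ^ 'm"
  shows "M *v (c *s x) = c *s (M *v x)"
  by (simp add: matrix_vector_mult_def vec_eq_iff sum_distrib_left mult.left_commute)

lemma matrix_eqI_vec:
  fixes A B :: "complex ^ 'n ^ 'm"
  assumes "\<And>x. A *v x = B *v x"
  shows "A = B"
  using assms matrix_eq by blast

lemma diag_conj_mult_diag_conj:
  fixes V :: "complex ^ 'n ^ 'n"
  assumes "invertible V"
  shows "(V ** diag d ** matrix_inv V) ** (V ** diag e ** matrix_inv V) =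
    V ** diag (\<lambda>i. d i * e i) ** matrix_inv V"
proof (rule matrix_eqI_vec)
  fix x
  have "diag d *v (diag e *v y) = diag (\<lambda>i. d i * e i) *v y" for y :: "complex ^ 'n"
    by (simp add: vec_eq_iff diag_mult_vec_nth mult.assoc)
  then show "((V ** diag d ** matrix_inv V) ** (V ** diag e ** matrix_inv V)) *v x =
      (V ** diag (\<lambda>i. d i * e i) ** matrix_inv V) *v x"
    by (simp only: matrix_vector_mul_assoc[symmetric] matrix_inv_vec_cancel[OF assms])
qed

lemma diag_conj_one:
  fixes V :: "complex ^ 'n ^ 'n"
  assumes "invertible V"
  shows "V ** diag (\<lambda>i. 1) ** matrix_inv V = mat 1"
proof -
  have "diag (\<lambda>i. 1) = (mat 1 :: complex ^ 'n ^ 'n)"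
    by (simp add: diag_def mat_def)
  then show ?thesis by (simp add: matrix_inv_mult[OF assms])
qed

lemma matrix_eigenvalues_diag_conj:
  fixes V :: "complex ^ 'n ^ 'n"
  assumes "invertible V"
  shows "matrix_eigenvalues (V ** diag d ** matrix_inv V) = range d"
proof
  show "matrix_eigenvalues (V ** diag d ** matrix_inv V) \<subseteq> range d"
  proof
    fix \<mu> assume "\<mu> \<in> matrix_eigenvalues (V ** diag d ** matrix_inv V)"
    then obtain w where w: "w \<noteq> 0" "(V ** diag d ** matrix_inv V) *v w = \<mu> *s w"
      by (auto simp: matrix_eigenvalues_def)
    define y where "y = matrix_inv V *v w"
    have "V *v (diag d *v y) = \<mu> *s w"
      using w(2) by (simp only: y_def matrix_vector_mul_assoc matrix_mul_assoc)
    then have "diag d *v y = \<mu> *s y"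
      by (metis assms matrix_inv_vec_cancel(2) matrix_mult_vec_smult y_def)
    moreover have "y \<noteq> 0"
      using w(1) matrix_inv_vec_cancel(1)[OF assms, of w] by (auto simp: y_def)
    then obtain i where "y $ i \<noteq> 0" by (auto simp: vec_eq_iff)
    ultimately have "d i * y $ i = \<mu> * y $ i"
      by (metis diag_mult_vec_nth vector_smult_component)
    then show "\<mu> \<in> range d" using \<open>y $ i \<noteq> 0\<close> by auto
  qed
  show "range d \<subseteq> matrix_eigenvalues (V ** diag d ** matrix_inv V)"
  proof
    fix \<mu> assume "\<mu> \<in> range d"
    then obtain i where \<mu>: "\<mu> = d i" by blast
    define w where "w = V *v axis i (1::complex)"
    have inv_w: "matrix_inv V *v w = axis i 1"
      by (simp add: w_def matrix_inv_vec_cancel[OF assms])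
    then have "w \<noteq> 0" by (metis axis_eq_0_iff matrix_vector_mult_0_right zero_neq_one)
    moreover have "diag d *v axis i 1 = d i *s axis i 1"
      by (simp add: vec_eq_iff diag_mult_vec_nth axis_def)
    then have "(V ** diag d ** matrix_inv V) *v w = \<mu> *s w"
      by (simp add: matrix_vector_mul_assoc[symmetric] inv_w matrix_mult_vec_smult \<mu>)
         (simp add: w_def)
    ultimately show "\<mu> \<in> matrix_eigenvalues (V ** diag d ** matrix_inv V)"
      unfolding matrix_eigenvalues_def by blast
  qed
qed

lemma diag_conj_inverse:
  fixes V :: "complex ^ 'n ^ 'n"
  assumes "invertible V" "invertible (V ** diag d ** matrix_inv V)"
  shows "(V ** diag d ** matrix_inv V) ** (V ** diag (\<lambda>i. inverse (d i)) ** matrix_inv V) = mat 1"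
    and "(V ** diag (\<lambda>i. inverse (d i)) ** matrix_inv V) ** (V ** diag d ** matrix_inv V) = mat 1"
proof -
  have "d i \<noteq> 0" for i
  proof
    assume "d i = 0"
    then have "0 \<in> matrix_eigenvalues (V ** diag d ** matrix_inv V)"
      unfolding matrix_eigenvalues_diag_conj[OF assms(1)] by (metis rangeI)
    then obtain w where "w \<noteq> 0" "(V ** diag d ** matrix_inv V) *v w = 0"
      by (auto simp: matrix_eigenvalues_def)
    then show False
      by (metis assms(2) matrix_inv_vec_cancel(2) matrix_vector_mult_0_right)
  qed
  then show "(V ** diag d ** matrix_inv V) ** (V ** diag (\<lambda>i. inverse (d i)) ** matrix_inv V) = mat 1"
    "(V ** diag (\<lambda>i. inverse (d i)) ** matrix_inv V) ** (V ** diag d ** matrix_inv V) = mat 1"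
    by (simp_all add: diag_conj_mult_diag_conj[OF assms(1)] diag_conj_one[OF assms(1)])
qed

text \<open>For invertible \<open>V\<close> this is the matrix exponential of \<open>z * t\<close> times \<open>V ** diag e ** matrix_inv V\<close>.\<close>

definition flow :: "complex ^ 'n ^ 'n \<Rightarrow> ('n \<Rightarrow> complex) \<Rightarrow> complex \<Rightarrow> real \<Rightarrow> complex ^ 'n ^ 'n" where
  "flow V e z t = V ** diag (\<lambda>i. exp (z * (e i * of_real t))) ** matrix_inv V"

lemma propagator_Suc_flow:
  "propagator p V a z (Suc s) =
    flow (V (Suc s)) (\<lambda>i. inverse (a (Suc s) i)) z (p (Suc s) - p s) ** propagator p V a z s"
  by (simp add: flow_def matrix_mul_assoc)

lemma flow_0: "invertible V \<Longrightarrow> flow V e z 0 = mat 1"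
  by (simp add: flow_def diag_conj_one)

lemma flow_vec_eq_sum:
  fixes V :: "complex ^ 'n ^ 'n"
  shows "flow V e z t *v y =
    (\<Sum>i\<in>UNIV. exp (z * (e i * of_real t)) *s ((matrix_inv V *v y) $ i *s column i V))"
  by (simp add: flow_def matrix_vector_mul_assoc[symmetric] matrix_mult_sum[of V] diag_mult_vec_nth
      vector_smult_assoc)

lemma bounded_linear_smult_left: "bounded_linear (\<lambda>c::complex. c *s (x :: complex ^ 'n))"
  by (auto simp: linear_conv_bounded_linear[symmetric] vec_eq_iff algebra_simps intro!: linearI)

lemma bounded_linear_matrix_vec_nth:
  "bounded_linear (\<lambda>x :: complex ^ 'n. ((M :: complex ^ 'n ^ 'm) *v x) $ i)"
  by (auto simp: linear_conv_bounded_linear[symmetric] matrix_vector_mult_def sum.distrib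
      scaleR_sum_right algebra_simps intro!: linearI)

lemma bounded_linear_matrix_vec:
  "bounded_linear (\<lambda>x :: complex ^ 'n. (M :: complex ^ 'n ^ 'm) *v x)"
  by (auto simp: linear_conv_bounded_linear[symmetric] matrix_vector_mult_def sum.distrib vec_eq_iff
      scaleR_sum_right algebra_simps intro!: linearI)

lemma bounded_linear_smult_right: "bounded_linear (\<lambda>x :: complex ^ 'n. c *s x)"
  by (auto simp: linear_conv_bounded_linear[symmetric] vec_eq_iff algebra_simps intro!: linearI)

lemma flow_has_vector_derivative:
  fixes V :: "complex ^ 'n ^ 'n"
  assumes "invertible V"
  shows "((\<lambda>x. flow V e z (x - l) *v y) has_vector_derivative
    z *s ((V ** diag e ** matrix_inv V) *v (flow V e z (x - l) *v y))) (at x)"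
proof -
  let ?E = "\<lambda>i x. exp (z * (e i * of_real (x - l)))"
  let ?c = "matrix_inv V *v y"
  have "((\<lambda>x. ?E i x) has_vector_derivative z * e i * ?E i x) (at x)" for i
  proof -
    have "((\<lambda>w. exp (z * (e i * (w - of_real l)))) has_field_derivative z * e i * ?E i x) (at (of_real x))"
      by (auto intro!: derivative_eq_intros)
    from has_vector_derivative_real_field[OF this] show ?thesis by simp
  qed
  then have "((\<lambda>x. ?E i x *s (?c $ i *s column i V)) has_vector_derivative
      (z * e i * ?E i x) *s (?c $ i *s column i V)) (at x)" for i
    by (rule bounded_linear.has_vector_derivative[OF bounded_linear_smult_left])
  then have "((\<lambda>x. flow V e z (x - l) *v y) has_vector_derivative
      (\<Sum>i\<in>UNIV. (z * e i * ?E i x) *s (?c $ i *s column i V))) (at x)"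
    unfolding flow_vec_eq_sum by (intro has_vector_derivative_sum)
  also have "(\<Sum>i\<in>UNIV. (z * e i * ?E i x) *s (?c $ i *s column i V)) =
      V *v (z *s (diag e *v (diag (\<lambda>i. ?E i x) *v ?c)))"
    by (simp add: matrix_mult_sum[of V] diag_mult_vec_nth vector_smult_assoc mult.assoc)
  also have "\<dots> = z *s ((V ** diag e ** matrix_inv V) *v (flow V e z (x - l) *v y))"
    by (simp add: flow_def matrix_vector_mul_assoc[symmetric] matrix_inv_vec_cancel[OF assms]
        matrix_mult_vec_smult)
  finally show ?thesis .
qed

section \<open>Weak solutions of linear differential equations\<close>

lemma test_function_outside:
  assumes "test_function l r \<phi>" "x \<notin> {l<..<r}"
  shows "\<phi> x = 0" "deriv \<phi> x = 0"
proof -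
  let ?C = "closure {x. \<phi> x \<noteq> 0}"
  have x: "x \<in> - ?C" using assms by (auto simp: test_function_def)
  have zero: "\<phi> y = 0" if "y \<in> - ?C" for y
    using that closure_subset[of "{x. \<phi> x \<noteq> 0}"] by blast
  then show "\<phi> x = 0" using x by blast
  have "(\<phi> has_field_derivative 0) (at x)"
  proof (rule has_field_derivative_transform_within_open)
    show "((\<lambda>_. 0) has_field_derivative 0) (at x)" by (rule DERIV_const)
    show "open (- ?C)" by (rule open_Compl[OF closed_closure])
    show "x \<in> - ?C" by (rule x)
    show "\<And>y. y \<in> - ?C \<Longrightarrow> 0 = \<phi> y" by (rule zero[symmetric])
  qed
  then show "deriv \<phi> x = 0" by (rule DERIV_imp_deriv)
qed

lemma test_function_C1:
  assumes "test_function l r \<phi>"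
  shows "(\<phi> has_real_derivative deriv \<phi> x) (at x)" "continuous_on S (deriv \<phi>)" "continuous_on S \<phi>"
proof -
  obtain D where D: "\<And>x. (\<phi> has_vector_derivative D x) (at x)" "continuous_on UNIV D"
    using assms by (auto simp: test_function_def C1_differentiable_on_def)
  then have der: "(\<phi> has_real_derivative D x) (at x)" for x
    by (simp add: has_real_derivative_iff_has_vector_derivative)
  then have "deriv \<phi> = D" using DERIV_imp_deriv by blast
  then show "(\<phi> has_real_derivative deriv \<phi> x) (at x)" "continuous_on S (deriv \<phi>)"
    using der continuous_on_subset[OF D(2), of S] by auto
  show "continuous_on S \<phi>"
    using der by (meson DERIV_continuous_on has_field_derivative_at_within)
qed

lemma test_function_mono:
  assumes "test_function l r \<phi>" "L \<le> l" "r \<le> R"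
  shows "test_function L R \<phi>"
  using assms by (fastforce simp: test_function_def)

lemma LINT_open_interval:
  fixes f :: "real \<Rightarrow> 'a::euclidean_space"
  assumes "continuous_on {l..r} f"
  shows "set_integrable lborel {l<..<r} f" "(LINT x:{l<..<r}|lborel. f x) = integral {l..r} f"
proof -
  have "set_integrable lborel {l..r} f"
    by (rule borel_integrable_atLeastAtMost'[OF assms])
  then show *: "set_integrable lborel {l<..<r} f"
    by (rule set_integrable_subset) auto
  then show "(LINT x:{l<..<r}|lborel. f x) = integral {l..r} f"
    by (simp add: set_borel_integral_eq_integral integral_open_interval_real)
qed

text \<open>On an inner interval choose a test function whose derivative is \<open>\<eta> * (h - c)\<close>, where \<open>\<eta>\<close> is a bump
and \<open>c\<close> is the mean of \<open>h\<close> with weight \<open>\<eta>\<close>. The mean value makes the support of the test function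
compact, and the hypothesis becomes the vanishing of the integral of \<open>\<eta> * (h - c)\<^sup>2\<close>.\<close>

lemma du_Bois_Reymond:
  fixes h :: "real \<Rightarrow> real"
  assumes "l < r" "continuous_on {l..r} h"
    and weak: "\<And>\<phi>. test_function l r \<phi> \<Longrightarrow> integral {l..r} (\<lambda>x. deriv \<phi> x * h x) = 0"
    and "x \<in> {l..r}"
  shows "h x = h l"
proof -
  have local_const: "\<exists>c. \<forall>x\<in>{x1<..<x2}. h x = c" if x12: "l < x1" "x1 < x2" "x2 < r" for x1 x2
  proof -
    define \<eta> where "\<eta> = (\<lambda>t. max 0 ((t - x1) * (x2 - t)))"
    have \<eta>_nonneg: "\<eta> t \<ge> 0" for t by (simp add: \<eta>_def)
    have \<eta>_out: "\<eta> t = 0" if "t \<notin> {x1<..<x2}" for t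
    proof -
      have "(t - x1) * (x2 - t) \<le> 0"
        using that x12(2) by (cases "t \<le> x1") (auto intro: mult_nonpos_nonneg mult_nonneg_nonpos)
      then show ?thesis by (simp add: \<eta>_def)
    qed
    have \<eta>_pos: "\<eta> t > 0" if "t \<in> {x1<..<x2}" for t
      using that by (auto simp: \<eta>_def less_max_iff_disj)
    \<comment> \<open>Outside the inner interval \<open>h\<close> is replaced by its values at the end points; the bump vanishes
      there, but the antiderivative below has to be defined on the whole line.\<close>
    define H where "H = (\<lambda>t. h (max x1 (min x2 t)))"
    have H_cont: "continuous_on S H" for S
      unfolding H_def
      by (rule continuous_on_compose2[OF assms(2)]) (use x12 in \<open>auto intro!: continuous_intros\<close>)
    have H_eq: "H t = h t" if "t \<in> {x1<..<x2}" for t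
      using that by (simp add: H_def)
    have \<eta>_cont: "continuous_on S \<eta>" for S
      unfolding \<eta>_def by (intro continuous_intros)
    have "integral {x1..x2} \<eta> \<noteq> 0"
    proof
      assume "integral {x1..x2} \<eta> = 0"
      then have "\<eta> ((x1 + x2) / 2) = 0"
        using integral_eq_0_iff[OF \<eta>_cont x12(2) \<eta>_nonneg] x12(2) by simp
      then show False using \<eta>_pos[of "(x1 + x2) / 2"] x12(2) by simp
    qed
    define c where "c = integral {x1..x2} (\<lambda>t. \<eta> t * H t) / integral {x1..x2} \<eta>"
    define k where "k = (\<lambda>t. \<eta> t * (H t - c))"
    have k_cont: "continuous_on S k" for S
      unfolding k_def by (intro continuous_intros \<eta>_cont H_cont)
    have k_out: "k t = 0" if "t \<notin> {x1<..<x2}" for t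
      using \<eta>_out[OF that] by (simp add: k_def)
    have k_int: "integral {x1..x2} k = 0"
    proof -
      have "integral {x1..x2} k = integral {x1..x2} (\<lambda>t. \<eta> t * H t - c * \<eta> t)"
        by (simp add: k_def algebra_simps)
      also have "\<dots> = integral {x1..x2} (\<lambda>t. \<eta> t * H t) - c * integral {x1..x2} \<eta>"
        by (subst integral_diff)
           (auto intro!: integrable_continuous_real continuous_intros \<eta>_cont H_cont)
      also have "\<dots> = 0" using \<open>integral {x1..x2} \<eta> \<noteq> 0\<close> by (simp add: c_def)
      finally show ?thesis .
    qed
    \<comment> \<open>Starting at \<open>l - 1\<close> makes every \<open>t \<ge> l\<close> an interior point of an interval of integration, so
      the derivative is two-sided.\<close>
    define \<phi> where "\<phi> = (\<lambda>t. integral {l - 1..t} k)"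
    have \<phi>_left: "\<phi> t = 0" if "t \<le> x1" for t
      unfolding \<phi>_def using that k_out by (intro integral_unique has_integral_is_0) auto
    have \<phi>_right: "\<phi> t = 0" if "t \<ge> x2" for t
    proof -
      have "integral {x2..t} k = 0"
        using k_out by (intro integral_unique has_integral_is_0) auto
      moreover have "integral {l - 1..x1} k = 0" using \<phi>_left[of x1] by (simp add: \<phi>_def)
      moreover have "integral {l - 1..x1} k + integral {x1..x2} k = integral {l - 1..x2} k"
        using x12 by (intro Henstock_Kurzweil_Integration.integral_combine integrable_continuous_real k_cont) auto
      moreover have "integral {l - 1..x2} k + integral {x2..t} k = integral {l - 1..t} k"
        using x12 that by (intro Henstock_Kurzweil_Integration.integral_combine integrable_continuous_real k_cont) auto
      ultimately show ?thesis using k_int by (simp add: \<phi>_def)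
    qed
    have \<phi>_deriv: "(\<phi> has_vector_derivative k t) (at t)" for t
    proof (cases "t < l")
      case True
      have "(\<phi> has_vector_derivative 0) (at t)"
        by (rule has_vector_derivative_transform_within_open[of "\<lambda>_. 0" _ _ "{..<l}"])
           (use True \<phi>_left x12 in auto)
      then show ?thesis using k_out[of t] True x12 by simp
    next
      case False
      have "(\<phi> has_vector_derivative k t) (at t within {l - 1..t + 1})"
        unfolding \<phi>_def using False by (intro integral_has_vector_derivative k_cont) auto
      moreover have "at t within {l - 1..t + 1} = at t"
        using False by (intro at_within_interior) (auto simp: interior_atLeastAtMost_real)
      ultimately show ?thesis by simp
    qed
    then have \<phi>_real_deriv: "(\<phi> has_real_derivative k t) (at t)" for t
      by (simp add: has_real_derivative_iff_has_vector_derivative)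
    then have deriv_\<phi>: "deriv \<phi> = k" using DERIV_imp_deriv by blast
    have "{x. \<phi> x \<noteq> 0} \<subseteq> {x1..x2}" 
      using \<phi>_left \<phi>_right by (metis (mono_tags, lifting) atLeastAtMost_iff linorder_le_cases mem_Collect_eq subsetI)
    then have "closure {x. \<phi> x \<noteq> 0} \<subseteq> {x1..x2}" by (intro closure_minimal) auto
    then have "test_function l r \<phi>"
    proof -
      have "\<phi> C1_differentiable_on UNIV"
        unfolding C1_differentiable_on_def using \<phi>_deriv k_cont by blast
      moreover have "{x1..x2} \<subseteq> {l<..<r}" using x12 by auto
      ultimately show ?thesis
        using \<open>closure {x. \<phi> x \<noteq> 0} \<subseteq> {x1..x2}\<close> unfolding test_function_def by blast
    qed
    then have "integral {l..r} (\<lambda>x. k x * h x) = 0"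
      using weak[of \<phi>] by (simp add: deriv_\<phi>)
    moreover have "integral {l..r} k = 0"
    proof -
      have "(k has_integral (\<phi> r - \<phi> l)) {l..r}"
        using \<phi>_deriv \<open>l < r\<close>
        by (intro fundamental_theorem_of_calculus) (auto intro: has_vector_derivative_at_within)
      then show ?thesis using \<phi>_left[of l] \<phi>_right[of r] x12 by (simp add: integral_unique)
    qed
    moreover have "integral {l..r} (\<lambda>x. k x * (h x - c)) =
        integral {l..r} (\<lambda>x. k x * h x) - c * integral {l..r} k"
    proof -
      have "integral {l..r} (\<lambda>x. k x * (h x - c)) = integral {l..r} (\<lambda>x. k x * h x - c * k x)"
        by (simp add: algebra_simps)
      also have "\<dots> = integral {l..r} (\<lambda>x. k x * h x) - c * integral {l..r} k"
        by (subst integral_diff)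
           (auto intro!: integrable_continuous_real continuous_intros k_cont assms(2))
      finally show ?thesis .
    qed
    ultimately have "integral {l..r} (\<lambda>x. k x * (h x - c)) = 0" by simp
    moreover have "continuous_on {l..r} (\<lambda>x. k x * (h x - c))"
      by (intro continuous_intros k_cont assms(2))
    moreover have "k t * (h t - c) \<ge> 0" for t
    proof (cases "t \<in> {x1<..<x2}")
      case True
      then have "k t * (h t - c) = \<eta> t * (h t - c)\<^sup>2"
        by (simp add: k_def H_eq power2_eq_square)
      then show ?thesis using \<eta>_nonneg by simp
    qed (simp add: k_out)
    ultimately have zero: "\<forall>t\<in>{l..r}. k t * (h t - c) = 0"
      using integral_eq_0_iff[of l r "\<lambda>x. k x * (h x - c)"] \<open>l < r\<close> by blast
    have "h t = c" if t: "t \<in> {x1<..<x2}" for t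
    proof -
      have "k t * (h t - c) = 0" using zero t x12 by auto
      then show ?thesis using \<eta>_pos[OF t] H_eq[OF t] by (simp add: k_def)
    qed
    then show ?thesis by blast
  qed
  define c where "c = h ((l + r) / 2)"
  have "h t = c" if "t \<in> {l<..<r}" for t
  proof -
    define x1 x2 where "x1 = (l + min t ((l + r) / 2)) / 2" and "x2 = (r + max t ((l + r) / 2)) / 2"
    have "l < x1" "x1 < x2" "x2 < r" "t \<in> {x1<..<x2}" "(l + r) / 2 \<in> {x1<..<x2}"
      using that by (auto simp: x1_def x2_def min_def max_def field_simps)
    then show ?thesis using local_const[of x1 x2] unfolding c_def by metis
  qed
  moreover have "closure {l<..<r} = {l..r}" using \<open>l < r\<close> by simp
  ultimately have "h t = c" if "t \<in> {l..r}" for t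
    using continuous_constant_on_closure[of "{l<..<r}" h c t] assms(2) that by simp
  then show ?thesis using \<open>x \<in> {l..r}\<close> \<open>l < r\<close> by simp
qed

text \<open>The difference of \<open>w\<close> and an antiderivative of \<open>\<mu> * w\<close> has weak derivative zero and is constant.
So \<open>w\<close> is continuously differentiable and solves the equation in the classical sense.\<close>

lemma weak_scalar_ode:
  fixes w :: "real \<Rightarrow> complex"
  assumes "l < r" "continuous_on {l..r} w"
    and weak: "\<And>\<phi>. test_function l r \<phi> \<Longrightarrow>
      integral {l..r} (\<lambda>x. deriv \<phi> x *\<^sub>R w x) = - integral {l..r} (\<lambda>x. \<phi> x *\<^sub>R (\<mu> * w x))"
    and "x \<in> {l..r}"
  shows "w x = exp (\<mu> * of_real (x - l)) * w l"
proof -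
  define G where "G = (\<lambda>x. integral {l..x} (\<lambda>t. \<mu> * w t))"
  have G_deriv: "(G has_vector_derivative \<mu> * w t) (at t within {l..r})" if "t \<in> {l..r}" for t
    unfolding G_def using assms(2) that
    by (intro integral_has_vector_derivative continuous_intros) auto
  have G_cont: "continuous_on {l..r} G"
    using G_deriv by (meson continuous_on_eq_continuous_within has_vector_derivative_continuous)
  define h where "h = (\<lambda>t. w t - G t)"
  have h_cont: "continuous_on {l..r} h"
    unfolding h_def by (intro continuous_intros assms(2) G_cont)
  have h_weak: "integral {l..r} (\<lambda>x. deriv \<phi> x *\<^sub>R h x) = 0" if \<phi>: "test_function l r \<phi>" for \<phi>
  proof -
    have "((\<lambda>x. deriv \<phi> x *\<^sub>R G x) has_integral - integral {l..r} (\<lambda>x. \<phi> x *\<^sub>R (\<mu> * w x))) {l..r}"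
    proof (rule integration_by_parts_interior[OF bounded_bilinear_scaleR])
      show "(\<phi> has_vector_derivative deriv \<phi> t) (at t)" for t
        using test_function_C1(1)[OF \<phi>] by (simp add: has_real_derivative_iff_has_vector_derivative)
      show "(G has_vector_derivative \<mu> * w t) (at t)" if "t \<in> {l<..<r}" for t
      proof -
        have "at t within {l..r} = at t"
          using that by (intro at_within_interior) (auto simp: interior_atLeastAtMost_real)
        then show ?thesis using G_deriv[of t] that by simp
      qed
      have "((\<lambda>x. \<phi> x *\<^sub>R (\<mu> * w x)) has_integral integral {l..r} (\<lambda>x. \<phi> x *\<^sub>R (\<mu> * w x))) {l..r}"
        by (intro integrable_integral integrable_continuous_real continuous_intros
            test_function_C1(3)[OF \<phi>] assms(2))
      then show "((\<lambda>x. \<phi> x *\<^sub>R (\<mu> * w x)) has_integral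
          (\<phi> r *\<^sub>R G r - \<phi> l *\<^sub>R G l - - integral {l..r} (\<lambda>x. \<phi> x *\<^sub>R (\<mu> * w x)))) {l..r}"
        using test_function_outside(1)[OF \<phi>, of l] test_function_outside(1)[OF \<phi>, of r] by simp
    qed (use \<open>l < r\<close> G_cont test_function_C1(3)[OF \<phi>] in auto)
    then have G_int: "integral {l..r} (\<lambda>x. deriv \<phi> x *\<^sub>R G x) = integral {l..r} (\<lambda>x. deriv \<phi> x *\<^sub>R w x)"
      using weak[OF \<phi>] by (simp add: integral_unique)
    have "integral {l..r} (\<lambda>x. deriv \<phi> x *\<^sub>R h x) =
        integral {l..r} (\<lambda>x. deriv \<phi> x *\<^sub>R w x) - integral {l..r} (\<lambda>x. deriv \<phi> x *\<^sub>R G x)"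
      unfolding h_def scaleR_diff_right
      by (intro integral_diff integrable_continuous_real continuous_intros test_function_C1(2)[OF \<phi>]
          assms(2) G_cont)
    then show ?thesis using G_int by simp
  qed
  have h_const: "h t = h l" if "t \<in> {l..r}" for t
  proof (rule complex_eqI)
    have part: "integral {l..r} (\<lambda>x. deriv \<phi> x * P (h x)) = 0"
      if "test_function l r \<phi>" "bounded_linear P" for \<phi> and P :: "complex \<Rightarrow> real"
    proof -
      have "integral {l..r} (P \<circ> (\<lambda>x. deriv \<phi> x *\<^sub>R h x)) = P (integral {l..r} (\<lambda>x. deriv \<phi> x *\<^sub>R h x))"
        by (intro integral_linear integrable_continuous_real continuous_intros that(2)
            test_function_C1(2)[OF that(1)] h_cont)
      then show ?thesis
        using h_weak[OF that(1)] linear_simps[OF that(2)] by (simp add: o_def)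
    qed
    show "Re (h t) = Re (h l)"
      using du_Bois_Reymond[of l r "\<lambda>x. Re (h x)" t] part[OF _ bounded_linear_Re] \<open>l < r\<close> that h_cont
      by (simp add: continuous_on_Re)
    show "Im (h t) = Im (h l)"
      using du_Bois_Reymond[of l r "\<lambda>x. Im (h x)" t] part[OF _ bounded_linear_Im] \<open>l < r\<close> that h_cont
      by (simp add: continuous_on_Im)
  qed
  have w_eq: "w t = w l + G t" if "t \<in> {l..r}" for t
    using h_const[OF that] by (simp add: h_def G_def algebra_simps)
  have w_deriv: "(w has_vector_derivative \<mu> * w t) (at t within {l..r})" if "t \<in> {l..r}" for t
  proof (rule has_vector_derivative_transform[OF that])
    show "w s = w l + G s" if "s \<in> {l..r}" for s using w_eq[OF that] .
    show "((\<lambda>s. w l + G s) has_vector_derivative \<mu> * w t) (at t within {l..r})"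
      using has_vector_derivative_add[OF has_vector_derivative_const G_deriv[OF that]] by simp
  qed
  define E where "E = (\<lambda>t. exp (- \<mu> * of_real (t - l)))"
  have E_deriv: "(E has_vector_derivative - \<mu> * E t) (at t within S)" for t S
  proof -
    have "((\<lambda>w. exp (- \<mu> * (w - of_real l))) has_field_derivative - \<mu> * E t) (at (of_real t))"
      unfolding E_def by (auto intro!: derivative_eq_intros)
    from has_vector_derivative_real_field[OF this] show ?thesis
      unfolding E_def by (auto intro: has_vector_derivative_at_within)
  qed
  have "((\<lambda>t. E t * w t) has_derivative (\<lambda>_. 0)) (at t within {l..r})" if "t \<in> {l..r}" for t
  proof -
    have "((\<lambda>t. E t * w t) has_vector_derivative E t * (\<mu> * w t) + - \<mu> * E t * w t) (at t within {l..r})"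
      by (rule has_vector_derivative_mult[OF E_deriv w_deriv[OF that]])
    then show ?thesis by (simp add: has_vector_derivative_def mult_ac)
  qed
  then obtain c where c: "\<And>t. t \<in> {l..r} \<Longrightarrow> E t * w t = c"
    using has_derivative_zero_constant[of "{l..r}" "\<lambda>t. E t * w t"] by auto
  have "E x * w x = w l"
    using c[OF \<open>x \<in> {l..r}\<close>] c[of l] \<open>l < r\<close> by (simp add: E_def)
  moreover have "exp (\<mu> * of_real (x - l)) * E x = 1"
    by (simp add: E_def flip: exp_add)
  ultimately show ?thesis
    by (metis mult.assoc mult_1)
qed

text \<open>The change of variables \<open>matrix_inv V\<close> decouples the system into scalar equations. It commutes
with the integrals because it is linear.\<close>

lemma weak_system_eq_flow:
  fixes f :: "real \<Rightarrow> complex ^ 'n" and V :: "complex ^ 'n ^ 'n"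
  assumes "l < r" "continuous_on {l..r} f" "invertible V"
    and weak: "\<And>\<phi>. test_function l r \<phi> \<Longrightarrow> integral {l..r} (\<lambda>x. deriv \<phi> x *\<^sub>R f x) =
      - integral {l..r} (\<lambda>x. \<phi> x *\<^sub>R (z *s ((V ** diag e ** matrix_inv V) *v f x)))"
    and "x \<in> {l..r}"
  shows "f x = flow V e z (x - l) *v f l"
proof -
  define y where "y = (\<lambda>i t. (matrix_inv V *v f t) $ i)"
  have lin: "bounded_linear (\<lambda>v. (matrix_inv V *v v) $ i)" for i
    by (rule bounded_linear_matrix_vec_nth)
  have y_cont: "continuous_on {l..r} (y i)" for i
    unfolding y_def by (rule bounded_linear.continuous_on[OF lin assms(2)])
  have B: "(matrix_inv V *v (z *s ((V ** diag e ** matrix_inv V) *v v))) $ i = z * e i * (matrix_inv V *v v) $ i" for v i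
    by (simp add: matrix_mult_vec_smult matrix_vector_mul_assoc[symmetric]
        matrix_inv_vec_cancel[OF assms(3)] diag_mult_vec_nth)
  have g_cont: "continuous_on {l..r} (\<lambda>x. z *s ((V ** diag e ** matrix_inv V) *v f x))"
    by (rule bounded_linear.continuous_on[OF bounded_linear_smult_right
          bounded_linear.continuous_on[OF bounded_linear_matrix_vec assms(2)]])
  have "y i x = exp (z * e i * of_real (x - l)) * y i l" for i
  proof (rule weak_scalar_ode[OF assms(1) y_cont _ assms(5)])
    fix \<phi> assume \<phi>: "test_function l r \<phi>"
    let ?T = "\<lambda>v. (matrix_inv V *v v) $ i"
    have T_scale: "?T (c *\<^sub>R v) = c *\<^sub>R ?T v" for c v
      using linear_simps[OF lin] by blast
    have "integral {l..r} (\<lambda>x. deriv \<phi> x *\<^sub>R y i x) = integral {l..r} (?T \<circ> (\<lambda>x. deriv \<phi> x *\<^sub>R f x))"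
      by (simp add: o_def T_scale y_def)
    also have "\<dots> = ?T (integral {l..r} (\<lambda>x. deriv \<phi> x *\<^sub>R f x))"
      by (intro integral_linear integrable_continuous_real continuous_intros lin
          test_function_C1(2)[OF \<phi>] assms(2))
    also have "\<dots> = - ?T (integral {l..r} (\<lambda>x. \<phi> x *\<^sub>R (z *s ((V ** diag e ** matrix_inv V) *v f x))))"
      unfolding weak[OF \<phi>] using linear_simps[OF lin] by blast
    also have "\<dots> = - integral {l..r} (?T \<circ> (\<lambda>x. \<phi> x *\<^sub>R (z *s ((V ** diag e ** matrix_inv V) *v f x))))"
      by (subst integral_linear)
         (intro integrable_continuous_real continuous_intros lin test_function_C1(3)[OF \<phi>] g_cont refl)+
    also have "\<dots> = - integral {l..r} (\<lambda>x. \<phi> x *\<^sub>R (z * e i * y i x))"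
      by (simp add: o_def T_scale B y_def)
    finally show "integral {l..r} (\<lambda>x. deriv \<phi> x *\<^sub>R y i x) =
      - integral {l..r} (\<lambda>x. \<phi> x *\<^sub>R (z * e i * y i x))" .
  qed
  then have "matrix_inv V *v f x = diag (\<lambda>i. exp (z * (e i * of_real (x - l)))) *v (matrix_inv V *v f l)"
    by (simp add: vec_eq_iff diag_mult_vec_nth y_def mult.assoc)
  then have "V *v (matrix_inv V *v f x) = flow V e z (x - l) *v f l"
    by (simp add: flow_def matrix_vector_mul_assoc[symmetric])
  then show ?thesis by (simp add: matrix_inv_vec_cancel[OF assms(3)])
qed

section \<open>Eigenvalues as zeros of the characteristic function\<close>

lemma breakpoints_less:
  fixes p :: "nat \<Rightarrow> real"
  assumes "\<And>s. s \<in> {1..m} \<Longrightarrow> p (s - 1) < p s" "i < j" "j \<le> m"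
  shows "p i < p j"
  using assms(2,3)
proof (induction j)
  case (Suc j)
  have "p j < p (Suc j)" using assms(1)[of "Suc j"] Suc.prems by simp
  then show ?case using Suc by (cases "i = j") auto
qed simp

lemma breakpoints_le:
  fixes p :: "nat \<Rightarrow> real"
  assumes "\<And>s. s \<in> {1..m} \<Longrightarrow> p (s - 1) < p s" "i \<le> j" "j \<le> m"
  shows "p i \<le> p j"
  using breakpoints_less[of m p i j] assms by (cases "i = j") auto

lemma breakpoints_cover:
  fixes p :: "nat \<Rightarrow> real"
  assumes "p 0 < x" "x \<le> p m"
  obtains s where "s \<in> {1..m}" "p (s - 1) < x" "x \<le> p s"
proof -
  define s where "s = (LEAST s. x \<le> p s)"
  have s: "x \<le> p s" unfolding s_def using assms(2) by (rule LeastI)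
  have "s \<le> m" unfolding s_def using assms(2) by (rule Least_le)
  moreover have "s \<noteq> 0" using s assms(1) by (metis not_le)
  moreover have "p (s - 1) < x"
    using not_less_Least[of "s - 1" "\<lambda>s. x \<le> p s"] \<open>s \<noteq> 0\<close> unfolding s_def[symmetric] by simp
  ultimately show ?thesis using that[of s] s by auto
qed

lemma breakpoints_unique:
  fixes p :: "nat \<Rightarrow> real"
  assumes p: "\<And>s. s \<in> {1..m} \<Longrightarrow> p (s - 1) < p s"
    and "s \<in> {1..m}" "p (s - 1) < x" "x \<le> p s" "t \<in> {1..m}" "p (t - 1) < x" "x \<le> p t"
  shows "s = t"
proof (rule ccontr)
  assume "s \<noteq> t"
  then consider "s \<le> t - 1" | "t \<le> s - 1" by linarith
  then show False
  proof cases
    case 1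
    then have "p s \<le> p (t - 1)" using assms(5) by (intro breakpoints_le[of m p, OF p]) auto
    then show False using assms by linarith
  next
    case 2
    then have "p t \<le> p (s - 1)" using assms(2) by (intro breakpoints_le[of m p, OF p]) auto
    then show False using assms by linarith
  qed
qed

lemma L2_on_bounded:
  fixes g :: "real \<Rightarrow> complex ^ 'n"
  assumes "g \<in> borel_measurable borel" "\<And>x. x \<in> {\<alpha><..<\<beta>} \<Longrightarrow> norm (g x) \<le> C"
  shows "L2_on \<alpha> \<beta> g"
  unfolding L2_on_def
proof
  show "set_borel_measurable lborel {\<alpha><..<\<beta>} g"
    unfolding set_borel_measurable_def using assms(1) by measurable
  have "(\<lambda>x. (norm (g x))\<^sup>2) \<in> borel_measurable lborel"
    using assms(1) by measurable
  moreover have "emeasure lborel {\<alpha><..<\<beta>} < \<infinity>"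
    by (cases "\<alpha> \<le> \<beta>") auto
  moreover have "AE x in lborel. x \<in> {\<alpha><..<\<beta>} \<longrightarrow> norm ((norm (g x))\<^sup>2) \<le> C\<^sup>2"
    using assms(2) by (intro AE_I2 impI) (simp add: power_mono)
  ultimately show "set_integrable lborel {\<alpha><..<\<beta>} (\<lambda>x. (norm (g x))\<^sup>2)"
    unfolding set_integrable_def by (intro integrableI_bounded_set_indicator) auto
qed

text \<open>A test function supported in one piece vanishes on the others, so the weak equation on the whole
interval restricts to each piece, where the coefficient is constant.\<close>

lemma L_solution_eq_flow:
  fixes V :: "complex ^ 'n ^ 'n" and f g :: "real \<Rightarrow> complex ^ 'n"
  assumes "continuous_on {l..r} f" "set_borel_measurable lborel {\<alpha><..<\<beta>} g"
    and wd: "weak_deriv \<alpha> \<beta> f g" and "\<alpha> \<le> l" "l < r" "r \<le> \<beta>" "invertible V"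
    and ode: "AE x in lborel. l < x \<and> x < r \<longrightarrow> g x = z *s ((V ** diag e ** matrix_inv V) *v f x)"
    and "x \<in> {l..r}"
  shows "f x = flow V e z (x - l) *v f l"
proof (rule weak_system_eq_flow[OF \<open>l < r\<close> assms(1) \<open>invertible V\<close> _ \<open>x \<in> {l..r}\<close>])
  fix \<phi> assume \<phi>: "test_function l r \<phi>"
  let ?G = "\<lambda>x. z *s ((V ** diag e ** matrix_inv V) *v f x)"
  have G_cont: "continuous_on {l..r} ?G"
    by (rule bounded_linear.continuous_on[OF bounded_linear_smult_right
          bounded_linear.continuous_on[OF bounded_linear_matrix_vec assms(1)]])
  have \<phi>G_cont: "continuous_on {l..r} (\<lambda>x. \<phi> x *\<^sub>R ?G x)"
    by (intro continuous_intros test_function_C1(3)[OF \<phi>] G_cont)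
  have \<phi>f_cont: "continuous_on {l..r} (\<lambda>x. deriv \<phi> x *\<^sub>R f x)"
    by (intro continuous_intros test_function_C1(2)[OF \<phi>] assms(1))
  have zero: "\<phi> x = 0" "deriv \<phi> x = 0" if "x \<notin> {l<..<r}" for x
    using test_function_outside[OF \<phi> that] by auto
  have "(LINT x:{\<alpha><..<\<beta>}|lborel. deriv \<phi> x *\<^sub>R f x) = (LINT x:{l<..<r}|lborel. deriv \<phi> x *\<^sub>R f x)"
    unfolding set_lebesgue_integral_def
  proof (rule Bochner_Integration.integral_cong[OF refl])
    fix x
    show "indicator {\<alpha><..<\<beta>} x *\<^sub>R deriv \<phi> x *\<^sub>R f x = indicator {l<..<r} x *\<^sub>R deriv \<phi> x *\<^sub>R f x"
      using zero(2)[of x] assms(4,6) by (cases "x \<in> {l<..<r}") auto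
  qed
  also have "\<dots> = integral {l..r} (\<lambda>x. deriv \<phi> x *\<^sub>R f x)"
    by (rule LINT_open_interval(2)[OF \<phi>f_cont])
  finally have 1: "(LINT x:{\<alpha><..<\<beta>}|lborel. deriv \<phi> x *\<^sub>R f x) = integral {l..r} (\<lambda>x. deriv \<phi> x *\<^sub>R f x)" .
  have "(LINT x:{\<alpha><..<\<beta>}|lborel. \<phi> x *\<^sub>R g x) = (LINT x:{l<..<r}|lborel. \<phi> x *\<^sub>R ?G x)"
    unfolding set_lebesgue_integral_def
  proof (rule integral_cong_AE)
    have "(\<lambda>x. \<phi> x *\<^sub>R (indicator {\<alpha><..<\<beta>} x *\<^sub>R g x)) \<in> borel_measurable lborel"
    proof (rule borel_measurable_scaleR)
      show "\<phi> \<in> borel_measurable lborel"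
        using borel_measurable_continuous_onI[OF test_function_C1(3)[OF \<phi>]] by simp
      show "(\<lambda>x. indicator {\<alpha><..<\<beta>} x *\<^sub>R g x) \<in> borel_measurable lborel"
        using assms(2) unfolding set_borel_measurable_def .
    qed
    then show "(\<lambda>x. indicator {\<alpha><..<\<beta>} x *\<^sub>R \<phi> x *\<^sub>R g x) \<in> borel_measurable lborel"
      by (simp only: scaleR_left_commute)
    show "(\<lambda>x. indicator {l<..<r} x *\<^sub>R \<phi> x *\<^sub>R ?G x) \<in> borel_measurable lborel"
      using LINT_open_interval(1)[OF \<phi>G_cont] unfolding set_integrable_def by (rule borel_measurable_integrable)
    show "AE x in lborel. indicator {\<alpha><..<\<beta>} x *\<^sub>R \<phi> x *\<^sub>R g x = indicator {l<..<r} x *\<^sub>R \<phi> x *\<^sub>R ?G x"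
      using ode
    proof eventually_elim
      case (elim x)
      show ?case
        using zero(1)[of x] elim assms(4,6) by (cases "x \<in> {l<..<r}") auto
    qed
  qed
  also have "\<dots> = integral {l..r} (\<lambda>x. \<phi> x *\<^sub>R ?G x)"
    by (rule LINT_open_interval(2)[OF \<phi>G_cont])
  finally have 2: "(LINT x:{\<alpha><..<\<beta>}|lborel. \<phi> x *\<^sub>R g x) = integral {l..r} (\<lambda>x. \<phi> x *\<^sub>R ?G x)" .
  have "test_function \<alpha> \<beta> \<phi>" using \<phi> assms(4,6) by (rule test_function_mono)
  then show "integral {l..r} (\<lambda>x. deriv \<phi> x *\<^sub>R f x) = - integral {l..r} (\<lambda>x. \<phi> x *\<^sub>R ?G x)"
    using wd unfolding weak_deriv_def 1[symmetric] 2[symmetric] by blast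
qed

text \<open>An eigenfunction is continuous and follows the flow on each piece, hence it is the propagator
applied to its initial value \<open>c *s u\<close>. It is not zero, so \<open>c \<noteq> 0\<close>, and the boundary condition at the
right end says that the characteristic function vanishes.\<close>

lemma eigenvalue_imp_char_fun_zero:
  fixes V :: "nat \<Rightarrow> complex ^ 'n ^ 'n" and a :: "nat \<Rightarrow> 'n \<Rightarrow> complex"
  assumes p: "\<And>s. s \<in> {1..m} \<Longrightarrow> p (s - 1) < p s"
    and V: "\<And>s. s \<in> {1..m} \<Longrightarrow> invertible (V s)"
    and B: "\<And>s x. s \<in> {1..m} \<Longrightarrow> p (s - 1) < x \<Longrightarrow> x \<le> p s \<Longrightarrow>
      (V s ** diag (\<lambda>i. inverse (a s i)) ** matrix_inv (V s)) ** A x = mat 1"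
    and "z \<in> L_eigenvalues (p 0) (p m) A u v"
  shows "char_fun m p V a u v z = 0"
proof -
  obtain f where nz: "\<not> (AE x in lborel. p 0 < x \<and> x < p m \<longrightarrow> f x = 0)"
    and graph: "(f, \<lambda>x. z *s f x) \<in> L_graph (p 0) (p m) A u v"
    using assms(4) unfolding L_eigenvalues_def by blast
  obtain g c where f_cont: "continuous_on {p 0..p m} f" and fa: "f (p 0) = c *s u"
    and fb: "cinner (f (p m)) v = 0" and g: "L2_on (p 0) (p m) g" "weak_deriv (p 0) (p m) f g"
    and ode: "AE x in lborel. p 0 < x \<and> x < p m \<longrightarrow> z *s f x = A x *v g x"
    using graph unfolding L_graph_def L_domain_def W12_def by auto
  let ?e = "\<lambda>s i. inverse (a s i)"
  have step: "f x = flow (V s) (?e s) z (x - p (s - 1)) *v f (p (s - 1))"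
    if s: "s \<in> {1..m}" and x: "x \<in> {p (s - 1)..p s}" for s x
  proof (rule L_solution_eq_flow[OF _ _ g(2) _ p[OF s] _ V[OF s] _ x])
    show le: "p 0 \<le> p (s - 1)" "p s \<le> p m"
      using s by (auto intro!: breakpoints_le[of m p, OF p])
    then show "continuous_on {p (s - 1)..p s} f"
      by (intro continuous_on_subset[OF f_cont]) auto
    show "set_borel_measurable lborel {p 0<..<p m} g"
      using g(1) by (simp add: L2_on_def)
    show "AE x in lborel. p (s - 1) < x \<and> x < p s \<longrightarrow>
        g x = z *s ((V s ** diag (?e s) ** matrix_inv (V s)) *v f x)"
      using ode
    proof eventually_elim
      case (elim x)
      show ?case
      proof
        assume x: "p (s - 1) < x \<and> x < p s"
        then have "A x *v g x = z *s f x" using elim le by auto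
        then have "((V s ** diag (?e s) ** matrix_inv (V s)) ** A x) *v g x =
            z *s ((V s ** diag (?e s) ** matrix_inv (V s)) *v f x)"
          by (simp only: matrix_vector_mul_assoc[symmetric] matrix_mult_vec_smult)
        then show "g x = z *s ((V s ** diag (?e s) ** matrix_inv (V s)) *v f x)"
          using B[OF s, of x] x by simp
      qed
    qed
  qed
  have at_p: "f (p k) = propagator p V a z k *v (c *s u)" if "k \<le> m" for k
    using that
  proof (induction k)
    case 0
    then show ?case using fa by simp
  next
    case (Suc k)
    then have "f (p (Suc k)) = flow (V (Suc k)) (?e (Suc k)) z (p (Suc k) - p k) *v f (p k)"
      using step[of "Suc k" "p (Suc k)"] p[of "Suc k"] by simp
    then show ?case
      using Suc by (simp only: propagator_Suc_flow matrix_vector_mul_assoc[symmetric] Suc_leD)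
  qed
  have "c \<noteq> 0"
  proof
    assume "c = 0"
    then have at_p0: "f (p k) = 0" if "k \<le> m" for k using at_p[OF that] by simp
    have "f x = 0" if "p 0 < x \<and> x < p m" for x
    proof -
      obtain s where "s \<in> {1..m}" "p (s - 1) < x" "x \<le> p s"
        using breakpoints_cover[of p x m] \<open>p 0 < x \<and> x < p m\<close> by auto
      then show ?thesis using step[of s x] at_p0[of "s - 1"] by auto
    qed
    then show False using nz by simp
  qed
  have "cinner (c *s w) v = c * cinner w v" for w :: "complex ^ 'n"
    by (simp add: cinner_def sum_distrib_left mult.assoc)
  then have "c * char_fun m p V a u v z = 0"
    using fb at_p[of m] by (simp add: char_fun_def matrix_mult_vec_smult)
  then show ?thesis using \<open>c \<noteq> 0\<close> by simp
qed

text \<open>Cutting off the breakpoints at \<open>x\<close> gives all pieces to the right of \<open>x\<close> length zero and shortens the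
piece that contains \<open>x\<close>. The propagator for these breakpoints is therefore the propagator from the
left end to \<open>x\<close>, given by one formula that is continuous in \<open>x\<close>.\<close>

definition solution :: "nat \<Rightarrow> (nat \<Rightarrow> real) \<Rightarrow> (nat \<Rightarrow> complex ^ 'n ^ 'n) \<Rightarrow> (nat \<Rightarrow> 'n \<Rightarrow> complex) \<Rightarrow>
    complex \<Rightarrow> complex ^ 'n \<Rightarrow> real \<Rightarrow> complex ^ 'n" where
  "solution m p V a z u x = propagator (\<lambda>s. min x (p s)) V a z m *v u"

lemma solution_continuous:
  fixes V :: "nat \<Rightarrow> complex ^ 'n ^ 'n"
  shows "continuous_on S (solution m p V a z u)"
proof -
  have comp: "continuous_on S (\<lambda>x. (propagator (\<lambda>s. min x (p s)) V a z k *v u) $ i)" for k i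
  proof (induction k arbitrary: i)
    case (Suc k)
    let ?w = "\<lambda>x j. inverse (a (Suc k) j) * of_real (min x (p (Suc k)) - min x (p k))"
    have eq: "(propagator (\<lambda>s. min x (p s)) V a z (Suc k) *v u) $ i =
      (\<Sum>j\<in>UNIV. V (Suc k) $ i $ j * (exp (z * ?w x j) *
        (\<Sum>l\<in>UNIV. matrix_inv (V (Suc k)) $ j $ l * (propagator (\<lambda>s. min x (p s)) V a z k *v u) $ l)))" for x
    proof -
      have "(propagator (\<lambda>s. min x (p s)) V a z (Suc k) *v u) $ i =
        (V (Suc k) *v (diag (\<lambda>j. exp (z * ?w x j)) *v
          (matrix_inv (V (Suc k)) *v (propagator (\<lambda>s. min x (p s)) V a z k *v u)))) $ i"
        by (simp only: propagator.simps matrix_vector_mul_assoc[symmetric])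
      also have "\<dots> = (\<Sum>j\<in>UNIV. V (Suc k) $ i $ j * (exp (z * ?w x j) *
          (matrix_inv (V (Suc k)) *v (propagator (\<lambda>s. min x (p s)) V a z k *v u)) $ j))"
        by (subst matrix_vector_mult_def) (simp add: diag_mult_vec_nth)
      finally show ?thesis
        by (subst (asm) matrix_vector_mult_def[of "matrix_inv (V (Suc k))"]) simp
    qed
    show ?case unfolding eq by (intro continuous_intros Suc.IH)
  qed simp
  have "continuous_on S (\<lambda>x. \<chi> i. (propagator (\<lambda>s. min x (p s)) V a z m *v u) $ i)"
    by (intro continuous_on_vec_lambda comp)
  then show ?thesis by (simp add: solution_def[abs_def])
qed

lemma solution_eq_flow:
  fixes V :: "nat \<Rightarrow> complex ^ 'n ^ 'n"
  assumes p: "\<And>s. s \<in> {1..m} \<Longrightarrow> p (s - 1) < p s"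
    and V: "\<And>s. s \<in> {1..m} \<Longrightarrow> invertible (V s)"
    and s: "s \<in> {1..m}" and x: "p (s - 1) \<le> x" "x \<le> p s"
  shows "solution m p V a z u x =
    flow (V s) (\<lambda>i. inverse (a s i)) z (x - p (s - 1)) *v (propagator p V a z (s - 1) *v u)"
proof -
  let ?P = "propagator (\<lambda>s. min x (p s)) V a z"
  have before: "?P k = propagator p V a z k" if "k \<le> s - 1" for k
    using that
  proof (induction k)
    case (Suc k)
    have "p (Suc k) \<le> x" "p k \<le> x"
    proof -
      have "s - 1 \<le> m" using s by auto
      then have "p (Suc k) \<le> p (s - 1)" "p k \<le> p (s - 1)"
        using Suc.prems by (auto intro!: breakpoints_le[of m p, OF p])
      then show "p (Suc k) \<le> x" "p k \<le> x" using x by linarith+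
    qed
    then have "min x (p (Suc k)) = p (Suc k)" "min x (p k) = p k" by auto
    then show ?case using Suc by simp
  qed simp
  obtain s' where s': "s = Suc s'" using s by (cases s) auto
  have "min x (p s) - min x (p s') = x - p (s - 1)" using x by (simp add: s')
  then have at_s: "?P s = flow (V s) (\<lambda>i. inverse (a s i)) z (x - p (s - 1)) ** propagator p V a z (s - 1)"
    using before[of s'] unfolding s' propagator_Suc_flow by simp
  have after: "?P k = ?P s" if "s \<le> k" "k \<le> m" for k
    using that
  proof (induction k rule: dec_induct)
    case (step k)
    have "x \<le> p k" "x \<le> p (Suc k)"
      using breakpoints_le[of m p s k, OF p] breakpoints_le[of m p s "Suc k", OF p] step x by auto
    then have "min x (p (Suc k)) - min x (p k) = 0" by simp
    then show ?case
      using step V[of "Suc k"] unfolding propagator_Suc_flow by (simp add: flow_0)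
  qed simp
  have "?P m = ?P s" using s by (intro after) auto
  then show ?thesis
    by (simp add: solution_def at_s matrix_vector_mul_assoc)
qed

lemma solution_left:
  fixes V :: "nat \<Rightarrow> complex ^ 'n ^ 'n"
  assumes p: "\<And>s. s \<in> {1..m} \<Longrightarrow> p (s - 1) < p s"
    and V: "\<And>s. s \<in> {1..m} \<Longrightarrow> invertible (V s)" and "1 \<le> m"
  shows "solution m p V a z u (p 0) = u"
  using solution_eq_flow[of m p V 1 "p 0" a z u] assms p[of 1] by (auto simp: flow_0)

lemma solution_right:
  assumes p: "\<And>s. s \<in> {1..m} \<Longrightarrow> p (s - 1) < p s"
  shows "solution m p V a z u (p m) = propagator p V a z m *v u"
proof -
  have "propagator (\<lambda>s. min (p m) (p s)) V a z k = propagator p V a z k" if "k \<le> m" for k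
    using that
  proof (induction k)
    case (Suc k)
    have "min (p m) (p (Suc k)) = p (Suc k)" "min (p m) (p k) = p k"
      using breakpoints_le[of m p "Suc k" m, OF p] breakpoints_le[of m p k m, OF p] Suc.prems by auto
    then show ?case using Suc by simp
  qed simp
  then show ?thesis by (simp add: solution_def)
qed

text \<open>The solution with initial value \<open>u\<close> satisfies both boundary conditions. It is continuous, and away
from the finitely many breakpoints it is differentiable with the piecewise continuous derivative
\<open>g\<close>; integration by parts across the breakpoints then shows that \<open>g\<close> is also its weak derivative.\<close>

lemma char_fun_zero_imp_eigenvalue:
  fixes V :: "nat \<Rightarrow> complex ^ 'n ^ 'n" and a :: "nat \<Rightarrow> 'n \<Rightarrow> complex"
  assumes "1 \<le> m" and p: "\<And>s. s \<in> {1..m} \<Longrightarrow> p (s - 1) < p s"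
    and V: "\<And>s. s \<in> {1..m} \<Longrightarrow> invertible (V s)"
    and B: "\<And>s x. s \<in> {1..m} \<Longrightarrow> p (s - 1) < x \<Longrightarrow> x \<le> p s \<Longrightarrow>
      A x ** (V s ** diag (\<lambda>i. inverse (a s i)) ** matrix_inv (V s)) = mat 1"
    and "u \<noteq> 0" and zero: "char_fun m p V a u v z = 0"
  shows "z \<in> L_eigenvalues (p 0) (p m) A u v"
proof -
  define f where "f = solution m p V a z u"
  define M where "M = (\<lambda>s. V s ** diag (\<lambda>i. inverse (a s i)) ** matrix_inv (V s))"
  define I where "I = (\<lambda>s. {p (s - 1)<..p s})"
  \<comment> \<open>The derivative is written with indicators of the pieces instead of the coefficient \<open>A\<close>, of
    which only the values on \<open>(p 0, p m]\<close> are known; this form is visibly measurable.\<close>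
  define g where "g = (\<lambda>x. \<Sum>s = 1..m. indicator (I s) x *\<^sub>R (z *s (M s *v f x)))"
  have less: "p 0 < p m" using \<open>1 \<le> m\<close> by (intro breakpoints_less[of m p, OF p]) auto
  have f_cont: "continuous_on S f" for S unfolding f_def by (rule solution_continuous)
  have Mf_cont: "continuous_on S (\<lambda>x. z *s (M s *v f x))" for S s
    by (rule bounded_linear.continuous_on[OF bounded_linear_smult_right
          bounded_linear.continuous_on[OF bounded_linear_matrix_vec f_cont]])
  have g_eq: "g x = z *s (M s *v f x)" if s: "s \<in> {1..m}" and x: "p (s - 1) < x" "x \<le> p s" for s x
  proof -
    have "indicator (I t) x *\<^sub>R (z *s (M t *v f x)) = (if t = s then z *s (M s *v f x) else 0)"
      if "t \<in> {1..m}" for t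
    proof (cases "t = s")
      case True
      then show ?thesis using x by (simp add: I_def)
    next
      case False
      then have "\<not> (p (t - 1) < x \<and> x \<le> p t)"
        using breakpoints_unique[of m p s x t, OF p s x that] by blast
      then have "x \<notin> I t" by (simp add: I_def)
      then show ?thesis using False by simp
    qed
    then have "g x = (\<Sum>t = 1..m. if t = s then z *s (M s *v f x) else 0)"
      unfolding g_def by (rule sum.cong[OF refl])
    then show ?thesis using s by simp
  qed
  have f_meas: "f \<in> borel_measurable borel"
    by (rule borel_measurable_continuous_onI[OF f_cont])
  have g_meas: "g \<in> borel_measurable borel"
    unfolding g_def I_def
    by (intro borel_measurable_sum borel_measurable_scaleR borel_measurable_indicator
        borel_measurable_continuous_onI Mf_cont) auto
  have bounded: "\<exists>C. \<forall>x\<in>{p 0<..<p m}. norm (h x) \<le> C"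
    if "continuous_on {p 0..p m} h" for h :: "real \<Rightarrow> complex ^ 'n"
  proof -
    have "bounded (h ` {p 0..p m})"
      using that by (intro compact_imp_bounded compact_continuous_image) auto
    then show ?thesis unfolding bounded_iff by fastforce
  qed
  obtain Cf where Cf: "\<And>x. x \<in> {p 0<..<p m} \<Longrightarrow> norm (f x) \<le> Cf"
    using bounded[OF f_cont] by blast
  obtain Czf where Czf: "\<And>x. x \<in> {p 0<..<p m} \<Longrightarrow> norm (z *s f x) \<le> Czf"
    using bounded[OF bounded_linear.continuous_on[OF bounded_linear_smult_right f_cont]] by blast
  obtain C where C: "\<And>s x. x \<in> {p 0<..<p m} \<Longrightarrow> norm (z *s (M s *v f x)) \<le> C s"
    using bounded[OF Mf_cont] by metis
  have g_bound: "norm (g x) \<le> (\<Sum>s = 1..m. C s)" if x: "x \<in> {p 0<..<p m}" for x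
    unfolding g_def
  proof (rule order_trans[OF norm_sum], rule sum_mono)
    fix s
    have "0 \<le> C s" using C[OF x, of s] norm_ge_zero order_trans by blast
    then show "norm (indicator (I s) x *\<^sub>R (z *s (M s *v f x))) \<le> C s"
      using C[OF x, of s] by (simp add: indicator_def)
  qed
  have L2_f: "L2_on (p 0) (p m) f" using f_meas Cf by (rule L2_on_bounded)
  have L2_g: "L2_on (p 0) (p m) g" using g_meas g_bound by (rule L2_on_bounded)
  have "(\<lambda>x. z *s f x) \<in> borel_measurable borel"
    by (rule borel_measurable_continuous_onI
        [OF bounded_linear.continuous_on[OF bounded_linear_smult_right f_cont]])
  then have L2_zf: "L2_on (p 0) (p m) (\<lambda>x. z *s f x)" using Czf by (rule L2_on_bounded)
  have f_deriv: "(f has_vector_derivative g x) (at x)"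
    if x: "x \<in> {p 0<..<p m} - p ` {0..m}" for x
  proof -
    obtain s where s: "s \<in> {1..m}" "p (s - 1) < x" "x \<le> p s"
      using breakpoints_cover[of p x m] x by auto
    have "x \<noteq> p s" using x s(1) by auto
    let ?y = "propagator p V a z (s - 1) *v u"
    have flow: "f t = flow (V s) (\<lambda>i. inverse (a s i)) z (t - p (s - 1)) *v ?y"
      if "t \<in> {p (s - 1)<..<p s}" for t
      unfolding f_def using that s(1) by (intro solution_eq_flow[of m p V, OF p V]) auto
    have "(f has_vector_derivative z *s (M s *v f x)) (at x)"
    proof (rule has_vector_derivative_transform_within_open)
      show "((\<lambda>t. flow (V s) (\<lambda>i. inverse (a s i)) z (t - p (s - 1)) *v ?y) has_vector_derivative
          z *s (M s *v f x)) (at x)"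
        using flow_has_vector_derivative[OF V[OF s(1)], of _ z "p (s - 1)" ?y x] flow[of x] s \<open>x \<noteq> p s\<close>
        by (simp add: M_def)
      show "open {p (s - 1)<..<p s}" by simp
      show "x \<in> {p (s - 1)<..<p s}" using s \<open>x \<noteq> p s\<close> by simp
    qed (use flow in simp)
    then show ?thesis using g_eq[OF s] by simp
  qed
  have wd: "weak_deriv (p 0) (p m) f g"
    unfolding weak_deriv_def
  proof (intro allI impI)
    fix \<phi> assume \<phi>: "test_function (p 0) (p m) \<phi>"
    have \<phi>f_cont: "continuous_on {p 0..p m} (\<lambda>x. deriv \<phi> x *\<^sub>R f x)"
      by (intro continuous_intros test_function_C1(2)[OF \<phi>] f_cont)
    have "((\<lambda>x. deriv \<phi> x *\<^sub>R f x + \<phi> x *\<^sub>R g x) has_integral (\<phi> (p m) *\<^sub>R f (p m) - \<phi> (p 0) *\<^sub>R f (p 0))) {p 0..p m}"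
    proof (rule fundamental_theorem_of_calculus_interior_strong[of "p ` {0..m}"])
      show "continuous_on {p 0..p m} (\<lambda>x. \<phi> x *\<^sub>R f x)"
        by (intro continuous_intros test_function_C1(3)[OF \<phi>] f_cont)
      show "((\<lambda>x. \<phi> x *\<^sub>R f x) has_vector_derivative deriv \<phi> x *\<^sub>R f x + \<phi> x *\<^sub>R g x) (at x)"
        if "x \<in> {p 0<..<p m} - p ` {0..m}" for x
        using has_vector_derivative_scaleR[OF test_function_C1(1)[OF \<phi>] f_deriv[OF that]]
        by (simp add: add.commute)
    qed (use less in auto)
    then have sum0: "((\<lambda>x. deriv \<phi> x *\<^sub>R f x + \<phi> x *\<^sub>R g x) has_integral 0) {p 0..p m}"
      using test_function_outside(1)[OF \<phi>, of "p 0"] test_function_outside(1)[OF \<phi>, of "p m"] by simp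
    have "((\<lambda>x. deriv \<phi> x *\<^sub>R f x) has_integral integral {p 0..p m} (\<lambda>x. deriv \<phi> x *\<^sub>R f x)) {p 0..p m}"
      by (intro integrable_integral integrable_continuous_real \<phi>f_cont)
    from has_integral_diff[OF sum0 this]
    have "integral {p 0..p m} (\<lambda>x. \<phi> x *\<^sub>R g x) = - integral {p 0..p m} (\<lambda>x. deriv \<phi> x *\<^sub>R f x)"
      by (simp add: integral_unique)
    moreover have "(LINT x:{p 0<..<p m}|lborel. \<phi> x *\<^sub>R g x) = integral {p 0..p m} (\<lambda>x. \<phi> x *\<^sub>R g x)"
    proof -
      have "bounded (\<phi> ` {p 0..p m})"
        by (intro compact_imp_bounded compact_continuous_image test_function_C1(3)[OF \<phi>]) auto
      then obtain K where K: "\<And>x. x \<in> {p 0..p m} \<Longrightarrow> norm (\<phi> x) \<le> K"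
        unfolding bounded_iff by blast
      have "norm (\<phi> x *\<^sub>R g x) \<le> K * (\<Sum>s = 1..m. C s)" if "x \<in> {p 0<..<p m}" for x
      proof -
        have "norm (\<phi> x) \<le> K" using K[of x] that by simp
        moreover from this have "0 \<le> K" by (rule order_trans[OF norm_ge_zero])
        ultimately show ?thesis
          using g_bound[OF that] unfolding norm_scaleR real_norm_def by (intro mult_mono) auto
      qed
      then have "set_integrable lborel {p 0<..<p m} (\<lambda>x. \<phi> x *\<^sub>R g x)"
        unfolding set_integrable_def using g_meas less
          borel_measurable_continuous_onI[OF test_function_C1(3)[OF \<phi>]]
        by (intro integrableI_bounded_set_indicator[where B = "K * (\<Sum>s = 1..m. C s)"]
            borel_measurable_scaleR) auto
      then show ?thesis
        by (simp add: set_borel_integral_eq_integral integral_open_interval_real)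
    qed
    ultimately show "(LINT x:{p 0<..<p m}|lborel. deriv \<phi> x *\<^sub>R f x) =
        - (LINT x:{p 0<..<p m}|lborel. \<phi> x *\<^sub>R g x)"
      by (simp add: LINT_open_interval(2)[OF \<phi>f_cont])
  qed
  have f_left: "f (p 0) = u"
    unfolding f_def using solution_left[of m p V, OF p V \<open>1 \<le> m\<close>] .
  have f_right: "cinner (f (p m)) v = 0"
    using zero solution_right[of m p V a z u, OF p] by (simp add: f_def char_fun_def)
  have "f \<in> L_domain (p 0) (p m) u v"
    unfolding L_domain_def W12_def
    using f_cont L2_f L2_g wd f_right f_left by (auto intro!: exI[of _ "1::complex"])
  moreover have "z *s f x = A x *v g x" if x: "p 0 < x \<and> x < p m" for x
  proof -
    obtain s where s: "s \<in> {1..m}" "p (s - 1) < x" "x \<le> p s"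
      using breakpoints_cover[of p x m] x by auto
    have "A x *v g x = z *s ((A x ** M s) *v f x)"
      unfolding g_eq[OF s] by (simp add: matrix_mult_vec_smult matrix_vector_mul_assoc)
    then show ?thesis using B[OF s] by (simp add: M_def)
  qed
  ultimately have "(f, \<lambda>x. z *s f x) \<in> L_graph (p 0) (p m) A u v"
    unfolding L_graph_def using L2_zf L2_g wd by auto
  moreover have "\<not> (AE x in lborel. p 0 < x \<and> x < p m \<longrightarrow> f x = 0)"
  proof
    assume ae: "AE x in lborel. p 0 < x \<and> x < p m \<longrightarrow> f x = 0"
    have "isCont f (p 0)" using f_cont[of UNIV] by (simp add: continuous_on_eq_continuous_at)
    then have "\<forall>\<^sub>F x in at (p 0). f x \<noteq> 0"
      using f_left \<open>u \<noteq> 0\<close> by (intro tendsto_imp_eventually_ne[of f u]) (auto simp: isCont_def)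
    then obtain \<epsilon> where \<epsilon>: "\<epsilon> > 0" "\<And>x. x \<noteq> p 0 \<Longrightarrow> dist x (p 0) < \<epsilon> \<Longrightarrow> f x \<noteq> 0"
      unfolding eventually_at by blast
    define J where "J = {p 0<..<min (p m) (p 0 + \<epsilon>)}"
    have "AE x in lborel. x \<notin> J"
      using ae by eventually_elim (use \<epsilon>(2) in \<open>force simp: J_def dist_real_def\<close>)
    moreover have "(AE x in lborel. x \<notin> J) \<longleftrightarrow> emeasure lborel J = 0"
    proof (rule AE_iff_measurable)
      show "J \<in> sets lborel" by (simp add: J_def)
    qed simp
    ultimately have "emeasure lborel J = 0" by blast
    then show False using less \<epsilon>(1) by (simp add: J_def min_def split: if_splits)
  qed
  ultimately show ?thesis unfolding L_eigenvalues_def by blast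
qed

section \<open>The counting law\<close>

text \<open>If a face of the hull contains at least two points of the set, it is an edge, and then all points
of the set on it are vertices. Three of them are impossible: on a line one of three points lies
between the other two and is not extreme.\<close>

lemma support_face_generic:
  assumes "finite \<Gamma>" "norm \<omega> = 1"
    and simple: "\<And>\<gamma> e. \<gamma> \<in> \<Gamma> \<Longrightarrow> e edge_of convex hull \<Gamma> \<Longrightarrow> \<gamma> \<in> e \<Longrightarrow> \<gamma> extreme_point_of convex hull \<Gamma>"
  shows "\<gamma> \<in> support_face \<Gamma> \<omega> \<Longrightarrow> \<gamma> extreme_point_of convex hull \<Gamma>"
    and "card (support_face \<Gamma> \<omega>) \<le> 2"
proof -
  let ?K = "convex hull \<Gamma>" and ?F = "support_face (convex hull \<Gamma>) \<omega>"
  have fin: "finite (support_face \<Gamma> \<omega>)"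
    using assms(1) by (rule finite_subset[OF support_face_subset])
  have ext: "\<gamma> extreme_point_of ?K" if \<gamma>: "\<gamma> \<in> support_face \<Gamma> \<omega>" for \<gamma>
  proof -
    have "\<gamma> \<in> \<Gamma>" "\<Gamma> \<noteq> {}" using \<gamma> by (auto simp: support_face_def)
    have F: "?F = convex hull (support_face \<Gamma> \<omega>)" "?F face_of ?K"
      using support_face_convex_hull[OF assms(1) \<open>\<Gamma> \<noteq> {}\<close>] by blast+
    show ?thesis
    proof (cases "\<omega> \<in> edge_normals \<Gamma>")
      case True
      have "\<gamma> \<in> ?F" using \<gamma> F(1) by (simp add: hull_inc)
      then show ?thesis
        using simple[OF \<open>\<gamma> \<in> \<Gamma>\<close> edge_normal_imp_edge[OF assms(1) True]] by blast
    next
      case False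
      then have "support_face \<Gamma> \<omega> = {\<gamma>}"
        using \<gamma> assms(2) unfolding edge_normals_def by blast
      then show ?thesis using F by (simp add: face_of_singleton)
    qed
  qed
  then show "\<gamma> \<in> support_face \<Gamma> \<omega> \<Longrightarrow> \<gamma> extreme_point_of ?K" .
  show "card (support_face \<Gamma> \<omega>) \<le> 2"
  proof (rule ccontr)
    assume "\<not> card (support_face \<Gamma> \<omega>) \<le> 2"
    then obtain T where T: "T \<subseteq> support_face \<Gamma> \<omega>" "card T = 3"
      using obtain_subset_with_card_n[of 3 "support_face \<Gamma> \<omega>"] by auto
    then obtain x y w where xyw: "T = {x, y, w}" "x \<noteq> y" "y \<noteq> w" "x \<noteq> w"
      by (auto simp: card_3_iff)
    then have mem: "x \<in> support_face \<Gamma> \<omega>" "y \<in> support_face \<Gamma> \<omega>" "w \<in> support_face \<Gamma> \<omega>"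
      using T(1) by auto
    then have "\<omega> \<in> edge_normals \<Gamma>"
      using assms(2) xyw(2) unfolding edge_normals_def by blast
    then have "aff_dim ?F = 1"
      using edge_normal_imp_edge[OF assms(1)] by (simp add: edge_of_def)
    then have "collinear ?F" by (simp add: collinear_aff_dim)
    moreover have "\<Gamma> \<noteq> {}" using mem by (auto simp: support_face_def)
    have "support_face \<Gamma> \<omega> \<subseteq> ?F"
      unfolding support_face_convex_hull(1)[OF assms(1) \<open>\<Gamma> \<noteq> {}\<close>] by (rule hull_subset)
    then have "{x, y, w} \<subseteq> ?F" using mem by blast
    ultimately have "collinear {x, y, w}" by (rule collinear_subset)
    moreover have no_between: "\<not> between (s, t) r"
      if "r \<in> support_face \<Gamma> \<omega>" "s \<in> support_face \<Gamma> \<omega>" "t \<in> support_face \<Gamma> \<omega>" "r \<noteq> s" "r \<noteq> t" for r s t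
    proof
      assume "between (s, t) r"
      then have "r \<in> open_segment s t"
        using that(4,5) by (simp add: between_mem_segment open_segment_def)
      moreover have "s \<in> ?K" "t \<in> ?K"
        using that(2,3) by (simp_all add: support_face_def hull_inc)
      ultimately show False using ext[OF that(1)] by (simp add: extreme_point_of_def)
    qed
    ultimately show False
      using no_between mem xyw(2-4) unfolding collinear_between_cases by metis
  qed
qed

text \<open>The value of \<open>b\<close> at the left end point is arbitrary; it enters through the indicator of a point, which
has measure zero.\<close>

lemma LINT_step_function:
  fixes p :: "nat \<Rightarrow> real" and b :: "real \<Rightarrow> real"
  assumes p: "\<And>s. s \<in> {1..m} \<Longrightarrow> p (s - 1) < p s"
    and b: "\<And>s x. s \<in> {1..m} \<Longrightarrow> p (s - 1) < x \<Longrightarrow> x \<le> p s \<Longrightarrow> b x = c s"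
  shows "(LINT x:{p 0..p m}|lborel. b x) = (\<Sum>s = 1..m. (p s - p (s - 1)) * c s)"
proof -
  have eq: "indicator {p 0..p m} x *\<^sub>R b x =
      indicator {p 0} x * b (p 0) + (\<Sum>s = 1..m. indicator {p (s - 1)<..p s} x * c s)" for x
  proof (cases "p 0 < x \<and> x \<le> p m")
    case True
    then obtain s where s: "s \<in> {1..m}" "p (s - 1) < x" "x \<le> p s"
      using breakpoints_cover[of p x m] by auto
    have "indicator {p (t - 1)<..p t} x * c t = (if t = s then c s else 0)" if "t \<in> {1..m}" for t
    proof (cases "t = s")
      case False
      then have "x \<notin> {p (t - 1)<..p t}"
        using breakpoints_unique[of m p s x t, OF p s that] by auto
      then show ?thesis using False by simp
    qed (use s in simp)
    then have "(\<Sum>t = 1..m. indicator {p (t - 1)<..p t} x * c t) = (\<Sum>t = 1..m. if t = s then c s else 0)"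
      by (rule sum.cong[OF refl])
    then show ?thesis using True s b[OF s] by simp
  next
    case False
    have "indicator {p (t - 1)<..p t} x * c t = 0" if "t \<in> {1..m}" for t
    proof -
      have "p 0 \<le> p (t - 1)" "p t \<le> p m"
        using that by (auto intro!: breakpoints_le[of m p, OF p])
      then have "x \<notin> {p (t - 1)<..p t}" using False by auto
      then show ?thesis by simp
    qed
    then have "(\<Sum>t = 1..m. indicator {p (t - 1)<..p t} x * c t) = 0"
      by (intro sum.neutral) blast
    moreover have "p 0 \<le> p m" by (rule breakpoints_le[of m p, OF p]) auto
    ultimately show ?thesis using False by (auto simp: indicator_def)
  qed
  have int0: "integrable lborel (\<lambda>x. indicator {p 0} x * b (p 0))"
    by (intro integrable_mult_left integrable_real_indicator) auto
  have int: "integrable lborel (\<lambda>x. indicator {p (s - 1)<..p s} x * c s)" for s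
    by (cases "p (s - 1) \<le> p s") (auto intro!: integrable_mult_left integrable_real_indicator)
  have "(LINT x:{p 0..p m}|lborel. b x) =
      (LINT x|lborel. indicator {p 0} x * b (p 0)) +
      (\<Sum>s = 1..m. LINT x|lborel. indicator {p (s - 1)<..p s} x * c s)"
    unfolding set_lebesgue_integral_def eq
      Bochner_Integration.integral_add[OF int0 Bochner_Integration.integrable_sum[OF int]]
      Bochner_Integration.integral_sum[OF int] ..
  also have "(LINT x|lborel. indicator {p 0} x * b (p 0)) = 0" by simp
  also have "(\<Sum>s = 1..m. LINT x|lborel. indicator {p (s - 1)<..p s} x * c s) =
      (\<Sum>s = 1..m. (p s - p (s - 1)) * c s)"
  proof (rule sum.cong[OF refl])
    fix s assume "s \<in> {1..m}"
    then show "(LINT x|lborel. indicator {p (s - 1)<..p s} x * c s) = (p s - p (s - 1)) * c s"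
      using p[of s] by simp
  qed
  finally show ?thesis by simp
qed

theorem theorem11:
  fixes m :: nat and p :: "nat \<Rightarrow> real" and \<alpha> \<beta> :: real
    and As V :: "nat \<Rightarrow> complex ^ 'n ^ 'n" and a :: "nat \<Rightarrow> 'n::finite \<Rightarrow> complex"
    and A :: "real \<Rightarrow> complex ^ 'n ^ 'n" and b :: "real \<Rightarrow> real"
    and N :: "real \<Rightarrow> nat" and u v :: "complex ^ 'n"
  assumes "1 \<le> m" and "p 0 = \<alpha>" and "p m = \<beta>"
    and "\<And>s. s \<in> {1..m} \<Longrightarrow> p (s - 1) < p s"
    and "\<And>s. s \<in> {1..m} \<Longrightarrow> invertible (As s)"
    and "\<And>s. s \<in> {1..m} \<Longrightarrow> invertible (V s)"
    and "\<And>s. s \<in> {1..m} \<Longrightarrow> As s = V s ** diag (a s) ** matrix_inv (V s)"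
    and "\<And>s x. s \<in> {1..m} \<Longrightarrow> p (s - 1) < x \<Longrightarrow> x \<le> p s \<Longrightarrow> A x = As s"
    and "u \<noteq> 0" and "v \<noteq> 0"
    and "generic m p V a u v"
  defines "b \<equiv> \<lambda>x. boundary_length (convex hull (matrix_eigenvalues (matrix_inv (A x))))"
    and "N \<equiv> \<lambda>E. card {z \<in> L_eigenvalues \<alpha> \<beta> A u v. cmod z \<le> E}"
  shows "(\<forall>E. finite {z \<in> L_eigenvalues \<alpha> \<beta> A u v. cmod z \<le> E}) \<and>
    (\<lambda>E. real (N E) - E / (2 * pi) * (LINT x:{\<alpha>..\<beta>}|lborel. b x)) \<in> O[at_top](\<lambda>_. 1)"
proof -
  note p = assms(4) and V = assms(6)
  define \<Gamma> where "\<Gamma> = Gamma_set m p a"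
  define d where "d = exp_coeffs m p V a u v"
  let ?B = "\<lambda>s. V s ** diag (\<lambda>i. inverse (a s i)) ** matrix_inv (V s)"
  have AB: "As s ** ?B s = mat 1" "?B s ** As s = mat 1" if "s \<in> {1..m}" for s
    using diag_conj_inverse[OF V[OF that], of "a s"] assms(5)[OF that] assms(7)[OF that] by simp_all
  have char_eq: "char_fun m p V a u v = exp_sum \<Gamma> d"
    using theI'[OF exp_coeffs_ex1[of m p a V u v]]
    unfolding d_def exp_coeffs_def \<Gamma>_def exp_sum_def by blast
  have "L_eigenvalues \<alpha> \<beta> A u v = {z. char_fun m p V a u v z = 0}"
  proof (intro equalityI subsetI CollectI)
    fix z assume "z \<in> L_eigenvalues \<alpha> \<beta> A u v"
    then show "char_fun m p V a u v z = 0"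
      using eigenvalue_imp_char_fun_zero[of m p V a A z u v, OF p V] AB assms(2,3,8) by simp
  next
    fix z assume "z \<in> {z. char_fun m p V a u v z = 0}"
    then show "z \<in> L_eigenvalues \<alpha> \<beta> A u v"
      using char_fun_zero_imp_eigenvalue[of m p V A a u v z, OF assms(1) p V] AB assms(2,3,8,9) by simp
  qed
  then have eigen: "{z \<in> L_eigenvalues \<alpha> \<beta> A u v. cmod z \<le> E} = {z. exp_sum \<Gamma> d z = 0 \<and> norm z \<le> E}" for E
    by (auto simp: char_eq)
  have \<Gamma>: "finite \<Gamma>" "\<Gamma> \<noteq> {}"
    by (simp_all add: \<Gamma>_def finite_Gamma_set Gamma_set_nonempty)
  have vertex: "\<gamma> extreme_point_of convex hull \<Gamma> \<Longrightarrow> d \<gamma> \<noteq> 0"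
    and simple: "\<gamma> \<in> \<Gamma> \<Longrightarrow> e edge_of convex hull \<Gamma> \<Longrightarrow> \<gamma> \<in> e \<Longrightarrow> \<gamma> extreme_point_of convex hull \<Gamma>" for \<gamma> e
    using assms(11) unfolding generic_def Let_def \<Gamma>_def d_def by blast+
  have two: "card (support_face \<Gamma> \<omega>) \<le> 2" if "norm \<omega> = 1" for \<omega>
    by (rule support_face_generic(2)[OF \<Gamma>(1) that]) (rule simple)
  have nz: "d \<gamma> \<noteq> 0" if "norm \<omega> = 1" "\<gamma> \<in> support_face \<Gamma> \<omega>" for \<omega> \<gamma>
    by (rule vertex[OF support_face_generic(1)[OF \<Gamma>(1) that(1) _ that(2)]]) (rule simple)
  have b_eq: "b x = perimeter (range (\<lambda>i. inverse (a s i)))"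
    if "s \<in> {1..m}" "p (s - 1) < x" "x \<le> p s" for s x
  proof -
    have "matrix_inv (A x) = ?B s"
      using assms(8)[OF that] matrix_inv_unique[OF AB[OF that(1)]] by simp
    then have "matrix_eigenvalues (matrix_inv (A x)) = range (\<lambda>i. inverse (a s i))"
      by (simp add: matrix_eigenvalues_diag_conj[OF V[OF that(1)]])
    then show ?thesis by (simp add: b_def boundary_length_convex_hull)
  qed
  have integral: "(LINT x:{\<alpha>..\<beta>}|lborel. b x) = perimeter \<Gamma>"
    using LINT_step_function[of m p b, OF p b_eq] perimeter_Gamma_set[of m p a, OF p] assms(2,3)
    by (simp add: \<Gamma>_def)
  have "\<exists>B. \<forall>E\<ge>0. \<bar>real (card {z. exp_sum \<Gamma> d z = 0 \<and> norm z \<le> E}) -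
      E / (2 * pi) * perimeter \<Gamma>\<bar> \<le> B"
    by (rule exp_sum_zero_count(2)[OF \<Gamma>]) (fact nz two)+
  then obtain B where B: "\<forall>E\<ge>0. \<bar>real (card {z. exp_sum \<Gamma> d z = 0 \<and> norm z \<le> E}) -
      E / (2 * pi) * perimeter \<Gamma>\<bar> \<le> B"
    by blast
  have "(\<lambda>E. real (N E) - E / (2 * pi) * (LINT x:{\<alpha>..\<beta>}|lborel. b x)) \<in> O[at_top](\<lambda>_. 1)"
  proof (rule bigoI[where c = B])
    show "\<forall>\<^sub>F E in at_top. norm (real (N E) - E / (2 * pi) * (LINT x:{\<alpha>..\<beta>}|lborel. b x)) \<le> B * norm (1 :: real)"
      using eventually_ge_at_top[of "0::real"]
      by eventually_elim (use B in \<open>simp add: N_def eigen integral\<close>)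
  qed
  moreover have "\<forall>E. finite {z \<in> L_eigenvalues \<alpha> \<beta> A u v. cmod z \<le> E}"
    unfolding eigen by (intro allI exp_sum_zero_count(1)[OF \<Gamma>]) (fact nz two)+
  ultimately show ?thesis by blast
qed

end
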